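(* Suppose $(M,F,\mathbb T)$ is a non-compact toric symplectic manifold obtained by the Delzant construction with respect to a simple convex unbounded polytope $P\subset\mathbb R^n$. Let $(g,I,J,f)$ and $(g_K,J_K,f_K)$ be respectively a $\mathbb T$-invariant generalized Kähler-Ricci soliton and a $\mathbb T$-invariant gradient steady Kähler-Ricci soliton on $M$ which are related by an $A$-deformation over $\mathring M$ (that is, $(F,g,I,J)$ satisfies, over $\mathring M$, the hypotheses (1)-(4) listed in the context, $A\in\Lambda^2\mathfrak t$, and $(F,g,I,J)$ is over $\mathring M$ the $A$-deformation of $(F,g_K,J_K)$, with $-\tfrac12J_K\nabla f_K=\tfrac12(X_I+X_J)$). Then $g$ is complete if and only if $g_K$ is complete.
   Context: Delzant setting: $\mathbb T$ is a compact $n$-dimensional torus with Lie algebra $\mathfrak t$, acting effectively and Hamiltonianly on the $2n$-dimensional symplectic manifold $(M,F)$ with proper momentum map $\mu:M\to\mathfrak t^*\cong\mathbb R^n$ whose image is $P$, a closed convex simple polytope with finitely many vertices, $P=\{L_1\ge0,\dots,L_d\ge0\}$, such that at each vertex the differentials of the $n$ affine functions $L_j$ vanishing there form a basis of the lattice of circle subgroups of $\mathbb T$. $\mathring P$ is the interior of $P$ and $\mathring M=\mu^{-1}(\mathring P)$ is the open dense set of points with $n$-dimensional orbits. $\mathfrak t$ is identified with the fundamental vector fields, spanned by $X_1,\dots,X_n$. Conventions. For a metric $g$ with compatible complex structure $J$: $\omega_J(X,Y)=g(JX,Y)$, $d^c_J=\sqrt{-1}(\bar\partial_J-\partial_J)$,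 Lee form $\theta_J$ defined by $d\omega_J^{n-1}=\theta_J\wedge\omega_J^{n-1}$. A generalized Kähler (GK) structure $(g,I,J)$ is a metric with two compatible integrable complex structures with $d^c_I\omega_I=H=-d^c_J\omega_J$, $dH=0$. It is a generalized Kähler-Ricci soliton (GKRS) with potential $f$ if $\mathrm{Rc}^{\nabla^+}+\nabla^+\nabla^+f=0$, $\nabla^+=\nabla+\tfrac12g^{-1}H$; its soliton vector fields are $X_I=\tfrac12I(\theta_I^\sharp-\nabla f)$, $X_J=\tfrac12J(\theta_J^\sharp-\nabla f)$. It is symplectic-type with symplectic form $F$ if $F=-2g(I+J)^{-1}$. A gradient steady Kähler-Ricci soliton (KRS) $(g_K,J_K,f_K)$ is a Kähler structure with $\mathrm{Rc}_{g_K}+\nabla^2f_K=0$; here compatible with $F$: $F=g_K(J_K\cdot,\cdot)$. Hypotheses on $(F,g,I,J,f)$ over $\mathring M$: (1) $\mathfrak t$ is pointwise $n$-dimensional; (2) $X_I,X_J\in\mathfrak t$; (3) $F|_{\mathfrak t\times\mathfrak t}=0$; (4) $I\mathfrak t=J\mathfrak t$ pointwise. $A$-deformation over $\mathring M$: in local coordinates $(t_i,\mu_i)$ with $X_i=\partial_{t_i}$, $F=\sum_i d\mu_i\wedge dt_i$, write $J_K\partial_{\mu_i}=\sum_jG_{ij}\partial_{t_j}$, $J_K\partial_{t_i}=-\sum_j(G^{-1})_{ij}\partial_{\mu_j}$, $G=\mathrm{Hess}(u)(\mu)>0$, $g_K=\sum_{i,j}(G_{ij}d\mu_id\mu_j+(G^{-1})_{ij}dt_idt_j)$.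 For a constant skew matrix $A=(A_{ij})\in\Lambda^2\mathfrak t$ put $\Psi=G+A$; the $A$-deformation is $J\partial_{\mu_i}=\sum_j\Psi_{ij}\partial_{t_j}$, $J\partial_{t_i}=-\sum_j(\Psi^{-1})_{ij}\partial_{\mu_j}$, $I$ given by the same formulas with $\Psi^T$ in place of $\Psi$, $g=\sum_{i,j}(G_{ij}d\mu_id\mu_j+((\Psi^{-1})^s)_{ij}dt_idt_j)$ ($s$ = symmetric part). *)

theory Defs
  imports "HOL-Analysis.Analysis"
begin

section \<open>Smooth functions and manifolds\<close>

primrec C_on :: "nat \<Rightarrow> ('e::real_normed_vector \<Rightarrow> 'f::real_normed_vector) \<Rightarrow> 'e set \<Rightarrow> bool" where
  "C_on 0 f S \<longleftrightarrow> continuous_on S f"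
| "C_on (Suc k) f S \<longleftrightarrow> (\<forall>x\<in>S. f differentiable (at x)) \<and>
     (\<forall>v. C_on k (\<lambda>x. frechet_derivative f (at x) v) S)"

text \<open>Used for open sets only.\<close>
definition smooth_on :: "'e::real_normed_vector set \<Rightarrow> ('e \<Rightarrow> 'f::real_normed_vector) \<Rightarrow> bool" where
  "smooth_on S f \<longleftrightarrow> (\<forall>k. C_on k f S)"

text \<open>The underlying manifold is a whole type \<open>'a\<close>, topologised by its type class. A chart is its
  domain together with its coordinate map, whose values off the domain are irrelevant.\<close>
type_synonym ('a, 'e) chart = "'a set \<times> ('a \<Rightarrow> 'e)"

abbreviation chart_dom :: "('a, 'e) chart \<Rightarrow> 'a set" where "chart_dom \<equiv> fst"
abbreviation chart_map :: "('a, 'e) chart \<Rightarrow> 'a \<Rightarrow> 'e" where "chart_map \<equiv> snd"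

definition chart_inv :: "('a, 'e) chart \<Rightarrow> 'e \<Rightarrow> 'a" where
  "chart_inv c = inv_into (chart_dom c) (chart_map c)"

definition is_chart :: "('a::topological_space, 'e::euclidean_space) chart \<Rightarrow> bool" where
  "is_chart c \<longleftrightarrow> open (chart_dom c) \<and> open (chart_map c ` chart_dom c) \<and>
     homeomorphism (chart_dom c) (chart_map c ` chart_dom c) (chart_map c) (chart_inv c)"

definition smoothly_compatible ::
    "('a, 'e::euclidean_space) chart \<Rightarrow> ('a, 'e) chart \<Rightarrow> bool" where
  "smoothly_compatible c c' \<longleftrightarrow>
     smooth_on (chart_map c ` (chart_dom c \<inter> chart_dom c')) (chart_map c' \<circ> chart_inv c) \<and>
     smooth_on (chart_map c' ` (chart_dom c \<inter> chart_dom c')) (chart_map c \<circ> chart_inv c')"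

definition maximal_atlas :: "('a::topological_space, 'e::euclidean_space) chart set \<Rightarrow> bool" where
  "maximal_atlas \<A> \<longleftrightarrow> (\<forall>c\<in>\<A>. is_chart c) \<and> (\<Union>c\<in>\<A>. chart_dom c) = UNIV \<and>
     (\<forall>c\<in>\<A>. \<forall>c'\<in>\<A>. smoothly_compatible c c') \<and>
     (\<forall>c. is_chart c \<and> (\<forall>c'\<in>\<A>. smoothly_compatible c c') \<longrightarrow> c \<in> \<A>)"

definition smooth_fun :: "('a, 'e::euclidean_space) chart set \<Rightarrow> ('a \<Rightarrow> 'f::real_normed_vector) \<Rightarrow> bool" where
  "smooth_fun \<A> f \<longleftrightarrow> (\<forall>c\<in>\<A>. smooth_on (chart_map c ` chart_dom c) (f \<circ> chart_inv c))"

section \<open>Tensor fields\<close>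

text \<open>A tensor field \<open>T\<close> is given by its components \<open>T c p\<close> at the points \<open>p\<close> of each chart \<open>c\<close>,
  subject to the usual transformation law. The transformation law is invariance under the identity,
  and invariance under a diffeomorphism \<open>\<psi>\<close> is expressed by the same formula.\<close>
type_synonym ('a, 'e) vfield = "('a, 'e) chart \<Rightarrow> 'a \<Rightarrow> 'e"
type_synonym ('a, 'e) endo = "('a, 'e) chart \<Rightarrow> 'a \<Rightarrow> 'e \<Rightarrow> 'e"
type_synonym ('a, 'e) covector = "('a, 'e) chart \<Rightarrow> 'a \<Rightarrow> 'e \<Rightarrow> real"
type_synonym ('a, 'e) bilin = "('a, 'e) chart \<Rightarrow> 'a \<Rightarrow> 'e \<Rightarrow> 'e \<Rightarrow> real"
type_synonym ('a, 'e) trilin = "('a, 'e) chart \<Rightarrow> 'a \<Rightarrow> 'e \<Rightarrow> 'e \<Rightarrow> 'e \<Rightarrow> real"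

definition tangent_map ::
    "('a, 'e::euclidean_space) chart \<Rightarrow> ('a, 'e) chart \<Rightarrow> ('a \<Rightarrow> 'a) \<Rightarrow> 'a \<Rightarrow> 'e \<Rightarrow> 'e" where
  "tangent_map c c' \<psi> p =
     frechet_derivative (chart_map c' \<circ> \<psi> \<circ> chart_inv c) (at (chart_map c p))"

definition preserves_bilin ::
    "('a, 'e::euclidean_space) chart set \<Rightarrow> ('a \<Rightarrow> 'a) \<Rightarrow> ('a, 'e) bilin \<Rightarrow> bool" where
  "preserves_bilin \<A> \<psi> b \<longleftrightarrow>
     (\<forall>c\<in>\<A>. \<forall>c'\<in>\<A>. \<forall>p v w. p \<in> chart_dom c \<and> \<psi> p \<in> chart_dom c' \<longrightarrow>
        b c' (\<psi> p) (tangent_map c c' \<psi> p v) (tangent_map c c' \<psi> p w) = b c p v w)"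

definition preserves_endo ::
    "('a, 'e::euclidean_space) chart set \<Rightarrow> ('a \<Rightarrow> 'a) \<Rightarrow> ('a, 'e) endo \<Rightarrow> bool" where
  "preserves_endo \<A> \<psi> J \<longleftrightarrow>
     (\<forall>c\<in>\<A>. \<forall>c'\<in>\<A>. \<forall>p v. p \<in> chart_dom c \<and> \<psi> p \<in> chart_dom c' \<longrightarrow>
        J c' (\<psi> p) (tangent_map c c' \<psi> p v) = tangent_map c c' \<psi> p (J c p v))"

definition bilin_tensor :: "('a, 'e::euclidean_space) chart set \<Rightarrow> ('a, 'e) bilin \<Rightarrow> bool" where
  "bilin_tensor \<A> b \<longleftrightarrow> preserves_bilin \<A> id b \<and>
     (\<forall>c\<in>\<A>. (\<forall>p\<in>chart_dom c. bilinear (b c p)) \<and>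
        (\<forall>v w. smooth_on (chart_map c ` chart_dom c) (\<lambda>x. b c (chart_inv c x) v w)))"

definition endo_tensor :: "('a, 'e::euclidean_space) chart set \<Rightarrow> ('a, 'e) endo \<Rightarrow> bool" where
  "endo_tensor \<A> J \<longleftrightarrow> preserves_endo \<A> id J \<and>
     (\<forall>c\<in>\<A>. (\<forall>p\<in>chart_dom c. linear (J c p)) \<and>
        (\<forall>v. smooth_on (chart_map c ` chart_dom c) (\<lambda>x. J c (chart_inv c x) v)))"

definition riemannian_metric :: "('a, 'e::euclidean_space) chart set \<Rightarrow> ('a, 'e) bilin \<Rightarrow> bool" where
  "riemannian_metric \<A> g \<longleftrightarrow> bilin_tensor \<A> g \<and>
     (\<forall>c\<in>\<A>. \<forall>p\<in>chart_dom c. (\<forall>v w. g c p v w = g c p w v) \<and> (\<forall>v. v \<noteq> 0 \<longrightarrow> g c p v v > 0))"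

section \<open>Differential forms in a chart\<close>

text \<open>A \<open>k\<close>-form on a vector space takes its arguments from the first \<open>k\<close> entries of a sequence of
  vectors; fields of forms on coordinate space are functions of the point.\<close>
type_synonym 'e form = "(nat \<Rightarrow> 'e) \<Rightarrow> real"

definition wedge :: "nat \<Rightarrow> nat \<Rightarrow> 'e form \<Rightarrow> 'e form \<Rightarrow> 'e form" where
  "wedge k l \<alpha> \<beta> v = (\<Sum>\<sigma> | \<sigma> permutes {..<k+l}.
     of_int (sign \<sigma>) * \<alpha> (\<lambda>i. v (\<sigma> i)) * \<beta> (\<lambda>i. v (\<sigma> (k + i)))) / (fact k * fact l)"

primrec wedge_power :: "nat \<Rightarrow> 'e form \<Rightarrow> 'e form" where
  "wedge_power 0 \<omega> = (\<lambda>v. 1)"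
| "wedge_power (Suc m) \<omega> = wedge 2 (2 * m) \<omega> (wedge_power m \<omega>)"

definition ext_deriv :: "nat \<Rightarrow> ('e::real_normed_vector \<Rightarrow> 'e form) \<Rightarrow> 'e \<Rightarrow> 'e form" where
  "ext_deriv k \<alpha> x v = (\<Sum>i\<le>k. (-1) ^ i *
     frechet_derivative (\<lambda>y. \<alpha> y (\<lambda>j. v (if j < i then j else Suc j))) (at x) (v i))"

definition form2 :: "('a, 'e) bilin \<Rightarrow> ('a, 'e) chart \<Rightarrow> 'e \<Rightarrow> 'e form" where
  "form2 b c x = (\<lambda>v. b c (chart_inv c x) (v 0) (v 1))"

definition form3 :: "('a, 'e) trilin \<Rightarrow> ('a, 'e) chart \<Rightarrow> 'e \<Rightarrow> 'e form" where
  "form3 T c x = (\<lambda>v. T c (chart_inv c x) (v 0) (v 1) (v 2))"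

definition d2 :: "('a, 'e::euclidean_space) bilin \<Rightarrow> ('a, 'e) trilin" where
  "d2 b c p u v w = ext_deriv 2 (form2 b c) (chart_map c p) (\<lambda>i. [u, v, w] ! i)"

definition closed2 :: "('a, 'e::euclidean_space) chart set \<Rightarrow> ('a, 'e) bilin \<Rightarrow> bool" where
  "closed2 \<A> b \<longleftrightarrow> (\<forall>c\<in>\<A>. \<forall>p\<in>chart_dom c. \<forall>v. ext_deriv 2 (form2 b c) (chart_map c p) v = 0)"

definition closed3 :: "('a, 'e::euclidean_space) chart set \<Rightarrow> ('a, 'e) trilin \<Rightarrow> bool" where
  "closed3 \<A> T \<longleftrightarrow> (\<forall>c\<in>\<A>. \<forall>p\<in>chart_dom c. \<forall>v. ext_deriv 3 (form3 T c) (chart_map c p) v = 0)"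

definition symplectic_form :: "('a, 'e::euclidean_space) chart set \<Rightarrow> ('a, 'e) bilin \<Rightarrow> bool" where
  "symplectic_form \<A> F \<longleftrightarrow> bilin_tensor \<A> F \<and> closed2 \<A> F \<and>
     (\<forall>c\<in>\<A>. \<forall>p\<in>chart_dom c. (\<forall>v w. F c p v w = - F c p w v) \<and>
        (\<forall>v. (\<forall>w. F c p v w = 0) \<longrightarrow> v = 0))"

section \<open>Complex structures\<close>

definition lie_bracket :: "('e::real_normed_vector \<Rightarrow> 'e) \<Rightarrow> ('e \<Rightarrow> 'e) \<Rightarrow> 'e \<Rightarrow> 'e" where
  "lie_bracket V W x = frechet_derivative W (at x) (V x) - frechet_derivative V (at x) (W x)"

text \<open>The Nijenhuis tensor, evaluated on the vector fields with constant components \<open>u\<close>, \<open>v\<close>.\<close>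
definition nijenhuis ::
    "('a, 'e::euclidean_space) endo \<Rightarrow> ('a, 'e) chart \<Rightarrow> 'a \<Rightarrow> 'e \<Rightarrow> 'e \<Rightarrow> 'e" where
  "nijenhuis J c p u v =
     (let x = chart_map c p;
          JU = (\<lambda>y. J c (chart_inv c y) u);
          JV = (\<lambda>y. J c (chart_inv c y) v)
      in lie_bracket JU JV x
         - J c p (lie_bracket JU (\<lambda>_. v) x) - J c p (lie_bracket (\<lambda>_. u) JV x)
         - lie_bracket (\<lambda>_. u) (\<lambda>_. v) x)"

definition complex_structure :: "('a, 'e::euclidean_space) chart set \<Rightarrow> ('a, 'e) endo \<Rightarrow> bool" where
  "complex_structure \<A> J \<longleftrightarrow> endo_tensor \<A> J \<and>
     (\<forall>c\<in>\<A>. \<forall>p\<in>chart_dom c. (\<forall>v. J c p (J c p v) = - v) \<and> (\<forall>u v. nijenhuis J c p u v = 0))"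

definition compatible ::
    "('a, 'e::euclidean_space) chart set \<Rightarrow> ('a, 'e) bilin \<Rightarrow> ('a, 'e) endo \<Rightarrow> bool" where
  "compatible \<A> g J \<longleftrightarrow>
     (\<forall>c\<in>\<A>. \<forall>p\<in>chart_dom c. \<forall>v w. g c p (J c p v) (J c p w) = g c p v w)"

definition fund_form :: "('a, 'e) bilin \<Rightarrow> ('a, 'e) endo \<Rightarrow> ('a, 'e) bilin" where
  "fund_form g J c p v w = g c p (J c p v) w"

text \<open>Complex tangent vectors are pairs (real part, imaginary part); \<open>complexify3\<close> is the complex
  multilinear extension of a real trilinear form.\<close>
definition complexify3 ::
    "('e \<Rightarrow> 'e \<Rightarrow> 'e \<Rightarrow> real) \<Rightarrow> 'e \<times> 'e \<Rightarrow> 'e \<times> 'e \<Rightarrow> 'e \<times> 'e \<Rightarrow> complex" where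
  "complexify3 \<beta> X Y Z = Complex
     (\<beta> (fst X) (fst Y) (fst Z) - \<beta> (fst X) (snd Y) (snd Z)
        - \<beta> (snd X) (fst Y) (snd Z) - \<beta> (snd X) (snd Y) (fst Z))
     (\<beta> (snd X) (fst Y) (fst Z) + \<beta> (fst X) (snd Y) (fst Z)
        + \<beta> (fst X) (fst Y) (snd Z) - \<beta> (snd X) (snd Y) (snd Z))"

text \<open>The projections of a real vector to the \<open>\<i>\<close>- and \<open>-\<i>\<close>-eigenspaces of \<open>J\<close>.\<close>
definition proj10 :: "('e::real_vector \<Rightarrow> 'e) \<Rightarrow> 'e \<Rightarrow> 'e \<times> 'e" where
  "proj10 J X = ((1/2) *\<^sub>R X, - ((1/2) *\<^sub>R J X))"

definition proj01 :: "('e::real_vector \<Rightarrow> 'e) \<Rightarrow> 'e \<Rightarrow> 'e \<times> 'e" where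
  "proj01 J X = ((1/2) *\<^sub>R X, (1/2) *\<^sub>R J X)"

definition part21 ::
    "('e::real_vector \<Rightarrow> 'e) \<Rightarrow> ('e \<Rightarrow> 'e \<Rightarrow> 'e \<Rightarrow> real) \<Rightarrow> 'e \<Rightarrow> 'e \<Rightarrow> 'e \<Rightarrow> complex" where
  "part21 J \<beta> X Y Z = complexify3 \<beta> (proj10 J X) (proj10 J Y) (proj01 J Z)
     + complexify3 \<beta> (proj10 J X) (proj01 J Y) (proj10 J Z)
     + complexify3 \<beta> (proj01 J X) (proj10 J Y) (proj10 J Z)"

definition part12 ::
    "('e::real_vector \<Rightarrow> 'e) \<Rightarrow> ('e \<Rightarrow> 'e \<Rightarrow> 'e \<Rightarrow> real) \<Rightarrow> 'e \<Rightarrow> 'e \<Rightarrow> 'e \<Rightarrow> complex" where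
  "part12 J \<beta> X Y Z = complexify3 \<beta> (proj01 J X) (proj01 J Y) (proj10 J Z)
     + complexify3 \<beta> (proj01 J X) (proj10 J Y) (proj01 J Z)
     + complexify3 \<beta> (proj10 J X) (proj01 J Y) (proj01 J Z)"

text \<open>\<open>d\<^sup>c = \<i>(\<partial>-bar - \<partial>)\<close> on a real (1,1)-form \<open>b\<close>, for which \<open>\<partial>b\<close> and \<open>\<partial>-bar b\<close> are the
  (2,1)- and (1,2)-parts of \<open>db\<close>.\<close>
definition dc :: "('a, 'e::euclidean_space) endo \<Rightarrow> ('a, 'e) bilin
    \<Rightarrow> ('a, 'e) chart \<Rightarrow> 'a \<Rightarrow> 'e \<Rightarrow> 'e \<Rightarrow> 'e \<Rightarrow> complex" where
  "dc J b c p X Y Z = \<i> * (part12 (J c p) (d2 b c p) X Y Z - part21 (J c p) (d2 b c p) X Y Z)"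

section \<open>Connections and solitons\<close>

definition sharp :: "('e \<Rightarrow> 'e \<Rightarrow> real) \<Rightarrow> ('e \<Rightarrow> real) \<Rightarrow> 'e" where
  "sharp b \<alpha> = (THE v. \<forall>w. b v w = \<alpha> w)"

definition differential :: "('a \<Rightarrow> real) \<Rightarrow> ('a, 'e::euclidean_space) covector" where
  "differential f c p = frechet_derivative (f \<circ> chart_inv c) (at (chart_map c p))"

definition gradient :: "('a, 'e::euclidean_space) bilin \<Rightarrow> ('a \<Rightarrow> real) \<Rightarrow> ('a, 'e) vfield" where
  "gradient g f c p = sharp (g c p) (differential f c p)"

text \<open>A connection is given in a chart by \<open>\<nabla>\<^bsub>u\<^esub> W = D\<^bsub>u\<^esub> W + \<Gamma>(u, W)\<close>.\<close>
definition levi_civita ::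
    "('a, 'e::euclidean_space) bilin \<Rightarrow> ('a, 'e) chart \<Rightarrow> 'e \<Rightarrow> 'e \<Rightarrow> 'e \<Rightarrow> 'e" where
  "levi_civita g c x u v = sharp (g c (chart_inv c x)) (\<lambda>w.
     (frechet_derivative (\<lambda>y. g c (chart_inv c y) v w) (at x) u
      + frechet_derivative (\<lambda>y. g c (chart_inv c y) u w) (at x) v
      - frechet_derivative (\<lambda>y. g c (chart_inv c y) u v) (at x) w) / 2)"

definition bismut :: "('a, 'e::euclidean_space) bilin \<Rightarrow> ('a, 'e) trilin
    \<Rightarrow> ('a, 'e) chart \<Rightarrow> 'e \<Rightarrow> 'e \<Rightarrow> 'e \<Rightarrow> 'e" where
  "bismut g H c x u v = levi_civita g c x u v
     + (1/2) *\<^sub>R sharp (g c (chart_inv c x)) (\<lambda>w. H c (chart_inv c x) u v w)"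

definition curvature :: "('e::euclidean_space \<Rightarrow> 'e \<Rightarrow> 'e \<Rightarrow> 'e) \<Rightarrow> 'e \<Rightarrow> 'e \<Rightarrow> 'e \<Rightarrow> 'e \<Rightarrow> 'e" where
  "curvature \<Gamma> x u v w =
     frechet_derivative (\<lambda>y. \<Gamma> y v w) (at x) u - frechet_derivative (\<lambda>y. \<Gamma> y u w) (at x) v
     + \<Gamma> x u (\<Gamma> x v w) - \<Gamma> x v (\<Gamma> x u w)"

text \<open>The trace of \<open>u \<mapsto> R(u, v)w\<close>; the order of the arguments matters, since the Ricci tensor of a
  connection with torsion need not be symmetric.\<close>
definition ricci :: "('e::euclidean_space \<Rightarrow> 'e \<Rightarrow> 'e \<Rightarrow> 'e) \<Rightarrow> 'e \<Rightarrow> 'e \<Rightarrow> 'e \<Rightarrow> real" where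
  "ricci \<Gamma> x v w = (\<Sum>b\<in>Basis. curvature \<Gamma> x b v w \<bullet> b)"

text \<open>\<open>(\<nabla>\<nabla>f)(u, v) = u(v f) - (\<nabla>\<^bsub>u\<^esub> v) f\<close>.\<close>
definition hessian :: "('e::euclidean_space \<Rightarrow> 'e \<Rightarrow> 'e \<Rightarrow> 'e) \<Rightarrow> ('e \<Rightarrow> real) \<Rightarrow> 'e \<Rightarrow> 'e \<Rightarrow> 'e \<Rightarrow> real" where
  "hessian \<Gamma> h x u v = frechet_derivative (\<lambda>y. frechet_derivative h (at y) v) (at x) u
     - frechet_derivative h (at x) (\<Gamma> x u v)"

definition generalized_kahler :: "('a, 'e::euclidean_space) chart set \<Rightarrow> ('a, 'e) bilin
    \<Rightarrow> ('a, 'e) endo \<Rightarrow> ('a, 'e) endo \<Rightarrow> ('a, 'e) trilin \<Rightarrow> bool" where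
  "generalized_kahler \<A> g I J H \<longleftrightarrow> riemannian_metric \<A> g \<and>
     complex_structure \<A> I \<and> compatible \<A> g I \<and> complex_structure \<A> J \<and> compatible \<A> g J \<and>
     (\<forall>c\<in>\<A>. \<forall>p\<in>chart_dom c. \<forall>X Y Z.
        dc I (fund_form g I) c p X Y Z = of_real (H c p X Y Z) \<and>
        - dc J (fund_form g J) c p X Y Z = of_real (H c p X Y Z)) \<and>
     closed3 \<A> H"

definition gk_ricci_soliton :: "('a, 'e::euclidean_space) chart set \<Rightarrow> ('a, 'e) bilin
    \<Rightarrow> ('a, 'e) endo \<Rightarrow> ('a, 'e) endo \<Rightarrow> ('a \<Rightarrow> real) \<Rightarrow> bool" where
  "gk_ricci_soliton \<A> g I J f \<longleftrightarrow> smooth_fun \<A> f \<and>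
     (\<exists>H. generalized_kahler \<A> g I J H \<and>
        (\<forall>c\<in>\<A>. \<forall>p\<in>chart_dom c. \<forall>u v.
           ricci (bismut g H c) (chart_map c p) u v
           + hessian (bismut g H c) (f \<circ> chart_inv c) (chart_map c p) u v = 0))"

definition kahler :: "('a, 'e::euclidean_space) chart set \<Rightarrow> ('a, 'e) bilin \<Rightarrow> ('a, 'e) endo \<Rightarrow> bool" where
  "kahler \<A> g J \<longleftrightarrow> riemannian_metric \<A> g \<and> complex_structure \<A> J \<and> compatible \<A> g J \<and>
     closed2 \<A> (fund_form g J)"

definition kahler_ricci_soliton :: "('a, 'e::euclidean_space) chart set \<Rightarrow> ('a, 'e) bilin
    \<Rightarrow> ('a, 'e) endo \<Rightarrow> ('a \<Rightarrow> real) \<Rightarrow> bool" where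
  "kahler_ricci_soliton \<A> g J f \<longleftrightarrow> kahler \<A> g J \<and> smooth_fun \<A> f \<and>
     (\<forall>c\<in>\<A>. \<forall>p\<in>chart_dom c. \<forall>u v.
        ricci (levi_civita g c) (chart_map c p) u v
        + hessian (levi_civita g c) (f \<circ> chart_inv c) (chart_map c p) u v = 0)"

text \<open>\<open>\<theta>\<close> with \<open>d\<omega>\<^bsup>m-1\<^esup> = \<theta> \<and> \<omega>\<^bsup>m-1\<^esup>\<close>, where \<open>2m\<close> is the real dimension; it is unique as \<open>\<omega>\<close> is
  nondegenerate.\<close>
definition lee_form :: "('a, 'e::euclidean_space) bilin \<Rightarrow> ('a, 'e) endo \<Rightarrow> ('a, 'e) covector" where
  "lee_form g J c p =
     (let m = DIM('e) div 2; x = chart_map c p;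
          \<Omega> = (\<lambda>y. wedge_power (m - 1) (form2 (fund_form g J) c y))
      in THE \<theta>. linear \<theta> \<and>
           (\<forall>v. ext_deriv (2 * (m - 1)) \<Omega> x v = wedge 1 (2 * (m - 1)) (\<lambda>v. \<theta> (v 0)) (\<Omega> x) v))"

definition soliton_field ::
    "('a, 'e::euclidean_space) bilin \<Rightarrow> ('a, 'e) endo \<Rightarrow> ('a \<Rightarrow> real) \<Rightarrow> ('a, 'e) vfield" where
  "soliton_field g J f c p =
     (1/2) *\<^sub>R J c p (sharp (g c p) (lee_form g J c p) - gradient g f c p)"

definition symplectic_type :: "('a, 'e::euclidean_space) chart set \<Rightarrow> ('a, 'e) bilin
    \<Rightarrow> ('a, 'e) endo \<Rightarrow> ('a, 'e) endo \<Rightarrow> ('a, 'e) bilin \<Rightarrow> bool" where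
  "symplectic_type \<A> g I J F \<longleftrightarrow>
     (\<forall>c\<in>\<A>. \<forall>p\<in>chart_dom c. bij (\<lambda>v. I c p v + J c p v) \<and>
        (\<forall>v w. F c p v w = - 2 * g c p (inv (\<lambda>v. I c p v + J c p v) v) w))"

section \<open>Completeness\<close>

definition C1_curve :: "('a, 'e::euclidean_space) chart set \<Rightarrow> (real \<Rightarrow> 'a) \<Rightarrow> real \<Rightarrow> real \<Rightarrow> bool" where
  "C1_curve \<A> \<gamma> a b \<longleftrightarrow>
     (\<forall>c\<in>\<A>. \<exists>D. (\<forall>t\<in>{s\<in>{a..b}. \<gamma> s \<in> chart_dom c}.
          ((chart_map c \<circ> \<gamma>) has_vector_derivative D t) (at t within {a..b})) \<and>
        continuous_on {s\<in>{a..b}. \<gamma> s \<in> chart_dom c} D)"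

definition piecewise_C1_curve ::
    "('a::topological_space, 'e::euclidean_space) chart set \<Rightarrow> (real \<Rightarrow> 'a) \<Rightarrow> bool" where
  "piecewise_C1_curve \<A> \<gamma> \<longleftrightarrow> continuous_on {0..1} \<gamma> \<and>
     (\<exists>m \<tau>. \<tau> 0 = 0 \<and> \<tau> (m::nat) = 1 \<and>
        (\<forall>i<m. \<tau> i < \<tau> (Suc i) \<and> C1_curve \<A> \<gamma> (\<tau> i) (\<tau> (Suc i))))"

text \<open>The speed does not depend on the chart. The break points of a curve form a null set.\<close>
definition speed ::
    "('a, 'e::euclidean_space) chart set \<Rightarrow> ('a, 'e) bilin \<Rightarrow> (real \<Rightarrow> 'a) \<Rightarrow> real \<Rightarrow> real" where
  "speed \<A> g \<gamma> t =
     (let c = (SOME c. c \<in> \<A> \<and> \<gamma> t \<in> chart_dom c);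
          v = vector_derivative (chart_map c \<circ> \<gamma>) (at t)
      in sqrt (g c (\<gamma> t) v v))"

definition riemannian_dist :: "('a::topological_space, 'e::euclidean_space) chart set
    \<Rightarrow> ('a, 'e) bilin \<Rightarrow> 'a \<Rightarrow> 'a \<Rightarrow> real" where
  "riemannian_dist \<A> g p q =
     Inf {integral {0..1} (speed \<A> g \<gamma>) | \<gamma>. piecewise_C1_curve \<A> \<gamma> \<and> \<gamma> 0 = p \<and> \<gamma> 1 = q}"

definition complete_metric ::
    "('a::topological_space, 'e::euclidean_space) chart set \<Rightarrow> ('a, 'e) bilin \<Rightarrow> bool" where
  "complete_metric \<A> g \<longleftrightarrow>
     (\<forall>\<sigma>::nat \<Rightarrow> 'a.
        (\<forall>\<epsilon>>0. \<exists>N. \<forall>m\<ge>N. \<forall>n\<ge>N. riemannian_dist \<A> g (\<sigma> m) (\<sigma> n) < \<epsilon>) \<longrightarrow>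
        (\<exists>p. (\<lambda>n. riemannian_dist \<A> g (\<sigma> n) p) \<longlonglongrightarrow> 0))"

section \<open>Toric symplectic manifolds\<close>

text \<open>The torus is \<open>\<real>\<^sup>n / (2\<pi>\<int>)\<^sup>n\<close>: a basis of the lattice of circle subgroups identifies its Lie
  algebra with \<open>\<real>\<^sup>n\<close>. An action is given as an action of the Lie algebra through the exponential
  map. It is effective iff exactly the elements of \<open>(2\<pi>\<int>)\<^sup>n\<close> act trivially.\<close>
definition int_lattice :: "(real ^ 'n) set" where
  "int_lattice = {v. \<forall>i. v $ i \<in> \<int>}"

definition effective_torus_action ::
    "('a::topological_space, 'e::euclidean_space) chart set \<Rightarrow> (real ^ 'n \<Rightarrow> 'a \<Rightarrow> 'a) \<Rightarrow> bool" where
  "effective_torus_action \<A> act \<longleftrightarrow>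
     act 0 = id \<and> (\<forall>s t. act (s + t) = act s \<circ> act t) \<and>
     (\<forall>s. act s = id \<longleftrightarrow> s \<in> (\<lambda>v. (2 * pi) *\<^sub>R v) ` int_lattice) \<and>
     continuous_on UNIV (\<lambda>(s, p). act s p) \<and>
     (\<forall>c\<in>\<A>. \<forall>c'\<in>\<A>. smooth_on
        {(s, x). x \<in> chart_map c ` chart_dom c \<and> act s (chart_inv c x) \<in> chart_dom c'}
        (\<lambda>(s, x). chart_map c' (act s (chart_inv c x))))"

definition fund_field ::
    "(real ^ 'n \<Rightarrow> 'a \<Rightarrow> 'a) \<Rightarrow> real ^ 'n \<Rightarrow> ('a, 'e::euclidean_space) vfield" where
  "fund_field act \<xi> c p = vector_derivative (\<lambda>s. chart_map c (act (s *\<^sub>R \<xi>) p)) (at 0)"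

text \<open>The sign in the moment map equation is the one for which
  \<open>F = \<Sum>\<^sub>i d\<mu>\<^sub>i \<and> dt\<^sub>i\<close> when \<open>X\<^sub>i = \<partial>/\<partial>t\<^sub>i\<close>.\<close>
definition moment_map :: "('a, 'e::euclidean_space) chart set \<Rightarrow> ('a, 'e) bilin
    \<Rightarrow> (real ^ 'n \<Rightarrow> 'a \<Rightarrow> 'a) \<Rightarrow> ('a \<Rightarrow> real ^ 'n) \<Rightarrow> bool" where
  "moment_map \<A> F act \<mu> \<longleftrightarrow> smooth_fun \<A> \<mu> \<and> (\<forall>s p. \<mu> (act s p) = \<mu> p) \<and>
     (\<forall>c\<in>\<A>. \<forall>p\<in>chart_dom c. \<forall>\<xi> v.
        F c p (fund_field act \<xi> c p) v = - differential (\<lambda>q. \<mu> q \<bullet> \<xi>) c p v)"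

text \<open>The polyhedron \<open>{L\<^sub>1 \<ge> 0, \<dots>, L\<^sub>d \<ge> 0}\<close> for \<open>L\<^sub>j x = u\<^sub>j \<bullet> x + \<lambda>\<^sub>j\<close>.\<close>
definition label :: "('d \<Rightarrow> real ^ 'n) \<Rightarrow> ('d \<Rightarrow> real) \<Rightarrow> 'd \<Rightarrow> real ^ 'n \<Rightarrow> real" where
  "label u l j x = u j \<bullet> x + l j"

definition polytope_of :: "('d \<Rightarrow> real ^ 'n) \<Rightarrow> ('d \<Rightarrow> real) \<Rightarrow> (real ^ 'n) set" where
  "polytope_of u l = {x. \<forall>j. label u l j x \<ge> 0}"

definition delzant_polytope :: "('d::finite \<Rightarrow> real ^ 'n) \<Rightarrow> ('d \<Rightarrow> real) \<Rightarrow> bool" where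
  "delzant_polytope u l \<longleftrightarrow>
     (\<forall>x. x extreme_point_of (polytope_of u l) \<longrightarrow>
        (let S = {j. label u l j x = 0}
         in card S = CARD('n) \<and> (\<forall>j\<in>S. u j \<in> int_lattice) \<and>
            (\<forall>z\<in>int_lattice. \<exists>!k::'d \<Rightarrow> int. (\<forall>j. j \<notin> S \<longrightarrow> k j = 0) \<and>
               z = (\<Sum>j\<in>S. of_int (k j) *\<^sub>R u j))))"

definition hamiltonian_toric_manifold ::
    "('a::topological_space, 'e::euclidean_space) chart set \<Rightarrow> ('a, 'e) bilin
    \<Rightarrow> (real ^ 'n \<Rightarrow> 'a \<Rightarrow> 'a) \<Rightarrow> ('a \<Rightarrow> real ^ 'n) \<Rightarrow> (real ^ 'n) set \<Rightarrow> bool" where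
  "hamiltonian_toric_manifold \<A> F act \<mu> P \<longleftrightarrow>
     maximal_atlas \<A> \<and> connected (UNIV :: 'a set) \<and> symplectic_form \<A> F \<and>
     effective_torus_action \<A> act \<and> (\<forall>s. preserves_bilin \<A> (act s) F) \<and> moment_map \<A> F act \<mu> \<and>
     (\<forall>K. compact K \<longrightarrow> compact (\<mu> -` K)) \<and> range \<mu> = P"

text \<open>Delzant's construction: \<open>M\<close> is the symplectic quotient of \<open>\<complex>\<^sup>d\<close>, with its standard symplectic
  form \<open>\<Sum>\<^sub>j dx\<^sub>j \<and> dy\<^sub>j\<close> and moment map \<open>(|z\<^sub>j|\<^sup>2/2)\<^sub>j\<close>, by the kernel \<open>K\<close> of the homomorphism of tori
  \<open>s \<mapsto> \<Sum>\<^sub>j s\<^sub>j u\<^sub>j\<close>. The level set of the moment map of \<open>K\<close> consists of the \<open>z\<close> such that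
  \<open>(|z\<^sub>j|\<^sup>2/2)\<^sub>j = (L\<^sub>j x)\<^sub>j\<close> for some \<open>x\<close>, and this \<open>x\<close> is the value of \<open>\<mu>\<close> on the quotient.\<close>
definition delzant_level :: "('d::finite \<Rightarrow> real ^ 'n) \<Rightarrow> ('d \<Rightarrow> real) \<Rightarrow> (complex ^ 'd) set" where
  "delzant_level u l = {z. \<exists>x. \<forall>j. (cmod (z $ j))\<^sup>2 / 2 = label u l j x}"

definition delzant_level_tangent :: "('d::finite \<Rightarrow> real ^ 'n) \<Rightarrow> complex ^ 'd \<Rightarrow> (complex ^ 'd) set" where
  "delzant_level_tangent u z = {v. \<exists>y. \<forall>j. Re (cnj (z $ j) * v $ j) = u j \<bullet> y}"

definition torus_rotate :: "('d::finite \<Rightarrow> real) \<Rightarrow> complex ^ 'd \<Rightarrow> complex ^ 'd" where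
  "torus_rotate s z = (\<chi> j. cis (s j) * z $ j)"

text \<open>The quotient map \<open>\<pi>\<close> is a smooth submersion on the level set, in the sense of local smooth
  extensions \<open>h\<close> of its chart representations, and pulls \<open>F\<close> back to the standard form.\<close>
definition delzant_quotient_map ::
    "('a::topological_space, 'e::euclidean_space) chart set \<Rightarrow> ('a, 'e) bilin
    \<Rightarrow> (real ^ 'n \<Rightarrow> 'a \<Rightarrow> 'a) \<Rightarrow> ('a \<Rightarrow> real ^ 'n)
    \<Rightarrow> ('d::finite \<Rightarrow> real ^ 'n) \<Rightarrow> ('d \<Rightarrow> real) \<Rightarrow> (complex ^ 'd \<Rightarrow> 'a) \<Rightarrow> bool" where
  "delzant_quotient_map \<A> F act \<mu> u l \<pi> \<longleftrightarrow>
     (let Z = delzant_level u l in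
      \<pi> ` Z = UNIV \<and>
      (\<forall>z\<in>Z. \<forall>w\<in>Z. \<pi> z = \<pi> w \<longleftrightarrow>
         (\<exists>s. (\<Sum>j\<in>UNIV. s j *\<^sub>R u j) \<in> (\<lambda>v. (2 * pi) *\<^sub>R v) ` int_lattice \<and> w = torus_rotate s z)) \<and>
      (\<forall>z\<in>Z. \<forall>s. \<pi> (torus_rotate s z) = act (\<Sum>j\<in>UNIV. s j *\<^sub>R u j) (\<pi> z)) \<and>
      (\<forall>z\<in>Z. \<forall>j. (cmod (z $ j))\<^sup>2 / 2 = label u l j (\<mu> (\<pi> z))) \<and>
      (\<forall>z\<in>Z. \<forall>c\<in>\<A>. \<pi> z \<in> chart_dom c \<longrightarrow>
         (\<exists>W h. open W \<and> z \<in> W \<and> smooth_on W h \<and>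
            (\<forall>w\<in>W \<inter> Z. \<pi> w \<in> chart_dom c \<and> h w = chart_map c (\<pi> w)) \<and>
            frechet_derivative h (at z) ` delzant_level_tangent u z = UNIV \<and>
            (\<forall>v\<in>delzant_level_tangent u z. \<forall>w\<in>delzant_level_tangent u z.
               F c (\<pi> z) (frechet_derivative h (at z) v) (frechet_derivative h (at z) w)
               = (\<Sum>j\<in>UNIV. Im (cnj (v $ j) * w $ j))))))"

definition delzant_manifold ::
    "('a::topological_space, 'e::euclidean_space) chart set \<Rightarrow> ('a, 'e) bilin
    \<Rightarrow> (real ^ 'n \<Rightarrow> 'a \<Rightarrow> 'a) \<Rightarrow> ('a \<Rightarrow> real ^ 'n)
    \<Rightarrow> ('d::finite \<Rightarrow> real ^ 'n) \<Rightarrow> ('d \<Rightarrow> real) \<Rightarrow> bool" where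
  "delzant_manifold \<A> F act \<mu> u l \<longleftrightarrow> delzant_polytope u l \<and>
     hamiltonian_toric_manifold \<A> F act \<mu> (polytope_of u l) \<and>
     (\<exists>\<pi>. delzant_quotient_map \<A> F act \<mu> u l \<pi>)"

text \<open>\<open>M0 = \<mu>\<^sup>-\<^sup>1(interior P)\<close> in the following.\<close>
definition toric_hypotheses :: "('a, 'e::euclidean_space) chart set \<Rightarrow> 'a set
    \<Rightarrow> (real ^ 'n \<Rightarrow> 'a \<Rightarrow> 'a) \<Rightarrow> ('a, 'e) bilin \<Rightarrow> ('a, 'e) bilin
    \<Rightarrow> ('a, 'e) endo \<Rightarrow> ('a, 'e) endo \<Rightarrow> ('a \<Rightarrow> real) \<Rightarrow> bool" where
  "toric_hypotheses \<A> M0 act F g I J f \<longleftrightarrow>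
     (\<forall>c\<in>\<A>. \<forall>p\<in>chart_dom c \<inter> M0. dim (range (\<lambda>\<xi>. fund_field act \<xi> c p)) = CARD('n)) \<and>
     (\<exists>\<xi>. \<forall>c\<in>\<A>. \<forall>p\<in>chart_dom c \<inter> M0. soliton_field g I f c p = fund_field act \<xi> c p) \<and>
     (\<exists>\<xi>. \<forall>c\<in>\<A>. \<forall>p\<in>chart_dom c \<inter> M0. soliton_field g J f c p = fund_field act \<xi> c p) \<and>
     (\<forall>c\<in>\<A>. \<forall>p\<in>chart_dom c \<inter> M0. \<forall>\<xi> \<eta>. F c p (fund_field act \<xi> c p) (fund_field act \<eta> c p) = 0) \<and>
     (\<forall>c\<in>\<A>. \<forall>p\<in>chart_dom c \<inter> M0.
        range (\<lambda>\<xi>. I c p (fund_field act \<xi> c p)) = range (\<lambda>\<xi>. J c p (fund_field act \<xi> c p)))"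

section \<open>A-deformations\<close>

definition hess_matrix :: "(real ^ 'n \<Rightarrow> real) \<Rightarrow> real ^ 'n \<Rightarrow> real ^ 'n ^ 'n" where
  "hess_matrix h x = (\<chi> i j. frechet_derivative
     (\<lambda>y. frechet_derivative h (at y) (axis j 1)) (at x) (axis i 1))"

text \<open>Coordinates \<open>(t, \<mu>)\<close> take values in \<open>\<real>\<^sup>n \<times> \<real>\<^sup>n\<close>.\<close>
definition dt :: "'n::finite \<Rightarrow> (real ^ 'n) \<times> (real ^ 'n)" where
  "dt i = (axis i 1, 0)"

definition dmu :: "'n::finite \<Rightarrow> (real ^ 'n) \<times> (real ^ 'n)" where
  "dmu i = (0, axis i 1)"

definition momentum_angle_chart :: "('a, (real ^ 'n) \<times> (real ^ 'n)) chart \<Rightarrow> ('a, (real ^ 'n) \<times> (real ^ 'n)) bilin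
    \<Rightarrow> (real ^ 'n \<Rightarrow> 'a \<Rightarrow> 'a) \<Rightarrow> ('a \<Rightarrow> real ^ 'n) \<Rightarrow> bool" where
  "momentum_angle_chart c F act \<mu> \<longleftrightarrow>
     (\<forall>p\<in>chart_dom c. snd (chart_map c p) = \<mu> p \<and>
        (\<forall>i. fund_field act (axis i 1) c p = dt i) \<and>
        (\<forall>v w. F c p v w = (\<Sum>i\<in>UNIV. snd v $ i * fst w $ i - fst v $ i * snd w $ i)))"

definition endo_from_matrix ::
    "((real ^ 'n) \<times> (real ^ 'n) \<Rightarrow> (real ^ 'n) \<times> (real ^ 'n)) \<Rightarrow> real ^ 'n ^ 'n \<Rightarrow> bool" where
  "endo_from_matrix J \<Psi> \<longleftrightarrow>
     (\<forall>i. J (dmu i) = (\<Sum>j\<in>UNIV. \<Psi> $ i $ j *\<^sub>R dt j) \<and>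
          J (dt i) = - (\<Sum>j\<in>UNIV. matrix_inv \<Psi> $ i $ j *\<^sub>R dmu j))"

definition metric_from_matrices :: "((real ^ 'n) \<times> (real ^ 'n) \<Rightarrow> (real ^ 'n) \<times> (real ^ 'n) \<Rightarrow> real)
    \<Rightarrow> real ^ 'n ^ 'n \<Rightarrow> real ^ 'n ^ 'n \<Rightarrow> bool" where
  "metric_from_matrices g G E \<longleftrightarrow>
     (\<forall>v w. g v w = (\<Sum>i\<in>UNIV. \<Sum>j\<in>UNIV.
        G $ i $ j * snd v $ i * snd w $ j + E $ i $ j * fst v $ i * fst w $ j))"

definition sym_part :: "real ^ 'n ^ 'n \<Rightarrow> real ^ 'n ^ 'n" where
  "sym_part B = (1/2) *\<^sub>R (B + transpose B)"

text \<open>\<open>h\<close> is the symplectic potential of \<open>(gK, JK)\<close> on the interior \<open>U\<close> of the polytope.\<close>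
definition A_deformation :: "('a, (real ^ 'n) \<times> (real ^ 'n)) chart set
    \<Rightarrow> ('a, (real ^ 'n) \<times> (real ^ 'n)) bilin \<Rightarrow> (real ^ 'n \<Rightarrow> 'a \<Rightarrow> 'a) \<Rightarrow> ('a \<Rightarrow> real ^ 'n)
    \<Rightarrow> (real ^ 'n) set \<Rightarrow> real ^ 'n ^ 'n
    \<Rightarrow> ('a, (real ^ 'n) \<times> (real ^ 'n)) bilin \<Rightarrow> ('a, (real ^ 'n) \<times> (real ^ 'n)) endo
    \<Rightarrow> ('a, (real ^ 'n) \<times> (real ^ 'n)) bilin \<Rightarrow> ('a, (real ^ 'n) \<times> (real ^ 'n)) endo
    \<Rightarrow> ('a, (real ^ 'n) \<times> (real ^ 'n)) endo \<Rightarrow> bool" where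
  "A_deformation \<A> F act \<mu> U A gK JK g I J \<longleftrightarrow>
     (\<exists>h. smooth_on U h \<and> (\<forall>x\<in>U. \<forall>w. w \<noteq> 0 \<longrightarrow> w \<bullet> (hess_matrix h x *v w) > 0) \<and>
        (\<forall>p\<in>\<mu> -` U. \<exists>c\<in>\<A>. p \<in> chart_dom c \<and> chart_dom c \<subseteq> \<mu> -` U \<and>
           momentum_angle_chart c F act \<mu> \<and>
           (\<forall>q\<in>chart_dom c.
              let G = hess_matrix h (\<mu> q); \<Psi> = G + A in
                endo_from_matrix (JK c q) G \<and>
                metric_from_matrices (gK c q) G (matrix_inv G) \<and>
                endo_from_matrix (J c q) \<Psi> \<and>
                endo_from_matrix (I c q) (transpose \<Psi>) \<and>
                metric_from_matrices (g c q) G (sym_part (matrix_inv \<Psi>)))))"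

end

theory Submission
  imports Defs
begin

text \<open>Write \<open>d\<close> and \<open>d\<^sub>K\<close> for the distances of \<open>g\<close> and \<open>gK\<close>, and \<open>M0\<close> for the set of points that
  \<open>\<mu>\<close> maps to the interior of the polytope. On \<open>M0\<close> both metrics have the same \<open>d\<mu>\<close>-part \<open>G\<close>, and the symmetric part of
  \<open>(G + A)\<^sup>-\<^sup>1\<close> lies between \<open>0\<close> and \<open>G\<^sup>-\<^sup>1\<close>. Hence \<open>d \<le> d\<^sub>K\<close>. Conversely, rotating a curve along the torus
  orbits makes it \<open>gK\<close>-orthogonal to them without changing its \<open>d\<mu>\<close>-part, so the \<open>d\<^sub>K\<close>-distance
  between two torus orbits is at most the \<open>d\<close>-distance between any of their points. As the torus is
  compact, Cauchy sequences for either distance have subsequences that converge in \<open>M\<close> as soon as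
  the other distance is complete.

  Both comparisons are made for distance functions rather than for curves: a function on \<open>M\<close> is
  1-Lipschitz for \<open>d\<close> once its directional upper slopes are bounded by the \<open>g\<close>-norm. Such a bound
  passes from \<open>M0\<close> to the rest of \<open>M\<close>, because in a chart at a boundary point a dense set of
  directions points into \<open>M0\<close>, so no curve has to be perturbed off the boundary.\<close>

section \<open>Charts\<close>

text \<open>The metrics can be compared on \<open>M0\<close> only, and a curve may stay outside
  \<open>M0\<close> for its whole length; hence the detour through slopes of functions. That good
  directions are dense at a boundary point rests on the labels vanishing there, composed with
  \<open>\<mu>\<close>. They are smooth and nonnegative, so their first derivatives vanish and their
  second derivatives are positive semidefinite; a ray enters \<open>M0\<close> as soon as all these
  forms are positive on it. Smoothness and sign alone would allow zeros with vanishing second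
  derivative. Delzant's quotient rules them out: upstairs the labels are \<open>|z_j|^2 / 2\<close>,
  with zeros of order two. One displacement \<open>e\<close> on which all forms are positive is then
  enough, because the form of each label is positive on \<open>v + \<delta> e\<close> for all but at
  most one \<open>\<delta>\<close>.

  The rotation of curves is infinitesimal as well: the \<open>gK\<close>-distance to a torus orbit
  is an invariant function, so a bound on its slope along \<open>v\<close> may be taken after
  removing the angular part of \<open>v\<close>. This comparison forgets the position within an
  orbit, which is why torus elements have to be chosen along a Cauchy sequence.\<close>

abbreviation chart_image :: "('a, 'e) chart \<Rightarrow> 'e set" where
  "chart_image c \<equiv> chart_map c ` chart_dom c"

lemma is_chart_homeo:
  assumes "is_chart c"
  shows is_chart_open_dom: "open (chart_dom c)"
    and is_chart_open_image: "open (chart_image c)"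
    and is_chart_inv_map: "\<And>p. p \<in> chart_dom c \<Longrightarrow> chart_inv c (chart_map c p) = p"
    and is_chart_map_inv: "\<And>x. x \<in> chart_image c \<Longrightarrow> chart_map c (chart_inv c x) = x"
    and is_chart_inv_dom: "\<And>x. x \<in> chart_image c \<Longrightarrow> chart_inv c x \<in> chart_dom c"
    and is_chart_continuous_map: "continuous_on (chart_dom c) (chart_map c)"
    and is_chart_continuous_inv: "continuous_on (chart_image c) (chart_inv c)"
  using assms unfolding is_chart_def homeomorphism_def by auto

lemma smooth_onD:
  assumes "smooth_on S f"
  shows smooth_on_differentiable: "\<And>x. x \<in> S \<Longrightarrow> f differentiable (at x)"
    and smooth_on_frechet: "\<And>v. smooth_on S (\<lambda>x. frechet_derivative f (at x) v)"
    and smooth_on_continuous: "continuous_on S f"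
proof -
  have C: "C_on k f S" for k
    using assms by (simp add: smooth_on_def)
  show "\<And>x. x \<in> S \<Longrightarrow> f differentiable (at x)"
    using C[of 1] by simp
  show "\<And>v. smooth_on S (\<lambda>x. frechet_derivative f (at x) v)"
    unfolding smooth_on_def using C[of "Suc _"] by auto
  show "continuous_on S f"
    using C[of 0] by simp
qed

text \<open>A derivative controls \<open>f\<close> on a whole cone around the ray
  \<open>x + h v\<close>, not only on the ray: deviations from the ray have size at most
  \<open>\<delta> * h\<close>, and \<open>f'\<close> enlarges them by a fixed factor. Slopes are
  defined on such cones, so this is what composes them with differentiable maps.\<close>

lemma has_derivative_cone:
  fixes f :: "'e::real_normed_vector \<Rightarrow> 'f::real_normed_vector"
  assumes "(f has_derivative f') (at x)" "\<eta> > 0"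
  obtains \<delta> where "\<delta> > 0" "\<And>h y. 0 < h \<Longrightarrow> h < \<delta> \<Longrightarrow> norm (y - (x + h *\<^sub>R v)) \<le> \<delta> * h \<Longrightarrow>
    norm (f y - (f x + h *\<^sub>R f' v)) \<le> \<eta> * h"
proof -
  have bl: "bounded_linear f'"
    using assms has_derivative_bounded_linear by blast
  obtain K where K: "K > 0" "\<And>w. norm (f' w) \<le> norm w * K"
    using bounded_linear.pos_bounded[OF bl] by blast
  define M where "M = norm v + 1"
  have M: "M > 0" by (simp add: M_def add_nonneg_pos)
  have "\<eta> / (2 * M) > 0" using assms M by simp
  then obtain r where r: "r > 0" "\<And>y. norm (y - x) < r \<Longrightarrow>
      norm (f y - f x - f' (y - x)) \<le> \<eta> / (2 * M) * norm (y - x)"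
    using assms(1) unfolding has_derivative_at_alt by blast
  \<comment> \<open>In the cone \<open>norm (y - x) \<le> h * M\<close>, so \<open>r / M\<close>
    keeps it inside the ball where the derivative estimate holds; \<open>\<eta> / (2 * K)\<close>
    bounds the image under \<open>f'\<close> of the deviation from the ray.\<close>
  define \<delta> where "\<delta> = min 1 (min (r / M) (\<eta> / (2 * K)))"
  have \<delta>: "\<delta> > 0" "\<delta> \<le> 1" "\<delta> \<le> r / M" "\<delta> \<le> \<eta> / (2 * K)"
    using r(1) M K(1) assms(2) by (auto simp: \<delta>_def)
  show thesis
  proof (rule that[OF \<delta>(1)])
    fix h y assume h: "0 < h" "h < \<delta>" "norm (y - (x + h *\<^sub>R v)) \<le> \<delta> * h"
    define e where "e = y - (x + h *\<^sub>R v)"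
    have y: "y - x = h *\<^sub>R v + e" by (simp add: e_def)
    have e: "norm e \<le> \<delta> * h" using h by (simp add: e_def)
    have "norm (y - x) \<le> h * norm v + norm e"
      unfolding y using norm_triangle_ineq[of "h *\<^sub>R v" e] h(1) by simp
    also have "\<dots> \<le> h * norm v + 1 * h"
      using e mult_right_mono[OF \<delta>(2), of h] h(1) by linarith
    finally have n: "norm (y - x) \<le> h * M" by (simp add: M_def algebra_simps)
    have "h * M < \<delta> * M" using h M by simp
    also have "\<dots> \<le> r" using \<delta>(3) M by (simp add: field_simps)
    finally have "norm (y - x) < r" using n by simp
    then have "norm (f y - f x - f' (y - x)) \<le> \<eta> / (2 * M) * norm (y - x)" by (rule r(2))
    also have "\<dots> \<le> \<eta> / (2 * M) * (h * M)"
      using n assms(2) M by (intro mult_left_mono) auto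
    also have "\<dots> = \<eta> * h / 2" using M by simp
    finally have 1: "norm (f y - f x - f' (y - x)) \<le> \<eta> * h / 2" .
    have "norm (f' e) \<le> norm e * K" by (rule K(2))
    also have "\<dots> \<le> (\<delta> * h) * K" using e K(1) by (intro mult_right_mono) auto
    also have "\<dots> = (\<delta> * K) * h" by simp
    also have "\<dots> \<le> (\<eta> / 2) * h" using \<delta>(4) K(1) h(1) by (intro mult_right_mono) (auto simp: field_simps)
    finally have 2: "norm (f' e) \<le> \<eta> * h / 2" by simp
    have "f' (y - x) = h *\<^sub>R f' v + f' e"
      unfolding y using bl by (simp add: bounded_linear.linear linear_add linear_scale)
    then have eq: "f y - (f x + h *\<^sub>R f' v) = (f y - f x - f' (y - x)) + f' e" by simp
    show "norm (f y - (f x + h *\<^sub>R f' v)) \<le> \<eta> * h"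
      unfolding eq using norm_triangle_ineq[of "f y - f x - f' (y - x)" "f' e"] 1 2 by linarith
  qed
qed

text \<open>Compare \<open>\<phi>\<close> with a line of slope \<open>\<epsilon>\<close> from
  \<open>s\<close>: the last point at which \<open>\<phi>\<close> is not above the line exists by
  continuity, and before \<open>b\<close> the slope hypothesis would push it further. Nothing is
  assumed about the slope at \<open>a\<close>, so \<open>a\<close> itself is reached as a limit from
  the right.\<close>

lemma nonincreasing_of_right_slope:
  fixes \<phi> :: "real \<Rightarrow> real"
  assumes "a \<le> b" "continuous_on {a..b} \<phi>"
    and slope: "\<And>t \<epsilon>. a < t \<Longrightarrow> t < b \<Longrightarrow> \<epsilon> > 0 \<Longrightarrow> \<exists>\<delta>>0. \<forall>h. 0 < h \<and> h < \<delta> \<longrightarrow> \<phi> (t + h) \<le> \<phi> t + \<epsilon> * h"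
  shows "\<phi> b \<le> \<phi> a"
proof -
  have *: "\<phi> b \<le> \<phi> s + \<epsilon> * (b - s)" if s: "a < s" "s < b" and \<epsilon>: "\<epsilon> > 0" for s \<epsilon>
  proof (rule ccontr)
    assume neg: "\<not> \<phi> b \<le> \<phi> s + \<epsilon> * (b - s)"
    define T where "T = {t \<in> {s..b}. \<phi> t - \<epsilon> * (t - s) \<le> \<phi> s}"
    have "continuous_on {s..b} (\<lambda>t. \<phi> t - \<epsilon> * (t - s))"
      using continuous_on_subset[OF assms(2), of "{s..b}"] s by (intro continuous_intros) auto
    then have "closed T"
      unfolding T_def by (intro continuous_on_closed_Collect_le) (auto intro: continuous_intros)
    moreover have "bounded T" unfolding T_def by (rule bounded_subset[of "{s..b}"]) auto
    ultimately have "compact T" by (simp add: compact_eq_bounded_closed)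
    moreover have "s \<in> T" using s by (simp add: T_def)
    ultimately obtain t where t: "t \<in> T" "\<And>r. r \<in> T \<Longrightarrow> r \<le> t"
      using compact_attains_sup[of T] by blast
    have "t < b" using t(1) neg by (cases "t = b") (auto simp: T_def)
    moreover have "a < t" using t(1) s by (auto simp: T_def)
    ultimately obtain \<delta> where \<delta>: "\<delta> > 0" "\<And>h. 0 < h \<Longrightarrow> h < \<delta> \<Longrightarrow> \<phi> (t + h) \<le> \<phi> t + \<epsilon> * h"
      using slope[OF _ _ \<epsilon>] by blast
    define h where "h = min (\<delta> / 2) (b - t)"
    have h: "0 < h" "h < \<delta>" "t + h \<le> b" using \<delta>(1) \<open>t < b\<close> by (auto simp: h_def)
    have "t + h \<in> T"
      using \<delta>(2)[OF h(1,2)] t(1) h by (auto simp: T_def algebra_simps)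
    then show False using t(2) h(1) by force
  qed
  show ?thesis
  proof (cases "a = b")
    case False
    then have ab: "a < b" using assms(1) by simp
    have **: "\<phi> b \<le> \<phi> s" if s: "s \<in> {a<..<b}" for s
    proof (rule field_le_epsilon)
      fix e :: real assume "e > 0"
      then show "\<phi> b \<le> \<phi> s + e" using *[of s "e / (b - s)"] s by simp
    qed
    have "(\<phi> \<longlongrightarrow> \<phi> a) (at_right a)"
      using assms(2) ab by (simp add: continuous_on_Icc_at_rightD)
    moreover have "eventually (\<lambda>s. \<phi> b \<le> \<phi> s) (at_right a)"
      using ** eventually_at_right_real[OF ab] by (auto elim: eventually_mono)
    ultimately show ?thesis
      by (intro tendsto_lowerbound[of \<phi> "\<phi> a" "at_right a"]) auto
  qed simp
qed

section \<open>Riemannian metrics on a manifold\<close>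

locale smooth_atlas =
  fixes \<A> :: "('a::t2_space, 'e::euclidean_space) chart set"
  assumes maximal: "maximal_atlas \<A>"
begin

lemma is_chart: "c \<in> \<A> \<Longrightarrow> is_chart c"
  using maximal by (simp add: maximal_atlas_def)

lemmas open_dom = is_chart_open_dom[OF is_chart]
  and open_image = is_chart_open_image[OF is_chart]
  and inv_map = is_chart_inv_map[OF is_chart]
  and map_inv = is_chart_map_inv[OF is_chart]
  and inv_dom = is_chart_inv_dom[OF is_chart]
  and continuous_map = is_chart_continuous_map[OF is_chart]
  and continuous_inv = is_chart_continuous_inv[OF is_chart]

lemma chart_at: obtains c where "c \<in> \<A>" "p \<in> chart_dom c"
proof -
  have "p \<in> (\<Union>c\<in>\<A>. chart_dom c)"
    using maximal by (simp add: maximal_atlas_def)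
  then show thesis using that by blast
qed

lemma transition_has_derivative:
  assumes "c \<in> \<A>" "c' \<in> \<A>" "p \<in> chart_dom c" "p \<in> chart_dom c'"
  shows "((chart_map c' \<circ> chart_inv c) has_derivative tangent_map c c' id p) (at (chart_map c p))"
proof -
  have "smoothly_compatible c c'"
    using maximal assms by (simp add: maximal_atlas_def)
  then have "(chart_map c' \<circ> chart_inv c) differentiable (at (chart_map c p))"
    unfolding smoothly_compatible_def using assms smooth_on_differentiable by blast
  then show ?thesis
    by (simp add: tangent_map_def frechet_derivative_works)
qed

lemma eventually_in_dom:
  assumes "c \<in> \<A>" "continuous (at t within X) \<gamma>" "\<gamma> t \<in> chart_dom c"
  shows "eventually (\<lambda>s. \<gamma> s \<in> chart_dom c) (at t within X)"
  using assms open_dom[of c] by (auto simp: continuous_within intro: topological_tendstoD)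

text \<open>Stated for derivatives within a set in order to cover the end points of the pieces of a
  curve, where only one-sided derivatives exist.\<close>

lemma curve_chart_change:
  assumes "c \<in> \<A>" "c' \<in> \<A>" "\<gamma> t \<in> chart_dom c" "\<gamma> t \<in> chart_dom c'"
    and "continuous (at t within X) \<gamma>" "t \<in> X"
    and "((chart_map c \<circ> \<gamma>) has_vector_derivative v) (at t within X)"
  shows "((chart_map c' \<circ> \<gamma>) has_vector_derivative tangent_map c c' id (\<gamma> t) v) (at t within X)"
proof -
  note tr = transition_has_derivative[OF assms(1-4)]
  have "(((chart_map c' \<circ> chart_inv c) \<circ> (chart_map c \<circ> \<gamma>)) has_vector_derivative
      tangent_map c c' id (\<gamma> t) v) (at t within X)"
    unfolding has_vector_derivative_def
  proof (rule has_derivative_eq_rhs)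
    show "((chart_map c' \<circ> chart_inv c \<circ> (chart_map c \<circ> \<gamma>)) has_derivative
        tangent_map c c' id (\<gamma> t) \<circ> (\<lambda>x. x *\<^sub>R v)) (at t within X)"
      using assms(7) tr unfolding has_vector_derivative_def
      by (intro diff_chain_within) (auto intro: has_derivative_at_withinI)
    show "tangent_map c c' id (\<gamma> t) \<circ> (\<lambda>x. x *\<^sub>R v) = (\<lambda>x. x *\<^sub>R tangent_map c c' id (\<gamma> t) v)"
      using has_derivative_linear[OF tr] by (auto simp: linear_scale)
  qed
  moreover have "eventually (\<lambda>s. (chart_map c' \<circ> chart_inv c \<circ> (chart_map c \<circ> \<gamma>)) s = (chart_map c' \<circ> \<gamma>) s)
      (at t within X)"
    using eventually_in_dom[OF assms(1,5,3)]
    by eventually_elim (use assms(1) inv_map in auto)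
  ultimately show ?thesis
    unfolding has_vector_derivative_def
    using assms(1,3,6) by (auto intro: has_derivative_transform_eventually simp: inv_map)
qed

end

locale riemannian = smooth_atlas \<A>
  for \<A> :: "('a::t2_space, 'e::euclidean_space) chart set" +
  fixes g :: "('a, 'e) bilin"
  assumes metric: "riemannian_metric \<A> g"
begin

lemma metric_bilinear: "c \<in> \<A> \<Longrightarrow> p \<in> chart_dom c \<Longrightarrow> bilinear (g c p)"
  and metric_preserved: "preserves_bilin \<A> id g"
  and metric_pos: "c \<in> \<A> \<Longrightarrow> p \<in> chart_dom c \<Longrightarrow> v \<noteq> 0 \<Longrightarrow> g c p v v > 0"
  and metric_smooth: "c \<in> \<A> \<Longrightarrow> smooth_on (chart_image c) (\<lambda>x. g c (chart_inv c x) v w)"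
  using metric by (auto simp: riemannian_metric_def bilin_tensor_def)

lemma metric_nonneg:
  assumes "c \<in> \<A>" "p \<in> chart_dom c" shows "g c p v v \<ge> 0"
proof (cases "v = 0")
  case True
  then show ?thesis using metric_bilinear[OF assms] by (simp add: bilinear_lzero)
qed (use metric_pos[OF assms] less_imp_le in blast)

lemma metric_scale:
  assumes "c \<in> \<A>" "p \<in> chart_dom c"
  shows "sqrt (g c p (k *\<^sub>R v) (k *\<^sub>R v)) = \<bar>k\<bar> * sqrt (g c p v v)"
proof -
  have "g c p (k *\<^sub>R v) (k *\<^sub>R v) = k\<^sup>2 * g c p v v"
    using metric_bilinear[OF assms] by (simp add: bilinear_lmul bilinear_rmul power2_eq_square)
  then show ?thesis by (simp add: real_sqrt_mult)
qed

lemma metric_tangent_map: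
  assumes "c \<in> \<A>" "c' \<in> \<A>" "p \<in> chart_dom c" "p \<in> chart_dom c'"
  shows "g c' p (tangent_map c c' id p v) (tangent_map c c' id p w) = g c p v w"
proof -
  have "\<forall>c\<in>\<A>. \<forall>c'\<in>\<A>. \<forall>p v w. p \<in> chart_dom c \<and> p \<in> chart_dom c' \<longrightarrow>
      g c' p (tangent_map c c' id p v) (tangent_map c c' id p w) = g c p v w"
    using metric_preserved by (simp add: preserves_bilin_def)
  then show ?thesis using assms by blast
qed

text \<open>Smoothness of a tensor is given for fixed vectors only. Joint continuity in point and
  vector follows by expanding both arguments in the basis.\<close>

lemma metric_continuous:
  assumes c: "c \<in> \<A>"
  shows "continuous_on (chart_image c \<times> UNIV) (\<lambda>y. sqrt (g c (chart_inv c (fst y)) (snd y) (snd y)))"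
proof -
  have eq: "g c p v v = (\<Sum>(i, j)\<in>Basis \<times> Basis. (v \<bullet> i) * (v \<bullet> j) * g c p i j)"
    if "p \<in> chart_dom c" for p v
  proof -
    have b: "bilinear (g c p)" using metric_bilinear c that by blast
    have "g c p v v = g c p (\<Sum>i\<in>Basis. (v \<bullet> i) *\<^sub>R i) (\<Sum>j\<in>Basis. (v \<bullet> j) *\<^sub>R j)"
      by (simp add: euclidean_representation)
    also have "\<dots> = (\<Sum>(i, j)\<in>Basis \<times> Basis. g c p ((v \<bullet> i) *\<^sub>R i) ((v \<bullet> j) *\<^sub>R j))"
      by (rule bilinear_sum[OF b])
    also have "\<dots> = (\<Sum>(i, j)\<in>Basis \<times> Basis. (v \<bullet> i) * (v \<bullet> j) * g c p i j)"
      using b by (intro sum.cong) (auto simp: bilinear_lmul bilinear_rmul)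
    finally show ?thesis .
  qed
  have 1: "continuous_on (chart_image c \<times> UNIV) (\<lambda>y::'e \<times> 'e. g c (chart_inv c (fst y)) i j)" for i j
    using smooth_on_continuous[OF metric_smooth[OF c, of i j]]
    by (rule continuous_on_compose2) (auto intro: continuous_intros)
  have "continuous_on (chart_image c \<times> UNIV)
      (\<lambda>y::'e \<times> 'e. sqrt (\<Sum>(i, j)\<in>Basis \<times> Basis. (snd y \<bullet> i) * (snd y \<bullet> j) * g c (chart_inv c (fst y)) i j))"
    unfolding split_def by (intro continuous_intros 1)
  then show ?thesis
    using eq c by (subst continuous_on_cong[OF refl]) (auto simp: inv_dom)
qed

lemma norm_near:
  assumes c: "c \<in> \<A>" and p: "p \<in> chart_dom c" and \<epsilon>: "\<epsilon> > 0"
  obtains r where "r > 0" "\<And>x w. norm (x - chart_map c p) < r \<Longrightarrow> norm (w - v) < r \<Longrightarrow>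
    x \<in> chart_image c \<and> \<bar>sqrt (g c (chart_inv c x) w w) - sqrt (g c p v v)\<bar> < \<epsilon>"
proof -
  define f where "f = (\<lambda>y. sqrt (g c (chart_inv c (fst y)) (snd y) (snd y)))"
  have op: "open (chart_image c \<times> (UNIV::'e set))"
    using open_image[OF c] by (intro open_Times) auto
  have mem: "(chart_map c p, v) \<in> chart_image c \<times> UNIV" using p by auto
  have "isCont f (chart_map c p, v)"
    using metric_continuous[OF c] op mem unfolding f_def by (metis (mono_tags) continuous_on_eq_continuous_at)
  then have "\<exists>d>0. \<forall>y. dist y (chart_map c p, v) < d \<longrightarrow> dist (f y) (f (chart_map c p, v)) < \<epsilon>"
    using \<epsilon> unfolding continuous_at_eps_delta by blast
  then obtain d where d: "d > 0" "\<And>y. dist y (chart_map c p, v) < d \<Longrightarrow> dist (f y) (f (chart_map c p, v)) < \<epsilon>"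
    by blast
  obtain d' where d': "d' > 0" "ball (chart_map c p) d' \<subseteq> chart_image c"
    using open_image[OF c] p open_contains_ball by (metis imageI)
  show thesis
  proof (rule that[of "min (d / 2) d'"])
    show "min (d / 2) d' > 0" using d d' by simp
    fix x w assume a: "norm (x - chart_map c p) < min (d / 2) d'" "norm (w - v) < min (d / 2) d'"
    have "dist (x, w) (chart_map c p, v) \<le> dist x (chart_map c p) + dist w v"
      unfolding dist_Pair_Pair by (simp add: sqrt_sum_squares_le_sum)
    also have "\<dots> < d" using a by (simp add: dist_norm)
    finally have "dist (f (x, w)) (f (chart_map c p, v)) < \<epsilon>" by (rule d(2))
    moreover have "x \<in> chart_image c" using a d'(2) by (auto simp: dist_norm norm_minus_commute subset_iff)
    ultimately show "x \<in> chart_image c \<and> \<bar>sqrt (g c (chart_inv c x) w w) - sqrt (g c p v v)\<bar> < \<epsilon>"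
      using c p by (auto simp: f_def dist_real_def inv_map)
  qed
qed

text \<open>\<open>speed\<close> picks an arbitrary chart at each time and uses two-sided
  derivatives, so it is neither visibly continuous nor meaningful at the ends of a piece. Its
  variant \<open>S\<close> with derivatives within \<open>{a..b}\<close> repairs both: transition
  maps preserve \<open>g\<close>, so \<open>S\<close> can be computed in any one chart near a given
  time.\<close>

lemma C1_curve_speed:
  assumes C1: "C1_curve \<A> \<gamma> a b" and cont: "continuous_on {a..b} \<gamma>" and ab: "a < b"
  obtains S where "continuous_on {a..b} S" "\<And>t. t \<in> {a<..<b} \<Longrightarrow> S t = speed \<A> g \<gamma> t"
    "\<And>t c. t \<in> {a..b} \<Longrightarrow> c \<in> \<A> \<Longrightarrow> \<gamma> t \<in> chart_dom c \<Longrightarrow>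
      \<exists>v. ((chart_map c \<circ> \<gamma>) has_vector_derivative v) (at t within {a..b}) \<and> S t = sqrt (g c (\<gamma> t) v v)"
proof -
  define S where "S t = (let c = (SOME c. c \<in> \<A> \<and> \<gamma> t \<in> chart_dom c);
      v = vector_derivative (chart_map c \<circ> \<gamma>) (at t within {a..b}) in sqrt (g c (\<gamma> t) v v))" for t
  have key: "S t = sqrt (g c (\<gamma> t) v v)"
    if t: "t \<in> {a..b}" "c \<in> \<A>" "\<gamma> t \<in> chart_dom c"
      and v: "((chart_map c \<circ> \<gamma>) has_vector_derivative v) (at t within {a..b})" for t c v
  proof -
    define c' where "c' = (SOME c. c \<in> \<A> \<and> \<gamma> t \<in> chart_dom c)"
    have "c' \<in> \<A> \<and> \<gamma> t \<in> chart_dom c'"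
      unfolding c'_def by (rule someI_ex) (use t in blast)
    then have c': "c' \<in> \<A>" "\<gamma> t \<in> chart_dom c'" by auto
    have "((chart_map c' \<circ> \<gamma>) has_vector_derivative tangent_map c c' id (\<gamma> t) v) (at t within {a..b})"
      using curve_chart_change[OF t(2) c'(1) t(3) c'(2) _ t(1) v] cont t(1)
      by (simp add: continuous_on_eq_continuous_within)
    then have "vector_derivative (chart_map c' \<circ> \<gamma>) (at t within {a..b}) = tangent_map c c' id (\<gamma> t) v"
      using ab t(1) vector_derivative_within_cbox[of a b] by auto
    then show ?thesis
      using metric_tangent_map[OF t(2) c'(1) t(3) c'(2)] by (simp add: S_def c'_def[symmetric] Let_def)
  qed
  show thesis
  proof
    show "S t = speed \<A> g \<gamma> t" if "t \<in> {a<..<b}" for t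
      using that by (simp add: S_def speed_def at_within_Icc_at)
    show "\<exists>v. ((chart_map c \<circ> \<gamma>) has_vector_derivative v) (at t within {a..b}) \<and> S t = sqrt (g c (\<gamma> t) v v)"
      if t: "t \<in> {a..b}" "c \<in> \<A>" "\<gamma> t \<in> chart_dom c" for t c
    proof -
      obtain D where D: "\<forall>t\<in>{s\<in>{a..b}. \<gamma> s \<in> chart_dom c}.
          ((chart_map c \<circ> \<gamma>) has_vector_derivative D t) (at t within {a..b})"
        using C1 t(2) unfolding C1_curve_def by blast
      then show ?thesis using key[OF t] t by blast
    qed
    show "continuous_on {a..b} S"
      unfolding continuous_on_eq_continuous_within
    proof
      fix t assume t: "t \<in> {a..b}"
      obtain c where c: "c \<in> \<A>" "\<gamma> t \<in> chart_dom c" using chart_at by blast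
      define T where "T = {s \<in> {a..b}. \<gamma> s \<in> chart_dom c}"
      obtain D where D: "\<forall>t\<in>T. ((chart_map c \<circ> \<gamma>) has_vector_derivative D t) (at t within {a..b})"
        "continuous_on T D"
        using C1 c(1) unfolding C1_curve_def T_def by blast
      have T: "T = {a..b} \<inter> \<gamma> -` chart_dom c" by (auto simp: T_def)
      have tT: "t \<in> T" using t c by (simp add: T_def)
      have "continuous_on T (\<lambda>s. sqrt (g c (chart_inv c (chart_map c (\<gamma> s))) (D s) (D s)))"
      proof -
        have 1: "continuous_on T (\<lambda>s. (chart_map c (\<gamma> s), D s))"
          using D(2) continuous_map[OF c(1)] continuous_on_subset[OF cont, of T]
          by (intro continuous_intros continuous_on_compose2[of "chart_dom c" "chart_map c" T \<gamma>])
            (auto simp: T_def subset_iff)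
        show ?thesis
          using continuous_on_compose2[OF metric_continuous[OF c(1)] 1] by (auto simp: T_def)
      qed
      then have "continuous_on T S"
      proof (rule continuous_on_eq)
        fix s assume "s \<in> T"
        then show "sqrt (g c (chart_inv c (chart_map c (\<gamma> s))) (D s) (D s)) = S s"
          using key[of s c "D s"] D(1) c(1) by (simp add: T_def inv_map)
      qed
      then have "continuous (at t within T) S" using tT by (simp add: continuous_on_eq_continuous_within)
      \<comment> \<open>\<open>T\<close> is relatively open in \<open>{a..b}\<close>, so passing to
        times in the chart does not change limits at \<open>t\<close>.\<close>
      moreover have "at t within T = at t within {a..b}"
      proof -
        have "openin (top_of_set {a..b}) T"
          unfolding T by (rule continuous_openin_preimage_gen[OF cont open_dom[OF c(1)]])
        then obtain O' where "open O'" "T = {a..b} \<inter> O'" by (auto simp: openin_open)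
        then show ?thesis using tT by (intro at_within_nhd[of t O']) auto
      qed
      ultimately show "continuous (at t within {a..b}) S" by simp
    qed
  qed
qed

end

section \<open>Upper slopes and lengths of curves\<close>

text \<open>An upper Dini derivative along \<open>v\<close> that is uniform over a cone around \<open>v\<close>; for \<open>g\<close>-distance
  functions it replaces the gradient bound \<open>|d\<rho>| \<le> 1\<close>.\<close>
definition slope_bound :: "('a, 'e::euclidean_space) bilin \<Rightarrow> ('a \<Rightarrow> real) \<Rightarrow> ('a, 'e) chart \<Rightarrow> 'a \<Rightarrow> bool" where
  "slope_bound g \<rho> c p \<longleftrightarrow> (\<forall>v. \<forall>\<epsilon>>0. \<exists>\<delta>>0. \<forall>h x.
     0 < h \<and> h < \<delta> \<and> norm (x - (chart_map c p + h *\<^sub>R v)) \<le> \<delta> * h \<longrightarrow>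
     \<rho> (chart_inv c x) \<le> \<rho> p + h * (sqrt (g c p v v) + \<epsilon>))"

lemma slope_boundE:
  assumes "slope_bound g \<rho> c p" "\<epsilon> > 0"
  obtains \<delta> where "\<delta> > 0" "\<And>h x. 0 < h \<Longrightarrow> h < \<delta> \<Longrightarrow> norm (x - (chart_map c p + h *\<^sub>R v)) \<le> \<delta> * h \<Longrightarrow>
    \<rho> (chart_inv c x) \<le> \<rho> p + h * (sqrt (g c p v v) + \<epsilon>)"
proof -
  have "\<exists>\<delta>>0. \<forall>h x. 0 < h \<and> h < \<delta> \<and> norm (x - (chart_map c p + h *\<^sub>R v)) \<le> \<delta> * h \<longrightarrow>
     \<rho> (chart_inv c x) \<le> \<rho> p + h * (sqrt (g c p v v) + \<epsilon>)"
    using assms unfolding slope_bound_def by (elim allE[of _ v] allE[of _ \<epsilon>]) simp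
  then show thesis using that by (elim exE conjE) simp
qed

text \<open>Confines a cone with opening at most 1 to a ball; this is how a choice of
  \<open>\<delta>\<close> keeps all points under consideration inside one chart.\<close>

lemma cone_near:
  fixes x :: "'e::real_normed_vector"
  assumes "0 < h" "h < \<delta>" "\<delta> \<le> 1" "norm (x - (x0 + h *\<^sub>R v)) \<le> \<delta> * h"
  shows "norm (x - x0) \<le> h * (norm v + 1)" "\<delta> * (norm v + 1) \<le> r \<Longrightarrow> norm (x - x0) < r"
proof -
  have eq: "x - x0 = h *\<^sub>R v + (x - (x0 + h *\<^sub>R v))" by simp
  have "norm (x - x0) \<le> norm (h *\<^sub>R v) + norm (x - (x0 + h *\<^sub>R v))"
    by (metis eq norm_triangle_ineq)
  moreover have "\<delta> * h \<le> h" using mult_right_mono[OF assms(3), of h] assms(1) by linarith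
  moreover have "norm (h *\<^sub>R v) = h * norm v" "h * (norm v + 1) = h * norm v + h"
    using assms(1) by (auto simp: algebra_simps)
  ultimately show 1: "norm (x - x0) \<le> h * (norm v + 1)"
    using assms(1,4) by linarith
  assume "\<delta> * (norm v + 1) \<le> r"
  moreover have "h * (norm v + 1) < \<delta> * (norm v + 1)"
    using assms by (intro mult_strict_right_mono) (auto simp: add_nonneg_pos)
  ultimately show "norm (x - x0) < r" using 1 by simp
qed

context smooth_atlas
begin

text \<open>Chain rule for slopes: by \<open>has_derivative_cone\<close> the map sends a narrow cone
  around \<open>v\<close> into the prescribed cone around \<open>T v\<close>. The ball of radius
  \<open>r\<close> keeps the images inside \<open>chart_dom c'\<close>.\<close>

lemma slope_bound_pullback:
  assumes c: "c \<in> \<A>" "c' \<in> \<A>" "p \<in> chart_dom c" "\<psi> p \<in> chart_dom c'"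
    and \<psi>: "continuous_on UNIV \<psi>" "((chart_map c' \<circ> \<psi> \<circ> chart_inv c) has_derivative T) (at (chart_map c p))"
    and le: "\<And>v. g c' (\<psi> p) (T v) (T v) \<le> g1 c p v v"
    and slope: "slope_bound g \<rho> c' (\<psi> p)"
  shows "slope_bound g1 (\<rho> \<circ> \<psi>) c p"
  unfolding slope_bound_def
proof (intro allI impI)
  fix v and \<epsilon> :: real assume "\<epsilon> > 0"
  then obtain \<delta>1 where \<delta>1: "\<delta>1 > 0" "\<And>h x. 0 < h \<Longrightarrow> h < \<delta>1 \<Longrightarrow>
      norm (x - (chart_map c' (\<psi> p) + h *\<^sub>R T v)) \<le> \<delta>1 * h \<Longrightarrow>
      \<rho> (chart_inv c' x) \<le> \<rho> (\<psi> p) + h * (sqrt (g c' (\<psi> p) (T v) (T v)) + \<epsilon>)"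
    using slope_boundE[OF slope \<open>\<epsilon> > 0\<close>, of "T v"] by metis
  obtain \<delta>2 where \<delta>2: "\<delta>2 > 0" "\<And>h y. 0 < h \<Longrightarrow> h < \<delta>2 \<Longrightarrow> norm (y - (chart_map c p + h *\<^sub>R v)) \<le> \<delta>2 * h \<Longrightarrow>
      norm ((chart_map c' \<circ> \<psi> \<circ> chart_inv c) y -
        ((chart_map c' \<circ> \<psi> \<circ> chart_inv c) (chart_map c p) + h *\<^sub>R T v)) \<le> \<delta>1 * h"
    using has_derivative_cone[OF \<psi>(2) \<delta>1(1), of v] by metis
  define X where "X = chart_image c \<inter> (\<psi> \<circ> chart_inv c) -` chart_dom c'"
  have "continuous_on (chart_image c) (\<psi> \<circ> chart_inv c)"
    using continuous_inv[OF c(1)] \<psi>(1) by (intro continuous_on_compose) (auto intro: continuous_on_subset)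
  then have "open X"
    unfolding X_def using open_image[OF c(1)] open_dom[OF c(2)] by (rule continuous_open_preimage)
  moreover have "chart_map c p \<in> X" using c by (auto simp: X_def inv_map)
  ultimately obtain r where r: "r > 0" "ball (chart_map c p) r \<subseteq> X"
    using open_contains_ball by blast
  define \<delta> where "\<delta> = Min {\<delta>1, \<delta>2, 1, r / (norm v + 1)}"
  have \<delta>: "\<delta> > 0" "\<delta> \<le> \<delta>1" "\<delta> \<le> \<delta>2" "\<delta> \<le> 1" "\<delta> \<le> r / (norm v + 1)"
    using \<delta>1 \<delta>2 r by (auto simp: \<delta>_def add_nonneg_pos)
  have \<delta>r: "\<delta> * (norm v + 1) \<le> r" using \<delta>(5) by (simp add: pos_le_divide_eq add_nonneg_pos)
  show "\<exists>\<delta>>0. \<forall>h x. 0 < h \<and> h < \<delta> \<and> norm (x - (chart_map c p + h *\<^sub>R v)) \<le> \<delta> * h \<longrightarrow>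
      (\<rho> \<circ> \<psi>) (chart_inv c x) \<le> (\<rho> \<circ> \<psi>) p + h * (sqrt (g1 c p v v) + \<epsilon>)"
  proof (intro exI conjI allI impI)
    show "\<delta> > 0" by fact
    fix h x assume "0 < h \<and> h < \<delta> \<and> norm (x - (chart_map c p + h *\<^sub>R v)) \<le> \<delta> * h"
    then have h: "0 < h" "h < \<delta>" "norm (x - (chart_map c p + h *\<^sub>R v)) \<le> \<delta> * h" by auto
    have "norm (x - chart_map c p) < r" by (rule cone_near(2)[OF h(1,2) \<delta>(4) h(3) \<delta>r])
    then have "x \<in> X" using r(2) by (auto simp: dist_norm norm_minus_commute)
    then have x: "x \<in> chart_image c" "\<psi> (chart_inv c x) \<in> chart_dom c'" by (auto simp: X_def)
    have "norm (x - (chart_map c p + h *\<^sub>R v)) \<le> \<delta>2 * h"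
      using h(3) mult_right_mono[OF \<delta>(3), of h] h(1) by linarith
    then have "norm (chart_map c' (\<psi> (chart_inv c x)) - (chart_map c' (\<psi> p) + h *\<^sub>R T v)) \<le> \<delta>1 * h"
      using \<delta>2(2)[OF h(1), of x] h(2) \<delta>(3) c by (simp add: inv_map)
    then have "\<rho> (chart_inv c' (chart_map c' (\<psi> (chart_inv c x))))
        \<le> \<rho> (\<psi> p) + h * (sqrt (g c' (\<psi> p) (T v) (T v)) + \<epsilon>)"
      using h \<delta>(2) by (intro \<delta>1(2)) auto
    also have "\<dots> \<le> \<rho> (\<psi> p) + h * (sqrt (g1 c p v v) + \<epsilon>)"
      using le[of v] h(1) by (intro add_left_mono mult_left_mono add_right_mono) auto
    finally show "(\<rho> \<circ> \<psi>) (chart_inv c x) \<le> (\<rho> \<circ> \<psi>) p + h * (sqrt (g1 c p v v) + \<epsilon>)"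
      using x(2) c(2) by (simp add: inv_map)
  qed
qed

section \<open>Reparametrizing and joining piecewise C1 curves\<close>

lemma piecewise_smooth_points:
  assumes "piecewise_C1_curve \<A> \<gamma>"
  obtains N where "finite N" "\<And>t c. t \<in> {0..1} - N \<Longrightarrow> c \<in> \<A> \<Longrightarrow> \<gamma> t \<in> chart_dom c \<Longrightarrow>
    (chart_map c \<circ> \<gamma>) differentiable (at t)"
proof -
  obtain m \<tau> where \<tau>: "\<tau> 0 = 0" "\<tau> (m::nat) = 1"
      "\<And>i. i < m \<Longrightarrow> \<tau> i < \<tau> (Suc i) \<and> C1_curve \<A> \<gamma> (\<tau> i) (\<tau> (Suc i))"
    using assms unfolding piecewise_C1_curve_def by blast
  have *: "\<exists>j<i. \<tau> j < t \<and> t < \<tau> (Suc j)" if "i \<le> m" "t \<in> {0..\<tau> i} - \<tau> ` {..m}" for i t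
    using that
  proof (induction i)
    case 0
    then show ?case using \<tau>(1) by auto
  next
    case (Suc i)
    show ?case
    proof (cases "t \<le> \<tau> i")
      case True
      then show ?thesis using Suc by (auto simp: less_Suc_eq)
    next
      case False
      moreover have "t \<noteq> \<tau> (Suc i)" using Suc.prems by blast
      ultimately show ?thesis using Suc.prems by (intro exI[of _ i]) auto
    qed
  qed
  show thesis
  proof (rule that[of "\<tau> ` {..m}"])
    fix t c assume t: "t \<in> {0..1} - \<tau> ` {..m}" and c: "c \<in> \<A>" "\<gamma> t \<in> chart_dom c"
    obtain j where j: "j < m" "\<tau> j < t" "t < \<tau> (Suc j)"
      using *[of m t] t \<tau>(2) by auto
    obtain D where "\<forall>t\<in>{s\<in>{\<tau> j..\<tau> (Suc j)}. \<gamma> s \<in> chart_dom c}.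
        ((chart_map c \<circ> \<gamma>) has_vector_derivative D t) (at t within {\<tau> j..\<tau> (Suc j)})"
      using \<tau>(3)[OF j(1)] c(1) unfolding C1_curve_def by blast
    then have "((chart_map c \<circ> \<gamma>) has_vector_derivative D t) (at t within {\<tau> j..\<tau> (Suc j)})"
      using j c by auto
    then have "((chart_map c \<circ> \<gamma>) has_vector_derivative D t) (at t)"
      using j by (simp add: at_within_Icc_at)
    then show "(chart_map c \<circ> \<gamma>) differentiable (at t)"
      by (auto simp: has_vector_derivative_def differentiable_def)
  qed auto
qed

lemma C1_curve_affine:
  assumes C1: "C1_curve \<A> \<gamma> a b" and k: "k > 0"
    and eq: "\<And>s. s \<in> {a'..b'} \<Longrightarrow> \<gamma>' s = \<gamma> (k * s + d)"
    and ends: "k * a' + d = a" "k * b' + d = b"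
  shows "C1_curve \<A> \<gamma>' a' b'"
  unfolding C1_curve_def
proof
  fix c assume "c \<in> \<A>"
  then obtain D where D: "\<forall>t\<in>{s\<in>{a..b}. \<gamma> s \<in> chart_dom c}.
      ((chart_map c \<circ> \<gamma>) has_vector_derivative D t) (at t within {a..b})"
    "continuous_on {s\<in>{a..b}. \<gamma> s \<in> chart_dom c} D"
    using C1 unfolding C1_curve_def by blast
  have mem: "k * s + d \<in> {a..b}" if "s \<in> {a'..b'}" for s
    using that k ends by auto
  show "\<exists>D. (\<forall>t\<in>{s\<in>{a'..b'}. \<gamma>' s \<in> chart_dom c}.
      ((chart_map c \<circ> \<gamma>') has_vector_derivative D t) (at t within {a'..b'})) \<and>
      continuous_on {s\<in>{a'..b'}. \<gamma>' s \<in> chart_dom c} D"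
  proof (intro exI conjI ballI)
    show "continuous_on {s\<in>{a'..b'}. \<gamma>' s \<in> chart_dom c} (\<lambda>s. k *\<^sub>R D (k * s + d))"
      using mem eq
      by (intro continuous_intros continuous_on_compose2[OF D(2)]) auto
    fix t assume t: "t \<in> {s\<in>{a'..b'}. \<gamma>' s \<in> chart_dom c}"
    then have "((chart_map c \<circ> \<gamma>) has_vector_derivative D (k * t + d)) (at (k * t + d) within {a..b})"
      using D(1) mem[of t] eq[of t] by auto
    then have "((chart_map c \<circ> \<gamma>) has_vector_derivative D (k * t + d))
        (at (k * t + d) within (\<lambda>s. k * s + d) ` {a'..b'})"
      by (rule has_vector_derivative_within_subset) (use mem in auto)
    moreover have "((\<lambda>s. k * s + d) has_vector_derivative k) (at t within {a'..b'})"
      by (auto intro!: derivative_eq_intros)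
    ultimately have "((chart_map c \<circ> \<gamma> \<circ> (\<lambda>s. k * s + d)) has_vector_derivative k *\<^sub>R D (k * t + d))
        (at t within {a'..b'})"
      by (intro vector_diff_chain_within)
    then show "((chart_map c \<circ> \<gamma>') has_vector_derivative k *\<^sub>R D (k * t + d)) (at t within {a'..b'})"
      by (rule has_vector_derivative_transform[rotated 2]) (use t eq in auto)
  qed
qed

lemma piecewise_C1_join:
  assumes "piecewise_C1_curve \<A> \<gamma>1" "piecewise_C1_curve \<A> \<gamma>2" "\<gamma>1 1 = \<gamma>2 0"
  shows "piecewise_C1_curve \<A> (\<gamma>1 +++ \<gamma>2)"
proof -
  obtain m1 \<tau>1 where \<tau>1: "\<tau>1 0 = 0" "\<tau>1 (m1::nat) = 1"
      "\<And>i. i < m1 \<Longrightarrow> \<tau>1 i < \<tau>1 (Suc i) \<and> C1_curve \<A> \<gamma>1 (\<tau>1 i) (\<tau>1 (Suc i))"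
    using assms(1) unfolding piecewise_C1_curve_def by blast
  obtain m2 \<tau>2 where \<tau>2: "\<tau>2 0 = 0" "\<tau>2 (m2::nat) = 1"
      "\<And>i. i < m2 \<Longrightarrow> \<tau>2 i < \<tau>2 (Suc i) \<and> C1_curve \<A> \<gamma>2 (\<tau>2 i) (\<tau>2 (Suc i))"
    using assms(2) unfolding piecewise_C1_curve_def by blast
  have up1: "\<tau>1 i \<le> 1" if "i \<le> m1" for i
  proof -
    have "\<tau>1 i \<le> \<tau>1 m1" using that
      by (induction i rule: inc_induct) (use \<tau>1(3) in \<open>auto intro: order_trans less_imp_le\<close>)
    then show ?thesis using \<tau>1(2) by simp
  qed
  have lo2: "0 \<le> \<tau>2 i" if "i \<le> m2" for i
    using that
  proof (induction i)
    case (Suc i)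
    then show ?case using \<tau>2(3)[of i] by auto
  qed (use \<tau>2(1) in simp)
  \<comment> \<open>Both branches give 1/2 at the index \<open>m1\<close>. By
    \<open>\<tau>_hi\<close> the second one may be used there, so the piece that starts at the
    junction needs no case of its own.\<close>
  define \<tau> where "\<tau> i = (if i \<le> m1 then \<tau>1 i / 2 else (\<tau>2 (i - m1) + 1) / 2)" for i
  have \<tau>_hi: "\<tau> i = (\<tau>2 (i - m1) + 1) / 2" if "i \<ge> m1" for i
    using that \<tau>1(2) \<tau>2(1) by (cases "i = m1") (auto simp: \<tau>_def)
  have "\<tau> i < \<tau> (Suc i) \<and> C1_curve \<A> (\<gamma>1 +++ \<gamma>2) (\<tau> i) (\<tau> (Suc i))" if i: "i < m1 + m2" for i
  proof (cases "i < m1")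
    case True
    then have t: "\<tau> i = \<tau>1 i / 2" "\<tau> (Suc i) = \<tau>1 (Suc i) / 2" by (auto simp: \<tau>_def)
    have "\<tau>1 (Suc i) \<le> 1" using True up1 by simp
    then have "C1_curve \<A> (\<gamma>1 +++ \<gamma>2) (\<tau> i) (\<tau> (Suc i))"
      by (intro C1_curve_affine[OF conjunct2[OF \<tau>1(3)[OF True]], where k = 2 and d = 0])
        (auto simp: t joinpaths_def)
    moreover have "\<tau> i < \<tau> (Suc i)" using \<tau>1(3)[OF True] by (simp add: t)
    ultimately show ?thesis by blast
  next
    case False
    define j where "j = i - m1"
    have j: "i = m1 + j" "j < m2" using False i by (auto simp: j_def)
    have t: "\<tau> i = (\<tau>2 j + 1) / 2" "\<tau> (Suc i) = (\<tau>2 (Suc j) + 1) / 2"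
      using \<tau>_hi[of i] \<tau>_hi[of "Suc i"] j by auto
    \<comment> \<open>At \<open>s = 1/2\<close> the join still takes its value from the first curve;
      the end point condition makes it agree with the second.\<close>
    have "(\<gamma>1 +++ \<gamma>2) s = \<gamma>2 (2 * s + - 1)" if "s \<in> {\<tau> i..\<tau> (Suc i)}" for s
    proof (cases "s = 1/2")
      case False
      moreover have "(\<tau>2 j + 1) / 2 \<le> s" using that t(1) by auto
      ultimately have "\<not> s \<le> 1/2" using lo2[of j] j(2) by auto
      then show ?thesis by (simp add: joinpaths_def)
    next
      case True
      then show ?thesis using assms(3) by (simp add: True joinpaths_def)
    qed
    then have "C1_curve \<A> (\<gamma>1 +++ \<gamma>2) (\<tau> i) (\<tau> (Suc i))"
      by (intro C1_curve_affine[OF conjunct2[OF \<tau>2(3)[OF j(2)]], where k = 2 and d = "-1"])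
        (auto simp: t field_simps)
    moreover have "\<tau> i < \<tau> (Suc i)" using \<tau>2(3)[OF j(2)] by (simp add: t)
    ultimately show ?thesis by blast
  qed
  moreover have "\<tau> 0 = 0" "\<tau> (m1 + m2) = 1"
    using \<tau>1(1) \<tau>2(2) \<tau>_hi[of "m1 + m2"] by (auto simp: \<tau>_def)
  moreover have "continuous_on {0..1} (\<gamma>1 +++ \<gamma>2)"
    using path_join_imp[of \<gamma>1 \<gamma>2] assms
    by (simp add: path_def pathfinish_def pathstart_def piecewise_C1_curve_def)
  ultimately show ?thesis unfolding piecewise_C1_curve_def by blast
qed

lemma speed_affine:
  assumes "\<And>c. c \<in> \<A> \<Longrightarrow> \<gamma> (k * t + d) \<in> chart_dom c \<Longrightarrow> (chart_map c \<circ> \<gamma>) differentiable (at (k * t + d))"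
    and S: "open S" "t \<in> S" "\<And>s. s \<in> S \<Longrightarrow> \<gamma>' s = \<gamma> (k * s + d)"
    and g: "riemannian \<A> g" and k: "k \<ge> 0"
  shows "speed \<A> g \<gamma>' t = k * speed \<A> g \<gamma> (k * t + d)"
proof -
  interpret riemannian \<A> g by fact
  define c where "c = (SOME c. c \<in> \<A> \<and> \<gamma> (k * t + d) \<in> chart_dom c)"
  have "c \<in> \<A> \<and> \<gamma> (k * t + d) \<in> chart_dom c"
    unfolding c_def by (rule someI_ex) (use chart_at in blast)
  then have c: "c \<in> \<A>" "\<gamma> (k * t + d) \<in> chart_dom c" by auto
  define v where "v = vector_derivative (chart_map c \<circ> \<gamma>) (at (k * t + d))"
  have v: "((chart_map c \<circ> \<gamma>) has_vector_derivative v) (at (k * t + d))"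
    unfolding v_def using assms(1)[OF c] vector_derivative_works by blast
  have "((\<lambda>s. k * s + d) has_vector_derivative k) (at t)"
    by (auto intro!: derivative_eq_intros)
  then have "((chart_map c \<circ> \<gamma> \<circ> (\<lambda>s. k * s + d)) has_vector_derivative k *\<^sub>R v) (at t)"
    using v by (intro vector_diff_chain_at)
  then have "((chart_map c \<circ> \<gamma>') has_vector_derivative k *\<^sub>R v) (at t)"
    by (rule has_vector_derivative_transform_within_open[OF _ S(1,2)]) (simp add: S(3))
  then have "vector_derivative (chart_map c \<circ> \<gamma>') (at t) = k *\<^sub>R v" by (rule vector_derivative_at)
  then have "speed \<A> g \<gamma>' t = sqrt (g c (\<gamma> (k * t + d)) (k *\<^sub>R v) (k *\<^sub>R v))"
    using S by (simp add: speed_def c_def Let_def)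
  also have "\<dots> = k * sqrt (g c (\<gamma> (k * t + d)) v v)"
    using metric_scale[OF c] k by simp
  finally show ?thesis by (simp add: speed_def c_def[symmetric] v_def Let_def)
qed

end

section \<open>Growth of functions along curves\<close>

context riemannian
begin

text \<open>Along the curve \<open>\<rho>\<close> grows at most at the rate of the speed, and the
  integral of \<open>S\<close> grows exactly at that rate, so their difference does not increase.
  The slope bound is demanded at interior times only; \<open>slope_bound_extend\<close> depends on
  this, since its curves start at points where no bound is known yet.\<close>

lemma slope_along_C1:
  assumes C1: "C1_curve \<A> \<gamma> a b" and cont: "continuous_on {a..b} \<gamma>" and ab: "a < b"
    and \<rho>: "continuous_on UNIV \<rho>"
    and slope: "\<And>t. t \<in> {a<..<b} \<Longrightarrow> \<exists>c\<in>\<A>. \<gamma> t \<in> chart_dom c \<and> slope_bound g \<rho> c (\<gamma> t)"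
  shows "speed \<A> g \<gamma> integrable_on {a..b}"
    and "\<rho> (\<gamma> b) \<le> \<rho> (\<gamma> a) + integral {a..b} (speed \<A> g \<gamma>)"
proof -
  obtain S where S: "continuous_on {a..b} S" "\<And>t. t \<in> {a<..<b} \<Longrightarrow> S t = speed \<A> g \<gamma> t"
    "\<And>t c. t \<in> {a..b} \<Longrightarrow> c \<in> \<A> \<Longrightarrow> \<gamma> t \<in> chart_dom c \<Longrightarrow>
      \<exists>v. ((chart_map c \<circ> \<gamma>) has_vector_derivative v) (at t within {a..b}) \<and> S t = sqrt (g c (\<gamma> t) v v)"
    using C1_curve_speed[OF C1 cont ab] by blast
  have Sint: "S integrable_on {a..b}" using S(1) by (rule integrable_continuous_interval)
  have neg: "negligible {a, b}" by simp
  have eq: "\<And>t. t \<in> {a..b} - {a, b} \<Longrightarrow> speed \<A> g \<gamma> t = S t"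
    using S(2) by auto
  show "speed \<A> g \<gamma> integrable_on {a..b}"
    by (rule integrable_spike[OF Sint neg eq])
  have int: "integral {a..b} S = integral {a..b} (speed \<A> g \<gamma>)"
    by (rule integral_spike[OF neg eq])
  define \<phi> where "\<phi> t = \<rho> (\<gamma> t) - integral {a..t} S" for t
  have "\<phi> b \<le> \<phi> a"
  proof (rule nonincreasing_of_right_slope[where \<phi> = \<phi> and a = a and b = b])
    show "a \<le> b" using ab by simp
    show "continuous_on {a..b} \<phi>"
      unfolding \<phi>_def using cont \<rho> Sint
      by (intro continuous_intros indefinite_integral_continuous_1 continuous_on_compose2[OF \<rho>]) auto
    fix t \<epsilon> :: real assume t: "a < t" "t < b" and \<epsilon>: "\<epsilon> > 0"
    obtain c where c: "c \<in> \<A>" "\<gamma> t \<in> chart_dom c" "slope_bound g \<rho> c (\<gamma> t)"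
      using slope[of t] t by (metis greaterThanLessThan_iff)
    obtain v where v: "((chart_map c \<circ> \<gamma>) has_vector_derivative v) (at t within {a..b})"
        "S t = sqrt (g c (\<gamma> t) v v)"
      using S(3)[of t c] c t by auto
    have v': "((chart_map c \<circ> \<gamma>) has_derivative (\<lambda>s. s *\<^sub>R v)) (at t)"
      using v(1) t by (simp add: at_within_Icc_at has_vector_derivative_def)
    obtain \<delta>1 where \<delta>1: "\<delta>1 > 0" "\<And>h x. 0 < h \<Longrightarrow> h < \<delta>1 \<Longrightarrow>
        norm (x - (chart_map c (\<gamma> t) + h *\<^sub>R v)) \<le> \<delta>1 * h \<Longrightarrow>
        \<rho> (chart_inv c x) \<le> \<rho> (\<gamma> t) + h * (sqrt (g c (\<gamma> t) v v) + \<epsilon> / 2)"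
      using slope_boundE[OF c(3) half_gt_zero[OF \<epsilon>], of v] by metis
    \<comment> \<open>A curve with velocity \<open>v\<close> does not follow the ray along
      \<open>v\<close> but stays in the cone around it. This is the reason for demanding slope
      bounds uniformly on cones.\<close>
    obtain \<delta>2 where \<delta>2: "\<delta>2 > 0" "\<And>h y. 0 < h \<Longrightarrow> h < \<delta>2 \<Longrightarrow> norm (y - (t + h *\<^sub>R 1)) \<le> \<delta>2 * h \<Longrightarrow>
        norm ((chart_map c \<circ> \<gamma>) y - ((chart_map c \<circ> \<gamma>) t + h *\<^sub>R (1 *\<^sub>R v))) \<le> \<delta>1 * h"
      using has_derivative_cone[OF v' \<delta>1(1), of 1] by metis
    have "((\<lambda>x. integral {a..x} S) has_real_derivative S t) (at t within {a..b})"
      using integral_has_real_derivative[OF S(1)] t by simp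
    then have I': "((\<lambda>x. integral {a..x} S) has_derivative (\<lambda>s. S t * s)) (at t)"
      using t by (simp add: at_within_Icc_at has_field_derivative_def)
    obtain \<delta>3 where \<delta>3: "\<delta>3 > 0" "\<And>h y. 0 < h \<Longrightarrow> h < \<delta>3 \<Longrightarrow> norm (y - (t + h *\<^sub>R 1)) \<le> \<delta>3 * h \<Longrightarrow>
        norm (integral {a..y} S - (integral {a..t} S + h *\<^sub>R (S t * 1))) \<le> \<epsilon> / 2 * h"
      using has_derivative_cone[OF I', of "\<epsilon> / 2" 1] \<epsilon> by (metis half_gt_zero)
    have "continuous (at t) \<gamma>"
      using cont t at_within_Icc_at[of a t b]
      by (metis atLeastAtMost_iff continuous_on_eq_continuous_within less_imp_le)
    then have "eventually (\<lambda>s. \<gamma> s \<in> chart_dom c) (at t)"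
      using eventually_in_dom[OF c(1), of t UNIV \<gamma>] c(2) by simp
    then obtain \<delta>4 where \<delta>4: "\<delta>4 > 0" "\<And>s. s \<noteq> t \<Longrightarrow> dist s t < \<delta>4 \<Longrightarrow> \<gamma> s \<in> chart_dom c"
      unfolding eventually_at by auto
    define \<delta> where "\<delta> = Min {\<delta>1, \<delta>2, \<delta>3, \<delta>4}"
    have \<delta>: "\<delta> > 0" "\<delta> \<le> \<delta>1" "\<delta> \<le> \<delta>2" "\<delta> \<le> \<delta>3" "\<delta> \<le> \<delta>4"
      using \<delta>1 \<delta>2 \<delta>3 \<delta>4 by (auto simp: \<delta>_def)
    show "\<exists>\<delta>>0. \<forall>h. 0 < h \<and> h < \<delta> \<longrightarrow> \<phi> (t + h) \<le> \<phi> t + \<epsilon> * h"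
    proof (intro exI conjI allI impI)
      show "\<delta> > 0" by fact
      fix h assume h: "0 < h \<and> h < \<delta>"
      have "norm (chart_map c (\<gamma> (t + h)) - (chart_map c (\<gamma> t) + h *\<^sub>R v)) \<le> \<delta>1 * h"
        using \<delta>2(2)[of h "t + h"] h \<delta> \<delta>2(1) by simp
      then have "\<rho> (chart_inv c (chart_map c (\<gamma> (t + h)))) \<le> \<rho> (\<gamma> t) + h * (S t + \<epsilon> / 2)"
        using \<delta>1(2)[of h "chart_map c (\<gamma> (t + h))"] h \<delta> v(2) by simp
      moreover have "\<gamma> (t + h) \<in> chart_dom c" using \<delta>4(2)[of "t + h"] h \<delta> by (simp add: dist_norm)
      ultimately have 1: "\<rho> (\<gamma> (t + h)) \<le> \<rho> (\<gamma> t) + h * (S t + \<epsilon> / 2)" by (simp add: inv_map c(1))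
      have "\<bar>integral {a..t + h} S - (integral {a..t} S + h * S t)\<bar> \<le> \<epsilon> / 2 * h"
        using \<delta>3(2)[of h "t + h"] h \<delta> \<delta>3(1) by simp
      then have "integral {a..t} S + h * S t - integral {a..t + h} S \<le> \<epsilon> / 2 * h" by linarith
      then show "\<phi> (t + h) \<le> \<phi> t + \<epsilon> * h"
        using 1 unfolding \<phi>_def by (simp add: algebra_simps)
    qed
  qed
  then show "\<rho> (\<gamma> b) \<le> \<rho> (\<gamma> a) + integral {a..b} (speed \<A> g \<gamma>)"
    by (simp add: \<phi>_def int)
qed

lemma slope_along_piecewise:
  assumes \<gamma>: "piecewise_C1_curve \<A> \<gamma>" and \<rho>: "continuous_on UNIV \<rho>"
    and slope: "\<And>p. \<exists>c\<in>\<A>. p \<in> chart_dom c \<and> slope_bound g \<rho> c p"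
  shows "speed \<A> g \<gamma> integrable_on {0..1} \<and> \<rho> (\<gamma> 1) \<le> \<rho> (\<gamma> 0) + integral {0..1} (speed \<A> g \<gamma>)"
proof -
  obtain m \<tau> where \<tau>: "\<tau> 0 = 0" "\<tau> (m::nat) = 1"
      "\<And>i. i < m \<Longrightarrow> \<tau> i < \<tau> (Suc i) \<and> C1_curve \<A> \<gamma> (\<tau> i) (\<tau> (Suc i))"
    using \<gamma> unfolding piecewise_C1_curve_def by blast
  have cont: "continuous_on {0..1} \<gamma>" using \<gamma> by (simp add: piecewise_C1_curve_def)
  have up: "\<tau> i \<le> 1" if "i \<le> m" for i
  proof -
    have "\<tau> i \<le> \<tau> m" using that
      by (induction i rule: inc_induct) (use \<tau>(3) in \<open>auto intro: order_trans less_imp_le\<close>)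
    then show ?thesis using \<tau>(2) by simp
  qed
  have "0 \<le> \<tau> i \<and> speed \<A> g \<gamma> integrable_on {0..\<tau> i} \<and>
      \<rho> (\<gamma> (\<tau> i)) \<le> \<rho> (\<gamma> 0) + integral {0..\<tau> i} (speed \<A> g \<gamma>)" if "i \<le> m" for i
    using that
  proof (induction i)
    case 0
    then show ?case using \<tau>(1) integrable_on_refl[of "speed \<A> g \<gamma>" 0] by simp
  next
    case (Suc i)
    then have IH: "0 \<le> \<tau> i" "speed \<A> g \<gamma> integrable_on {0..\<tau> i}"
      "\<rho> (\<gamma> (\<tau> i)) \<le> \<rho> (\<gamma> 0) + integral {0..\<tau> i} (speed \<A> g \<gamma>)" by auto
    have i: "\<tau> i < \<tau> (Suc i)" "C1_curve \<A> \<gamma> (\<tau> i) (\<tau> (Suc i))" using \<tau>(3) Suc by auto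
    have "continuous_on {\<tau> i..\<tau> (Suc i)} \<gamma>"
      using up[OF Suc.prems] IH(1) by (intro continuous_on_subset[OF cont]) auto
    note piece = slope_along_C1[OF i(2) this i(1) \<rho> slope]
    have "speed \<A> g \<gamma> integrable_on {0..\<tau> (Suc i)}"
      using Henstock_Kurzweil_Integration.integrable_combine[OF IH(1) _ IH(2) piece(1)] i(1) by simp
    moreover have "integral {0..\<tau> i} (speed \<A> g \<gamma>) + integral {\<tau> i..\<tau> (Suc i)} (speed \<A> g \<gamma>)
        = integral {0..\<tau> (Suc i)} (speed \<A> g \<gamma>)"
      using Henstock_Kurzweil_Integration.integral_combine[OF IH(1) _ calculation] i(1) by simp
    ultimately show ?case using IH i(1) piece(2) by linarith
  qed
  from this[of m] show ?thesis using \<tau>(2) by simp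
qed

end

section \<open>The Riemannian distance\<close>

text \<open>No bound is asked at the end points, where \<open>speed\<close> need not be the length
  of a tangent vector.\<close>

lemma integral_le_const:
  fixes f :: "real \<Rightarrow> real"
  assumes f: "f integrable_on {a..b}" and "a \<le> b" and le: "\<And>t. t \<in> {a<..<b} \<Longrightarrow> f t \<le> K"
  shows "integral {a..b} f \<le> (b - a) * K"
proof (rule has_integral_le)
  show "(f has_integral integral {a..b} f) {a..b}" using f by (rule integrable_integral)
  show "((\<lambda>t. if t \<in> {a, b} then f t else K) has_integral (b - a) * K) {a..b}"
  proof (rule has_integral_spike_finite)
    show "finite {a, b}" by simp
    show "((\<lambda>t. K) has_integral (b - a) * K) {a..b}" using has_integral_const_real[of K a b] \<open>a \<le> b\<close> by simp
  qed auto
qed (use le in auto)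

context riemannian
begin

lemma chart_segment:
  assumes c: "c \<in> \<A>" and b: "b > 0" and mem: "\<And>t. t \<in> {0..b} \<Longrightarrow> x + t *\<^sub>R w \<in> chart_image c"
  defines "\<gamma> \<equiv> \<lambda>t. chart_inv c (x + t *\<^sub>R w)"
  shows "C1_curve \<A> \<gamma> 0 b" "continuous_on {0..b} \<gamma>"
    "\<And>t. t \<in> {0<..<b} \<Longrightarrow> speed \<A> g \<gamma> t = sqrt (g c (\<gamma> t) w w)"
proof -
  show cont: "continuous_on {0..b} \<gamma>"
    unfolding \<gamma>_def using mem
    by (intro continuous_on_compose2[OF continuous_inv[OF c]] continuous_intros) auto
  have dom: "\<gamma> t \<in> chart_dom c" "chart_map c (\<gamma> t) = x + t *\<^sub>R w" if "t \<in> {0..b}" for t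
    using mem[OF that] c by (auto simp: \<gamma>_def inv_dom map_inv)
  have der: "((chart_map c \<circ> \<gamma>) has_vector_derivative w) (at t within {0..b})" if t: "t \<in> {0..b}" for t
  proof -
    have "((\<lambda>t. x + t *\<^sub>R w) has_vector_derivative w) (at t within {0..b})"
      by (auto intro!: derivative_eq_intros)
    then show ?thesis
      by (rule has_vector_derivative_transform[rotated 2]) (use t dom in auto)
  qed
  show C1: "C1_curve \<A> \<gamma> 0 b"
    unfolding C1_curve_def
  proof
    fix c' assume c': "c' \<in> \<A>"
    show "\<exists>D. (\<forall>t\<in>{s\<in>{0..b}. \<gamma> s \<in> chart_dom c'}.
          ((chart_map c' \<circ> \<gamma>) has_vector_derivative D t) (at t within {0..b})) \<and>
        continuous_on {s\<in>{0..b}. \<gamma> s \<in> chart_dom c'} D"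
    proof (intro exI conjI ballI)
      fix t assume t: "t \<in> {s\<in>{0..b}. \<gamma> s \<in> chart_dom c'}"
      then show "((chart_map c' \<circ> \<gamma>) has_vector_derivative tangent_map c c' id (\<gamma> t) w) (at t within {0..b})"
        using curve_chart_change[OF c c', of \<gamma> t "{0..b}" w] dom[of t] der[of t] cont
        by (simp add: continuous_on_eq_continuous_within)
    next
      have "smoothly_compatible c c'" using maximal c c' by (simp add: maximal_atlas_def)
      then have "smooth_on (chart_map c ` (chart_dom c \<inter> chart_dom c')) (chart_map c' \<circ> chart_inv c)"
        by (simp add: smoothly_compatible_def)
      note * = smooth_on_continuous[OF smooth_on_frechet[OF this, of w]]
      have "continuous_on {s\<in>{0..b}. \<gamma> s \<in> chart_dom c'}
          (\<lambda>t. frechet_derivative (chart_map c' \<circ> chart_inv c) (at (x + t *\<^sub>R w)) w)"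
      proof (rule continuous_on_compose2[OF *])
        show "continuous_on {s\<in>{0..b}. \<gamma> s \<in> chart_dom c'} (\<lambda>t. x + t *\<^sub>R w)"
          by (intro continuous_intros)
        show "(\<lambda>t. x + t *\<^sub>R w) ` {s\<in>{0..b}. \<gamma> s \<in> chart_dom c'} \<subseteq> chart_map c ` (chart_dom c \<inter> chart_dom c')"
          using dom by (force simp: image_iff)
      qed
      then show "continuous_on {s\<in>{0..b}. \<gamma> s \<in> chart_dom c'} (\<lambda>t. tangent_map c c' id (\<gamma> t) w)"
        by (rule continuous_on_eq) (use dom in \<open>auto simp: tangent_map_def\<close>)
    qed
  qed
  show "speed \<A> g \<gamma> t = sqrt (g c (\<gamma> t) w w)" if t: "t \<in> {0<..<b}" for t
  proof -
    obtain S where S: "S t = speed \<A> g \<gamma> t"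
      "\<exists>v. ((chart_map c \<circ> \<gamma>) has_vector_derivative v) (at t within {0..b}) \<and> S t = sqrt (g c (\<gamma> t) v v)"
      using C1_curve_speed[OF C1 cont b] t c dom[of t] by (metis atLeastAtMost_iff greaterThanLessThan_iff less_imp_le)
    then obtain v where v: "((chart_map c \<circ> \<gamma>) has_vector_derivative v) (at t within {0..b})"
      "S t = sqrt (g c (\<gamma> t) v v)" by blast
    have "v = w"
      using vector_derivative_unique_at[of "chart_map c \<circ> \<gamma>" v t w] v(1) der[of t] t
      by (simp add: at_within_Icc_at)
    then show ?thesis using S v by simp
  qed
qed

text \<open>Serves to extract integrability of the speed from \<open>slope_along_piecewise\<close>,
  with a constant as test function.\<close>

lemma slope_bound_const:
  assumes "c \<in> \<A>" "p \<in> chart_dom c"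
  shows "slope_bound g (\<lambda>_. k) c p"
  unfolding slope_bound_def using metric_nonneg[OF assms]
  by (intro allI impI exI[of _ 1]) (auto intro!: mult_nonneg_nonneg add_nonneg_nonneg)

lemma speed_integrable:
  assumes "piecewise_C1_curve \<A> \<gamma>" shows "speed \<A> g \<gamma> integrable_on {0..1}"
proof -
  have "\<exists>c\<in>\<A>. p \<in> chart_dom c \<and> slope_bound g (\<lambda>_. 0) c p" for p
    using chart_at[of p] slope_bound_const by metis
  then show ?thesis using slope_along_piecewise[OF assms, of "\<lambda>_. 0"] by auto
qed

lemma speed_nonneg: "speed \<A> g \<gamma> t \<ge> 0"
proof -
  have "(SOME c. c \<in> \<A> \<and> \<gamma> t \<in> chart_dom c) \<in> \<A> \<and> \<gamma> t \<in> chart_dom (SOME c. c \<in> \<A> \<and> \<gamma> t \<in> chart_dom c)"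
    by (rule someI_ex) (use chart_at in blast)
  then show ?thesis by (simp add: speed_def Let_def metric_nonneg)
qed

text \<open>Off finitely many times, each half of the join runs through its curve at double speed on
  an interval of half the length. The exceptional times are the junction, the ends, and the rescaled
  break points, where the two-sided derivative may not exist.\<close>

lemma length_join:
  assumes \<gamma>: "piecewise_C1_curve \<A> \<gamma>1" "piecewise_C1_curve \<A> \<gamma>2"
  shows "integral {0..1} (speed \<A> g (\<gamma>1 +++ \<gamma>2))
    = integral {0..1} (speed \<A> g \<gamma>1) + integral {0..1} (speed \<A> g \<gamma>2)"
proof -
  have g: "riemannian \<A> g" by unfold_locales
  have half: "((\<lambda>t. k * speed \<A> g \<gamma> (2 * t + d)) has_integral k * integral {0..1} (speed \<A> g \<gamma>) / 2)
      {- d / 2..(1 - d) / 2}" if "piecewise_C1_curve \<A> \<gamma>" for \<gamma> d k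
  proof -
    have "(speed \<A> g \<gamma> has_integral integral {0..1} (speed \<A> g \<gamma>)) (cbox 0 1)"
      using speed_integrable[OF that] by (simp add: integrable_integral)
    note * = has_integral_affinity'[OF this, of 2 d]
    have "i /\<^sub>R 2 ^ DIM(real) = i / 2" "(0 - d) /\<^sub>R 2 = - d / 2" "(1 - d) /\<^sub>R 2 = (1 - d) / 2" for i :: real
      by simp_all
    with * have "((\<lambda>t. speed \<A> g \<gamma> (2 * t + d)) has_integral integral {0..1} (speed \<A> g \<gamma>) / 2)
      {- d / 2..(1 - d) / 2}" by (simp only: box_real real_scaleR_def)
    from has_integral_mult_right[OF this, of k] show ?thesis by simp
  qed
  have 1: "(speed \<A> g (\<gamma>1 +++ \<gamma>2) has_integral integral {0..1} (speed \<A> g \<gamma>1)) {0..1/2}"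
  proof -
    obtain N where N: "finite N" "\<And>t c. t \<in> {0..1} - N \<Longrightarrow> c \<in> \<A> \<Longrightarrow> \<gamma>1 t \<in> chart_dom c \<Longrightarrow>
      (chart_map c \<circ> \<gamma>1) differentiable (at t)" using piecewise_smooth_points[OF \<gamma>(1)] by blast
    show ?thesis
    proof (rule has_integral_spike_finite)
      show "finite ((\<lambda>s. s / 2) ` N \<union> {0, 1/2})" using N(1) by simp
      show "((\<lambda>t. 2 * speed \<A> g \<gamma>1 (2 * t + 0)) has_integral integral {0..1} (speed \<A> g \<gamma>1)) {0..1/2}"
        using half[OF \<gamma>(1), of 2 0] by simp
      fix t :: real assume t: "t \<in> {0..1/2} - ((\<lambda>s. s / 2) ` N \<union> {0, 1/2})"
      have tN: "2 * t + 0 \<notin> N"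
      proof
        assume "2 * t + 0 \<in> N"
        then have "(2 * t + 0) / 2 \<in> (\<lambda>s. s / 2) ` N" by blast
        then show False using t by simp
      qed
      show "speed \<A> g (\<gamma>1 +++ \<gamma>2) t = 2 * speed \<A> g \<gamma>1 (2 * t + 0)"
      proof (rule speed_affine[where S = "{0<..<1/2}"])
        show "(chart_map c \<circ> \<gamma>1) differentiable (at (2 * t + 0))"
          if "c \<in> \<A>" "\<gamma>1 (2 * t + 0) \<in> chart_dom c" for c
          using N(2)[of "2 * t + 0" c] that t tN by simp
      qed (use t g in \<open>auto simp: joinpaths_def\<close>)
    qed
  qed
  have 2: "(speed \<A> g (\<gamma>1 +++ \<gamma>2) has_integral integral {0..1} (speed \<A> g \<gamma>2)) {1/2..1}"
  proof -
    obtain N where N: "finite N" "\<And>t c. t \<in> {0..1} - N \<Longrightarrow> c \<in> \<A> \<Longrightarrow> \<gamma>2 t \<in> chart_dom c \<Longrightarrow>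
      (chart_map c \<circ> \<gamma>2) differentiable (at t)" using piecewise_smooth_points[OF \<gamma>(2)] by blast
    show ?thesis
    proof (rule has_integral_spike_finite)
      show "finite ((\<lambda>s. (s + 1) / 2) ` N \<union> {1, 1/2})" using N(1) by simp
      show "((\<lambda>t. 2 * speed \<A> g \<gamma>2 (2 * t + - 1)) has_integral integral {0..1} (speed \<A> g \<gamma>2)) {1/2..1}"
        using half[OF \<gamma>(2), of 2 "- 1"] by simp
      fix t :: real assume t: "t \<in> {1/2..1} - ((\<lambda>s. (s + 1) / 2) ` N \<union> {1, 1/2})"
      have tN: "2 * t + - 1 \<notin> N"
      proof
        assume "2 * t + - 1 \<in> N"
        then have "(2 * t + - 1 + 1) / 2 \<in> (\<lambda>s. (s + 1) / 2) ` N" by blast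
        then show False using t by simp
      qed
      show "speed \<A> g (\<gamma>1 +++ \<gamma>2) t = 2 * speed \<A> g \<gamma>2 (2 * t + - 1)"
      proof (rule speed_affine[where S = "{1/2<..<1}"])
        show "(chart_map c \<circ> \<gamma>2) differentiable (at (2 * t + - 1))"
          if "c \<in> \<A>" "\<gamma>2 (2 * t + - 1) \<in> chart_dom c" for c
          using N(2)[of "2 * t + - 1" c] that t tN by simp
      qed (use t g in \<open>auto simp: joinpaths_def\<close>)
    qed
  qed
  have "(speed \<A> g (\<gamma>1 +++ \<gamma>2) has_integral
      integral {0..1} (speed \<A> g \<gamma>1) + integral {0..1} (speed \<A> g \<gamma>2)) {0..1}"
    by (rule has_integral_combine[OF _ _ 1 2]) auto
  then show ?thesis by (rule integral_unique)
qed

text \<open>The \<open>g\<close>-length attains a positive minimum on the compact set of Euclidean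
  unit vectors over \<open>K\<close>; homogeneity does the rest.\<close>

lemma metric_lower_bound:
  assumes c: "c \<in> \<A>" and K: "compact K" "K \<subseteq> chart_image c"
  obtains \<kappa> where "\<kappa> > 0" "\<And>x v. x \<in> K \<Longrightarrow> \<kappa> * norm v \<le> sqrt (g c (chart_inv c x) v v)"
proof (cases "K = {}")
  case False
  let ?f = "\<lambda>y. sqrt (g c (chart_inv c (fst y)) (snd y) (snd y))"
  obtain b :: 'e where "norm b = 1" using SOME_Basis norm_Basis by blast
  then have ne: "K \<times> sphere (0::'e) 1 \<noteq> {}" using False by auto
  have comp: "compact (K \<times> sphere (0::'e) 1)" using K(1) by (intro compact_Times) auto
  have "continuous_on (K \<times> sphere 0 1) ?f"
    using K(2) by (intro continuous_on_subset[OF metric_continuous[OF c]]) auto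
  from continuous_attains_inf[OF comp ne this]
  obtain y where y: "y \<in> K \<times> sphere 0 1" "\<And>z. z \<in> K \<times> sphere 0 1 \<Longrightarrow> ?f y \<le> ?f z" by blast
  have "snd y \<noteq> 0" using y(1) by auto
  then have pos: "?f y > 0" using y(1) K(2) c by (auto intro!: metric_pos inv_dom)
  show thesis
  proof (rule that[OF pos])
    fix x v assume x: "x \<in> K"
    then have xc: "chart_inv c x \<in> chart_dom c" using K(2) c inv_dom by blast
    show "?f y * norm v \<le> sqrt (g c (chart_inv c x) v v)"
    proof (cases "v = 0")
      case True
      then show ?thesis using metric_nonneg[OF c xc] by simp
    next
      case False
      then have "(x, v /\<^sub>R norm v) \<in> K \<times> sphere 0 1" using x by simp
      from y(2)[OF this] have "?f y \<le> sqrt (g c (chart_inv c x) (v /\<^sub>R norm v) (v /\<^sub>R norm v))" by simp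
      also have "\<dots> = sqrt (g c (chart_inv c x) v v) / norm v"
        using metric_scale[OF c xc, of "inverse (norm v)" v] by (simp add: field_simps)
      finally show ?thesis using False by (simp add: field_simps)
    qed
  qed
qed (rule that[of 1], auto)

end

text \<open>Connectedness ensures that the infimum in \<open>riemannian_dist\<close> is taken over a
  nonempty set; the infimum of the empty set of reals would be a meaningless value.\<close>

locale connected_riemannian = riemannian \<A> g
  for \<A> :: "('a::t2_space, 'e::euclidean_space) chart set" and g :: "('a, 'e) bilin" +
  assumes connected: "connected (UNIV :: 'a set)"
begin

abbreviation rdist :: "'a \<Rightarrow> 'a \<Rightarrow> real" where
  "rdist \<equiv> riemannian_dist \<A> g"

lemma piecewise_segment:
  assumes c: "c \<in> \<A>" and mem: "\<And>t. t \<in> {0..1} \<Longrightarrow> x + t *\<^sub>R w \<in> chart_image c"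
  shows "piecewise_C1_curve \<A> (\<lambda>t. chart_inv c (x + t *\<^sub>R w))"
  unfolding piecewise_C1_curve_def
proof
  show "continuous_on {0..1} (\<lambda>t. chart_inv c (x + t *\<^sub>R w))"
    using chart_segment(2)[OF c, of 1] mem by simp
  show "\<exists>m \<tau>. \<tau> 0 = 0 \<and> \<tau> m = 1 \<and>
      (\<forall>i<m. \<tau> i < \<tau> (Suc i) \<and> C1_curve \<A> (\<lambda>t. chart_inv c (x + t *\<^sub>R w)) (\<tau> i) (\<tau> (Suc i)))"
    using chart_segment(1)[OF c, of 1] mem by (intro exI[of _ 1] exI[of _ real]) auto
qed

text \<open>Being joined by a curve is transitive and holds between any two points of a coordinate
  ball, so it holds throughout a connected space.\<close>

lemma curve_exists: "\<exists>\<gamma>. piecewise_C1_curve \<A> \<gamma> \<and> \<gamma> 0 = p \<and> \<gamma> 1 = q"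
proof (rule connected_equivalence_relation_gen[OF connected, of p q "\<lambda>_. True"])
  fix x y z assume "\<exists>\<gamma>. piecewise_C1_curve \<A> \<gamma> \<and> \<gamma> 0 = x \<and> \<gamma> 1 = y"
    "\<exists>\<gamma>. piecewise_C1_curve \<A> \<gamma> \<and> \<gamma> 0 = y \<and> \<gamma> 1 = z"
  then obtain \<gamma>1 \<gamma>2 where "piecewise_C1_curve \<A> \<gamma>1" "\<gamma>1 0 = x" "\<gamma>1 1 = y"
    "piecewise_C1_curve \<A> \<gamma>2" "\<gamma>2 0 = y" "\<gamma>2 1 = z" by blast
  then show "\<exists>\<gamma>. piecewise_C1_curve \<A> \<gamma> \<and> \<gamma> 0 = x \<and> \<gamma> 1 = z"
    by (intro exI[of _ "\<gamma>1 +++ \<gamma>2"] conjI piecewise_C1_join) (auto simp: joinpaths_def)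
next
  fix a :: 'a
  obtain c where c: "c \<in> \<A>" "a \<in> chart_dom c" using chart_at by blast
  obtain r where r: "r > 0" "ball (chart_map c a) r \<subseteq> chart_image c"
    using open_image[OF c(1)] c(2) open_contains_ball by (metis imageI)
  define T where "T = chart_dom c \<inter> chart_map c -` ball (chart_map c a) r"
  have "open T" unfolding T_def
    using continuous_map[OF c(1)] open_dom[OF c(1)] by (rule continuous_open_preimage) simp
  moreover have "a \<in> T" using c r by (simp add: T_def)
  moreover have "\<exists>\<gamma>. piecewise_C1_curve \<A> \<gamma> \<and> \<gamma> 0 = x \<and> \<gamma> 1 = y" if "x \<in> T" "y \<in> T" for x y
  proof -
    let ?x = "chart_map c x" and ?y = "chart_map c y"
    have "?x + t *\<^sub>R (?y - ?x) \<in> chart_image c" if t: "t \<in> {0..1}" for t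
    proof -
      have "(1 - t) *\<^sub>R ?x + t *\<^sub>R ?y \<in> ball (chart_map c a) r"
        using convex_ball[of "chart_map c a" r] \<open>x \<in> T\<close> \<open>y \<in> T\<close> t
        unfolding convex_alt T_def by auto
      then show ?thesis using r(2) by (auto simp: algebra_simps)
    qed
    from piecewise_segment[OF c(1) this] show ?thesis
      using that c(1) by (intro exI[of _ "\<lambda>t. chart_inv c (?x + t *\<^sub>R (?y - ?x))"]) (auto simp: T_def inv_map)
  qed
  ultimately show "\<exists>T. openin (top_of_set UNIV) T \<and> a \<in> T \<and>
      (\<forall>x\<in>T. \<forall>y\<in>T. True \<and> True \<longrightarrow> (\<exists>\<gamma>. piecewise_C1_curve \<A> \<gamma> \<and> \<gamma> 0 = x \<and> \<gamma> 1 = y))"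
    by (intro exI[of _ T]) auto
qed auto

lemma rdist_le_length:
  assumes "piecewise_C1_curve \<A> \<gamma>"
  shows "rdist (\<gamma> 0) (\<gamma> 1) \<le> integral {0..1} (speed \<A> g \<gamma>)"
  unfolding riemannian_dist_def
  by (intro cInf_lower bdd_belowI[of _ 0]) (use assms in \<open>auto intro!: integral_nonneg speed_integrable speed_nonneg\<close>)

lemma le_rdist:
  assumes "\<And>\<gamma>. piecewise_C1_curve \<A> \<gamma> \<Longrightarrow> \<gamma> 0 = p \<Longrightarrow> \<gamma> 1 = q \<Longrightarrow> B \<le> integral {0..1} (speed \<A> g \<gamma>)"
  shows "B \<le> rdist p q"
  unfolding riemannian_dist_def
  by (intro cInf_greatest) (use assms curve_exists[of p q] in auto)

lemma rdist_nonneg: "rdist p q \<ge> 0"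
  by (rule le_rdist) (intro integral_nonneg speed_integrable speed_nonneg)

lemma rdist_triangle: "rdist p r \<le> rdist p q + rdist q r"
proof -
  have "rdist p r - integral {0..1} (speed \<A> g \<gamma>1) \<le> rdist q r"
    if 1: "piecewise_C1_curve \<A> \<gamma>1" "\<gamma>1 0 = p" "\<gamma>1 1 = q" for \<gamma>1
  proof (rule le_rdist)
    fix \<gamma>2 assume 2: "piecewise_C1_curve \<A> \<gamma>2" "\<gamma>2 0 = q" "\<gamma>2 1 = r"
    have "rdist ((\<gamma>1 +++ \<gamma>2) 0) ((\<gamma>1 +++ \<gamma>2) 1) \<le> integral {0..1} (speed \<A> g (\<gamma>1 +++ \<gamma>2))"
      using 1 2 by (intro rdist_le_length piecewise_C1_join) auto
    then show "rdist p r - integral {0..1} (speed \<A> g \<gamma>1) \<le> integral {0..1} (speed \<A> g \<gamma>2)"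
      using length_join[OF 1(1) 2(1)] 1 2 by (simp add: joinpaths_def)
  qed
  then have "rdist p r - rdist q r \<le> rdist p q" by (intro le_rdist) fastforce
  then show ?thesis by simp
qed

lemma rdist_segment_le:
  assumes c: "c \<in> \<A>" and mem: "\<And>t. t \<in> {0..1} \<Longrightarrow> x + t *\<^sub>R w \<in> chart_image c"
    and K: "\<And>t. t \<in> {0..1} \<Longrightarrow> sqrt (g c (chart_inv c (x + t *\<^sub>R w)) w w) \<le> K"
  shows "rdist (chart_inv c x) (chart_inv c (x + w)) \<le> K"
proof -
  define \<gamma> where "\<gamma> = (\<lambda>t. chart_inv c (x + t *\<^sub>R w))"
  have \<gamma>: "piecewise_C1_curve \<A> \<gamma>" unfolding \<gamma>_def by (rule piecewise_segment[OF c mem])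
  have "rdist (\<gamma> 0) (\<gamma> 1) \<le> integral {0..1} (speed \<A> g \<gamma>)" by (rule rdist_le_length[OF \<gamma>])
  also have "\<dots> \<le> (1 - 0) * K"
    using chart_segment(3)[OF c zero_less_one mem] K
    by (intro integral_le_const speed_integrable[OF \<gamma>]) (auto simp: \<gamma>_def)
  finally show ?thesis by (simp add: \<gamma>_def)
qed

text \<open>Near \<open>p\<close> and \<open>v\<close> the metric is almost constant, so the
  coordinate segment from \<open>x\<close> to \<open>y\<close> has length close to \<open>h\<close>
  times that of \<open>v\<close>. Both end points are allowed to vary: one use moves the first,
  another the second, and the Lipschitz estimate both.\<close>

lemma rdist_near:
  assumes c: "c \<in> \<A>" and p: "p \<in> chart_dom c" and \<epsilon>: "\<epsilon> > 0"
  obtains r where "r > 0" "ball (chart_map c p) r \<subseteq> chart_image c"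
    "\<And>x y h. x \<in> ball (chart_map c p) r \<Longrightarrow> y \<in> ball (chart_map c p) r \<Longrightarrow> h > 0 \<Longrightarrow>
      norm (y - x - h *\<^sub>R v) < r * h \<Longrightarrow> rdist (chart_inv c x) (chart_inv c y) \<le> h * (sqrt (g c p v v) + \<epsilon>)"
proof -
  obtain r where r: "r > 0" "\<And>x w. norm (x - chart_map c p) < r \<Longrightarrow> norm (w - v) < r \<Longrightarrow>
    x \<in> chart_image c \<and> \<bar>sqrt (g c (chart_inv c x) w w) - sqrt (g c p v v)\<bar> < \<epsilon>"
    using norm_near[OF c p \<epsilon>, of v] by blast
  show thesis
  proof (rule that[OF r(1)])
    show "ball (chart_map c p) r \<subseteq> chart_image c"
      using r(2)[of _ v] r(1) by (auto simp: dist_norm norm_minus_commute)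
    fix x y h assume xy: "x \<in> ball (chart_map c p) r" "y \<in> ball (chart_map c p) r" and h: "h > 0"
      and n: "norm (y - x - h *\<^sub>R v) < r * h"
    define w where "w = (y - x) /\<^sub>R h"
    have w: "y - x = h *\<^sub>R w" using h by (simp add: w_def)
    have "y - x - h *\<^sub>R v = h *\<^sub>R (w - v)" by (simp add: w scaleR_diff_right)
    then have "h * norm (w - v) < r * h" using n h by simp
    then have wv: "norm (w - v) < r" using h by (simp add: mult.commute)
    have near: "norm (x + t *\<^sub>R (y - x) - chart_map c p) < r" if t: "t \<in> {0..1}" for t
    proof -
      have "(1 - t) *\<^sub>R x + t *\<^sub>R y \<in> ball (chart_map c p) r"
        using convex_ball[of "chart_map c p" r] xy t unfolding convex_alt by auto
      moreover have "(1 - t) *\<^sub>R x + t *\<^sub>R y = x + t *\<^sub>R (y - x)" by (simp add: algebra_simps)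
      ultimately show ?thesis by (simp add: dist_norm norm_minus_commute)
    qed
    have "rdist (chart_inv c x) (chart_inv c (x + (y - x))) \<le> h * (sqrt (g c p v v) + \<epsilon>)"
    proof (rule rdist_segment_le[OF c])
      fix t :: real assume t: "t \<in> {0..1}"
      note b = r(2)[OF near[OF t] wv]
      show "x + t *\<^sub>R (y - x) \<in> chart_image c" using b by blast
      then have "chart_inv c (x + t *\<^sub>R (y - x)) \<in> chart_dom c" by (rule inv_dom[OF c])
      from metric_scale[OF c this, of h w]
      have "sqrt (g c (chart_inv c (x + t *\<^sub>R (y - x))) (y - x) (y - x))
          = h * sqrt (g c (chart_inv c (x + t *\<^sub>R (y - x))) w w)" using h by (simp add: w)
      also have "\<dots> \<le> h * (sqrt (g c p v v) + \<epsilon>)" using b h by (intro mult_left_mono) auto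
      finally show "sqrt (g c (chart_inv c (x + t *\<^sub>R (y - x))) (y - x) (y - x)) \<le> h * (sqrt (g c p v v) + \<epsilon>)" .
    qed
    then show "rdist (chart_inv c x) (chart_inv c y) \<le> h * (sqrt (g c p v v) + \<epsilon>)" by simp
  qed
qed

lemma rdist_self: "rdist p p = 0"
proof -
  obtain c where c: "c \<in> \<A>" "p \<in> chart_dom c" using chart_at by blast
  have b: "bilinear (g c p)" by (rule metric_bilinear[OF c])
  have "rdist (chart_inv c (chart_map c p)) (chart_inv c (chart_map c p + 0)) \<le> 0"
    by (rule rdist_segment_le[OF c(1)]) (use c b in \<open>auto simp: inv_map bilinear_lzero\<close>)
  then show ?thesis using rdist_nonneg[of p p] c by (simp add: inv_map)
qed

text \<open>This is \<open>rdist_near\<close> for the zero vector: any \<open>h\<close> with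
  \<open>norm (y - x) < r * h\<close> bounds the distance, and
  \<open>h = 2 / r * norm (y - x)\<close> qualifies, the factor 2 providing strictness.\<close>

lemma rdist_lipschitz:
  assumes c: "c \<in> \<A>" and p: "p \<in> chart_dom c"
  obtains r K where "r > 0" "K \<ge> 0" "ball (chart_map c p) r \<subseteq> chart_image c"
    "\<And>x y. x \<in> ball (chart_map c p) r \<Longrightarrow> y \<in> ball (chart_map c p) r \<Longrightarrow>
      rdist (chart_inv c x) (chart_inv c y) \<le> K * norm (y - x)"
proof -
  obtain r where r: "r > 0" "ball (chart_map c p) r \<subseteq> chart_image c"
    "\<And>x y h. x \<in> ball (chart_map c p) r \<Longrightarrow> y \<in> ball (chart_map c p) r \<Longrightarrow> h > 0 \<Longrightarrow>
      norm (y - x - h *\<^sub>R 0) < r * h \<Longrightarrow> rdist (chart_inv c x) (chart_inv c y) \<le> h * (sqrt (g c p 0 0) + 1)"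
    using rdist_near[OF c p zero_less_one, of 0] by blast
  have b: "g c p 0 0 = 0" using metric_bilinear[OF c p] by (simp add: bilinear_lzero)
  show thesis
  proof (rule that[OF r(1) _ r(2), of "2 / r"])
    fix x y assume xy: "x \<in> ball (chart_map c p) r" "y \<in> ball (chart_map c p) r"
    show "rdist (chart_inv c x) (chart_inv c y) \<le> 2 / r * norm (y - x)"
    proof (cases "x = y")
      case False
      then show ?thesis using r(3)[OF xy, of "2 / r * norm (y - x)"] r(1) b by simp
    qed (simp add: rdist_self)
  qed (use r in auto)
qed

text \<open>The maximum over both orders of the arguments stands in for symmetry of the distance,
  which is itself derived from these estimates in \<open>rdist_commute\<close>.\<close>

lemma lipschitz_continuous:
  assumes \<rho>: "\<And>x y. \<rho> y \<le> \<rho> x + max (rdist x y) (rdist y x)"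
  shows "continuous_on UNIV \<rho>"
proof -
  have "isCont \<rho> p" for p
  proof -
    obtain c where c: "c \<in> \<A>" "p \<in> chart_dom c" using chart_at by blast
    obtain r K where r: "r > 0" "K \<ge> 0" "ball (chart_map c p) r \<subseteq> chart_image c"
      "\<And>x y. x \<in> ball (chart_map c p) r \<Longrightarrow> y \<in> ball (chart_map c p) r \<Longrightarrow>
        rdist (chart_inv c x) (chart_inv c y) \<le> K * norm (y - x)"
      using rdist_lipschitz[OF c] by blast
    have tm: "((\<lambda>q. chart_map c q) \<longlongrightarrow> chart_map c p) (at p)"
      using continuous_map[OF c(1)] open_dom[OF c(1)] c(2)
      by (metis continuous_on_eq_continuous_at isContD)
    have "((\<lambda>q. K * norm (chart_map c q - chart_map c p)) \<longlongrightarrow> K * norm (chart_map c p - chart_map c p)) (at p)"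
      by (intro tendsto_intros tm)
    then have lim: "((\<lambda>q. K * norm (chart_map c q - chart_map c p)) \<longlongrightarrow> 0) (at p)" by simp
    have "eventually (\<lambda>q. chart_map c q \<in> ball (chart_map c p) r) (at p)"
      using tm r(1) by (intro topological_tendstoD) auto
    moreover have "eventually (\<lambda>q. q \<in> chart_dom c) (at p)"
      using open_dom[OF c(1)] c(2) by (intro eventually_at_in_open') auto
    ultimately have "eventually (\<lambda>q. norm (\<rho> q - \<rho> p) \<le> K * norm (chart_map c q - chart_map c p)) (at p)"
    proof eventually_elim
      case (elim q)
      have "rdist q p \<le> K * norm (chart_map c q - chart_map c p)"
        "rdist p q \<le> K * norm (chart_map c q - chart_map c p)"
        using r(4)[of "chart_map c q" "chart_map c p"] r(4)[of "chart_map c p" "chart_map c q"] elim r(1) c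
        by (auto simp: inv_map norm_minus_commute)
      then show ?case using \<rho>[of p q] \<rho>[of q p] by (auto simp: max_def split: if_splits)
    qed
    then have "((\<lambda>q. \<rho> q - \<rho> p) \<longlongrightarrow> 0) (at p)" using lim by (rule Lim_null_comparison)
    then show ?thesis unfolding isCont_def using LIM_zero_cancel by blast
  qed
  then show ?thesis by (simp add: continuous_on_eq_continuous_at)
qed

text \<open>The converse of \<open>slope_bound_imp_le_rdist\<close>. Since the distance occurs in
  both orders, \<open>rdist_near\<close> is applied to \<open>v\<close> from \<open>p\<close> and to
  \<open>- v\<close> towards \<open>p\<close>.\<close>

lemma lipschitz_slope_bound:
  assumes \<rho>: "\<And>x y. \<rho> y \<le> \<rho> x + max (rdist x y) (rdist y x)"
    and c: "c \<in> \<A>" "p \<in> chart_dom c"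
  shows "slope_bound g \<rho> c p"
  unfolding slope_bound_def
proof (intro allI impI)
  fix v :: 'e and \<epsilon> :: real assume \<epsilon>: "\<epsilon> > 0"
  obtain r where r: "r > 0"
    "\<And>x y h. x \<in> ball (chart_map c p) r \<Longrightarrow> y \<in> ball (chart_map c p) r \<Longrightarrow> h > 0 \<Longrightarrow>
      norm (y - x - h *\<^sub>R v) < r * h \<Longrightarrow> rdist (chart_inv c x) (chart_inv c y) \<le> h * (sqrt (g c p v v) + \<epsilon>)"
    using rdist_near[OF c \<epsilon>, of v] by metis
  obtain r' where r': "r' > 0"
    "\<And>x y h. x \<in> ball (chart_map c p) r' \<Longrightarrow> y \<in> ball (chart_map c p) r' \<Longrightarrow> h > 0 \<Longrightarrow>
      norm (y - x - h *\<^sub>R (- v)) < r' * h \<Longrightarrow>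
      rdist (chart_inv c x) (chart_inv c y) \<le> h * (sqrt (g c p (- v) (- v)) + \<epsilon>)"
    using rdist_near[OF c \<epsilon>, of "- v"] by metis
  have neg: "g c p (- v) (- v) = g c p v v"
    using metric_bilinear[OF c] by (simp add: bilinear_lneg bilinear_rneg)
  define s where "s = min r r'"
  define \<delta> where "\<delta> = Min {1, s / 2, s / (norm v + 1)}"
  have s: "s > 0" "s \<le> r" "s \<le> r'" using r r' by (auto simp: s_def)
  have \<delta>: "\<delta> > 0" "\<delta> \<le> 1" "\<delta> < s" "\<delta> \<le> s / (norm v + 1)"
    using s by (auto simp: \<delta>_def add_nonneg_pos min_less_iff_disj)
  have \<delta>s: "\<delta> * (norm v + 1) \<le> s" using \<delta>(4) by (simp add: pos_le_divide_eq add_nonneg_pos)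
  show "\<exists>\<delta>>0. \<forall>h x. 0 < h \<and> h < \<delta> \<and> norm (x - (chart_map c p + h *\<^sub>R v)) \<le> \<delta> * h \<longrightarrow>
      \<rho> (chart_inv c x) \<le> \<rho> p + h * (sqrt (g c p v v) + \<epsilon>)"
  proof (intro exI conjI allI impI)
    show "\<delta> > 0" by fact
    fix h x assume "0 < h \<and> h < \<delta> \<and> norm (x - (chart_map c p + h *\<^sub>R v)) \<le> \<delta> * h"
    then have h: "0 < h" "h < \<delta>" "norm (x - (chart_map c p + h *\<^sub>R v)) \<le> \<delta> * h" by auto
    have "norm (x - chart_map c p) < s" by (rule cone_near(2)[OF h(1,2) \<delta>(2) h(3) \<delta>s])
    then have x: "x \<in> ball (chart_map c p) r" "x \<in> ball (chart_map c p) r'"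
      using s by (auto simp: dist_norm norm_minus_commute)
    have ds: "\<delta> * h < r * h" "\<delta> * h < r' * h" using \<delta> s h by (auto intro!: mult_strict_right_mono)
    have "norm (x - chart_map c p - h *\<^sub>R v) < r * h" using h(3) ds by (simp add: algebra_simps)
    then have 1: "rdist p (chart_inv c x) \<le> h * (sqrt (g c p v v) + \<epsilon>)"
      using r(2)[OF _ x(1) h(1), of "chart_map c p"] r(1) c by (simp add: inv_map)
    have "norm (chart_map c p - x - h *\<^sub>R (- v)) < r' * h"
    proof -
      have "chart_map c p - x - h *\<^sub>R (- v) = - (x - (chart_map c p + h *\<^sub>R v))" by simp
      then show ?thesis using h(3) ds by (metis norm_minus_cancel le_less_trans)
    qed
    then have 2: "rdist (chart_inv c x) p \<le> h * (sqrt (g c p v v) + \<epsilon>)"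
      using r'(2)[OF x(2) _ h(1), of "chart_map c p"] r'(1) c by (simp add: inv_map neg)
    show "\<rho> (chart_inv c x) \<le> \<rho> p + h * (sqrt (g c p v v) + \<epsilon>)"
      using \<rho>[of "chart_inv c x" p] 1 2 by (auto simp: max_def split: if_splits)
  qed
qed

text \<open>From here on every nontrivial lower bound on a distance is obtained in this way: a
  single test function bounds the lengths of all curves at once.\<close>

lemma slope_bound_imp_le_rdist:
  assumes \<rho>: "continuous_on UNIV \<rho>"
    and slope: "\<And>p. \<exists>c\<in>\<A>. p \<in> chart_dom c \<and> slope_bound g \<rho> c p"
  shows "\<rho> q \<le> \<rho> p + rdist p q"
proof -
  have "\<rho> q - \<rho> p \<le> rdist p q"
    by (rule le_rdist) (use slope_along_piecewise[OF _ \<rho> slope] in fastforce)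
  then show ?thesis by simp
qed

text \<open>The test function is the distance to \<open>x\<close> with \<open>x\<close> as second
  argument. The triangle inequality alone gives its two-sided Lipschitz estimate, and no curve has
  to be reversed.\<close>

lemma rdist_commute: "rdist p q = rdist q p"
proof -
  have "rdist y x \<le> rdist x y" for x y
  proof -
    let ?\<rho> = "\<lambda>q. rdist q x"
    have \<rho>: "?\<rho> w \<le> ?\<rho> z + max (rdist z w) (rdist w z)" for z w
      using rdist_triangle[of w x z] by linarith
    have "?\<rho> y \<le> ?\<rho> x + rdist x y"
      by (rule slope_bound_imp_le_rdist[OF lipschitz_continuous[OF \<rho>]])
        (use lipschitz_slope_bound[OF \<rho>] chart_at in metis)
    then show ?thesis by (simp add: rdist_self)
  qed
  then show ?thesis by (meson order_antisym)
qed

section \<open>The distance induces the manifold topology\<close>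

lemma rdist_tendsto_of_tendsto:
  assumes "\<sigma> \<longlonglongrightarrow> p" shows "(\<lambda>n. rdist (\<sigma> n) p) \<longlonglongrightarrow> 0"
proof -
  have \<rho>: "rdist y p \<le> rdist x p + max (rdist x y) (rdist y x)" for x y
    using rdist_triangle[of y p x] by linarith
  have "isCont (\<lambda>q. rdist q p) p"
    using lipschitz_continuous[OF \<rho>] by (simp add: continuous_on_eq_continuous_at)
  then have "(\<lambda>n. rdist (\<sigma> n) p) \<longlonglongrightarrow> rdist p p" using assms by (rule isCont_tendsto_compose)
  then show ?thesis by (simp add: rdist_self)
qed

text \<open>Points outside a coordinate ball around \<open>p\<close> must have a definite distance
  from \<open>p\<close>. The witness is a truncated multiple of the coordinate distance, whose slope
  is at most 1 by the choice of \<open>\<kappa>\<close>. That the space is Hausdorff enters through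
  the closedness of the compact set \<open>L\<close>, which makes the extension by a constant
  continuous.\<close>

lemma tendsto_of_rdist_tendsto:
  assumes lim: "(\<lambda>n. rdist (\<sigma> n) p) \<longlonglongrightarrow> 0" shows "\<sigma> \<longlonglongrightarrow> p"
proof (rule topological_tendstoI)
  fix V assume V: "open V" "p \<in> V"
  obtain c where c: "c \<in> \<A>" "p \<in> chart_dom c" using chart_at by blast
  define X where "X = chart_image c \<inter> chart_inv c -` V"
  have "open X" unfolding X_def using continuous_inv[OF c(1)] open_image[OF c(1)] V(1)
    by (rule continuous_open_preimage)
  moreover have "chart_map c p \<in> X" using c V by (auto simp: X_def inv_map)
  ultimately obtain r where r: "r > 0" "cball (chart_map c p) r \<subseteq> X"
    using open_contains_cball by blast
  have sub: "cball (chart_map c p) r \<subseteq> chart_image c" using r(2) by (auto simp: X_def)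
  obtain \<kappa> where \<kappa>: "\<kappa> > 0" "\<And>x v. x \<in> cball (chart_map c p) r \<Longrightarrow> \<kappa> * norm v \<le> sqrt (g c (chart_inv c x) v v)"
    using metric_lower_bound[OF c(1) compact_cball sub] by blast
  define N where "N = chart_dom c \<inter> chart_map c -` ball (chart_map c p) r"
  \<comment> \<open>Truncating at \<open>r / 2\<close>, strictly inside the ball of radius
    \<open>r\<close>, leaves an overlap on which both branches are the same constant.\<close>
  define \<rho> where "\<rho> q = (if q \<in> N then \<kappa> * min (norm (chart_map c q - chart_map c p)) (r / 2) else \<kappa> * (r / 2))" for q
  have \<rho>max: "\<rho> q \<le> \<kappa> * (r / 2)" for q using \<kappa>(1) by (auto simp: \<rho>_def min_def)
  have "open N" unfolding N_def
    using continuous_map[OF c(1)] open_dom[OF c(1)] by (rule continuous_open_preimage) simp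
  define L where "L = chart_inv c ` cball (chart_map c p) (r / 2)"
  have "cball (chart_map c p) (r / 2) \<subseteq> cball (chart_map c p) r" using r(1) by auto
  then have "compact L" unfolding L_def
    using sub by (intro compact_continuous_image continuous_on_subset[OF continuous_inv[OF c(1)]]) auto
  then have "closed L" by (rule compact_imp_closed)
  have L: "q \<in> L" if "q \<in> chart_dom c" "norm (chart_map c q - chart_map c p) \<le> r / 2" for q
    unfolding L_def using that c(1)
    by (intro image_eqI[of _ _ "chart_map c q"]) (auto simp: inv_map dist_norm norm_minus_commute)
  have LN: "L \<subseteq> N"
    unfolding L_def N_def using sub c(1) r(1)
    by (auto simp: dist_norm map_inv subset_iff inv_dom)
  have cont: "continuous_on UNIV \<rho>"
  proof -
    have "continuous_on N (\<lambda>q. \<kappa> * min (norm (chart_map c q - chart_map c p)) (r / 2))"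
      by (intro continuous_intros continuous_on_subset[OF continuous_map[OF c(1)]]) (auto simp: N_def)
    then have 1: "continuous_on N \<rho>" by (rule continuous_on_eq) (simp add: \<rho>_def)
    have "\<rho> q = \<kappa> * (r / 2)" if "q \<in> - L" for q
      using L[of q] that by (auto simp: \<rho>_def N_def min_def)
    then have 2: "continuous_on (- L) \<rho>" using continuous_on_eq[of "- L" "\<lambda>_. \<kappa> * (r / 2)" \<rho>] by (simp add: continuous_on_const)
    have "continuous_on (N \<union> - L) \<rho>"
      using \<open>open N\<close> \<open>closed L\<close> 1 2 by (intro continuous_on_open_Un) auto
    moreover have "N \<union> - L = UNIV" using LN by auto
    ultimately show ?thesis by simp
  qed
  have slope: "\<exists>c\<in>\<A>. q \<in> chart_dom c \<and> slope_bound g \<rho> c q" for q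
  proof (cases "q \<in> chart_dom c \<and> norm (chart_map c q - chart_map c p) < r / 2")
    case True
    then have q: "q \<in> chart_dom c" "norm (chart_map c q - chart_map c p) < r / 2" by auto
    have qN: "q \<in> N" using L LN q by fastforce
    have "slope_bound g \<rho> c q"
      unfolding slope_bound_def
    proof (intro allI impI)
      fix v :: 'e and \<epsilon> :: real assume \<epsilon>: "\<epsilon> > 0"
      define \<delta> where "\<delta> = Min {1, \<epsilon> / \<kappa>, (r / 2) / (norm v + 1)}"
      have \<delta>: "\<delta> > 0" "\<delta> \<le> 1" "\<delta> \<le> \<epsilon> / \<kappa>" "\<delta> \<le> (r / 2) / (norm v + 1)"
        using \<kappa> r \<epsilon> by (auto simp: \<delta>_def add_nonneg_pos)
      have \<delta>r: "\<delta> * (norm v + 1) \<le> r / 2"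
        by (rule iffD1[OF pos_le_divide_eq, OF _ \<delta>(4)]) (simp add: add_nonneg_pos)
      show "\<exists>\<delta>>0. \<forall>h x. 0 < h \<and> h < \<delta> \<and> norm (x - (chart_map c q + h *\<^sub>R v)) \<le> \<delta> * h \<longrightarrow>
          \<rho> (chart_inv c x) \<le> \<rho> q + h * (sqrt (g c q v v) + \<epsilon>)"
      proof (intro exI conjI allI impI)
        show "\<delta> > 0" by fact
        fix h x assume "0 < h \<and> h < \<delta> \<and> norm (x - (chart_map c q + h *\<^sub>R v)) \<le> \<delta> * h"
        then have h: "0 < h" "h < \<delta>" "norm (x - (chart_map c q + h *\<^sub>R v)) \<le> \<delta> * h" by auto
        have "norm (x - chart_map c q) < r / 2" by (rule cone_near(2)[OF h(1,2) \<delta>(2) h(3) \<delta>r])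
        then have "norm (x - chart_map c p) < r"
          using norm_triangle_ineq[of "x - chart_map c q" "chart_map c q - chart_map c p"] q(2) by simp
        then have xb: "x \<in> ball (chart_map c p) r" by (simp add: dist_norm norm_minus_commute)
        then have x: "x \<in> chart_image c" using sub by (auto simp: subset_iff)
        have "chart_inv c x \<in> N" using x xb c(1) by (simp add: N_def map_inv inv_dom)
        then have "\<rho> (chart_inv c x) \<le> \<kappa> * norm (x - chart_map c p)"
          using x c(1) \<kappa>(1) by (simp add: \<rho>_def map_inv)
        also have "\<dots> \<le> \<kappa> * (norm (chart_map c q - chart_map c p) + h * norm v + \<delta> * h)"
        proof (intro mult_left_mono)
          have "x - chart_map c p = (chart_map c q - chart_map c p) + h *\<^sub>R v + (x - (chart_map c q + h *\<^sub>R v))"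
            by simp
          then have "norm (x - chart_map c p) \<le> norm (chart_map c q - chart_map c p) + norm (h *\<^sub>R v)
              + norm (x - (chart_map c q + h *\<^sub>R v))"
            by (metis norm_triangle_mono norm_triangle_ineq order_refl)
          then show "norm (x - chart_map c p) \<le> norm (chart_map c q - chart_map c p) + h * norm v + \<delta> * h"
            using h by simp
        qed (use \<kappa> in auto)
        also have "\<dots> = \<rho> q + h * (\<kappa> * norm v + \<kappa> * \<delta>)"
          using q(2) qN by (simp add: \<rho>_def algebra_simps)
        also have "\<dots> \<le> \<rho> q + h * (sqrt (g c q v v) + \<epsilon>)"
        proof -
          have "\<kappa> * norm v \<le> sqrt (g c (chart_inv c (chart_map c q)) v v)"
            using q(2) r(1) by (intro \<kappa>(2)) (auto simp: dist_norm norm_minus_commute)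
          moreover have "\<kappa> * \<delta> \<le> \<epsilon>" using \<delta>(3) \<kappa>(1) by (simp add: field_simps)
          ultimately show ?thesis using h(1) q(1) c(1) by (simp add: inv_map add_mono)
        qed
        finally show "\<rho> (chart_inv c x) \<le> \<rho> q + h * (sqrt (g c q v v) + \<epsilon>)" .
      qed
    qed
    then show ?thesis using q(1) c(1) by blast
  next
    case False
    \<comment> \<open>Here \<open>\<rho>\<close> has its maximal value, so every increment is at
      most 0 and any chart at \<open>q\<close> will do.\<close>
    then have q: "\<rho> q = \<kappa> * (r / 2)" by (auto simp: \<rho>_def N_def min_def)
    obtain c' where c': "c' \<in> \<A>" "q \<in> chart_dom c'" using chart_at by blast
    have "slope_bound g \<rho> c' q"
      unfolding slope_bound_def
    proof (intro allI impI exI[of _ 1] conjI)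
      fix v and \<epsilon> h :: real and x
      assume "\<epsilon> > 0" "0 < h \<and> h < 1 \<and> norm (x - (chart_map c' q + h *\<^sub>R v)) \<le> 1 * h"
      then have "0 \<le> h * (sqrt (g c' q v v) + \<epsilon>)" using metric_nonneg[OF c'] by simp
      then show "\<rho> (chart_inv c' x) \<le> \<rho> q + h * (sqrt (g c' q v v) + \<epsilon>)" using \<rho>max[of "chart_inv c' x"] q by simp
    qed simp
    then show ?thesis using c' by blast
  qed
  have pN: "p \<in> N" using c r by (simp add: N_def)
  then have "\<rho> p = 0" using r(1) by (simp add: \<rho>_def)
  then have le: "\<rho> q \<le> rdist q p" for q
    using slope_bound_imp_le_rdist[OF cont slope, of q p] by (simp add: rdist_commute)
  have "\<kappa> * (r / 2) > 0" using \<kappa> r by simp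
  then have "eventually (\<lambda>n. rdist (\<sigma> n) p < \<kappa> * (r / 2)) sequentially"
    using lim by (rule order_tendstoD(2)[rotated])
  then show "eventually (\<lambda>n. \<sigma> n \<in> V) sequentially"
  proof eventually_elim
    case (elim n)
    then have "\<rho> (\<sigma> n) < \<kappa> * (r / 2)" using le[of "\<sigma> n"] by simp
    then have "\<sigma> n \<in> N" by (auto simp: \<rho>_def split: if_splits)
    then have "\<sigma> n \<in> chart_dom c" "chart_map c (\<sigma> n) \<in> X" using r(2) by (auto simp: N_def subset_iff)
    then show ?case using c(1) by (auto simp: X_def inv_map)
  qed
qed

text \<open>The distance from \<open>\<psi> p\<close>, pulled back along \<open>\<psi>\<close>,
  again has slope at most 1. In this way no curve needs to be transported by
  \<open>\<psi>\<close>.\<close>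

lemma rdist_isometry_le:
  assumes pres: "preserves_bilin \<A> \<psi> g" and cont: "continuous_on UNIV \<psi>"
    and diff: "\<And>c c' p. c \<in> \<A> \<Longrightarrow> c' \<in> \<A> \<Longrightarrow> p \<in> chart_dom c \<Longrightarrow> \<psi> p \<in> chart_dom c' \<Longrightarrow>
      (chart_map c' \<circ> \<psi> \<circ> chart_inv c) differentiable (at (chart_map c p))"
  shows "rdist (\<psi> p) (\<psi> q) \<le> rdist p q"
proof -
  let ?\<rho> = "\<lambda>q. rdist (\<psi> p) q"
  have \<rho>: "?\<rho> w \<le> ?\<rho> z + max (rdist z w) (rdist w z)" for z w
    using rdist_triangle[of "\<psi> p" w z] by linarith
  have "(?\<rho> \<circ> \<psi>) q \<le> (?\<rho> \<circ> \<psi>) p + rdist p q"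
  proof (rule slope_bound_imp_le_rdist)
    show "continuous_on UNIV (?\<rho> \<circ> \<psi>)"
      using lipschitz_continuous[OF \<rho>] cont by (intro continuous_on_compose) (auto intro: continuous_on_subset)
    fix x
    obtain c c' where c: "c \<in> \<A>" "x \<in> chart_dom c" "c' \<in> \<A>" "\<psi> x \<in> chart_dom c'"
      using chart_at by metis
    have "((chart_map c' \<circ> \<psi> \<circ> chart_inv c) has_derivative tangent_map c c' \<psi> x) (at (chart_map c x))"
      using diff[OF c(1,3,2,4)] unfolding tangent_map_def by (simp add: frechet_derivative_works)
    moreover have "g c' (\<psi> x) (tangent_map c c' \<psi> x v) (tangent_map c c' \<psi> x v) \<le> g c x v v" for v
      using pres c unfolding preserves_bilin_def by (metis order_refl)
    ultimately have "slope_bound g (?\<rho> \<circ> \<psi>) c x"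
      using c cont lipschitz_slope_bound[OF \<rho>] by (intro slope_bound_pullback[where g = g and c' = c']) auto
    then show "\<exists>c\<in>\<A>. x \<in> chart_dom c \<and> slope_bound g (?\<rho> \<circ> \<psi>) c x" using c by blast
  qed
  then show ?thesis by (simp add: rdist_self)
qed

end

section \<open>Zeros of nonnegative functions\<close>

text \<open>\<open>B\<close> is the second derivative of \<open>f\<close> at \<open>x\<close>.\<close>
lemma nonneg_second_order:
  fixes f :: "'e::euclidean_space \<Rightarrow> real"
  assumes S: "open S" "x \<in> S"
    and der: "\<And>y. y \<in> S \<Longrightarrow> (f has_derivative D y) (at y)"
    and der2: "\<And>b. b \<in> Basis \<Longrightarrow> (\<lambda>y. D y b) differentiable (at x)"
    and nonneg: "\<And>y. y \<in> S \<Longrightarrow> f y \<ge> 0" and zero: "f x = 0"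
  obtains B where "bilinear B"
    "\<And>\<eta>. \<eta> > 0 \<Longrightarrow> \<exists>r>0. \<forall>w. norm w < r \<longrightarrow> x + w \<in> S \<and>
      (\<exists>\<theta>. 0 < \<theta> \<and> \<theta> < 1 \<and> \<bar>f (x + w) - \<theta> * B w w\<bar> \<le> \<theta> * (\<eta> * (norm w)\<^sup>2))"
proof -
  define D2 where "D2 b = frechet_derivative (\<lambda>y. D y b) (at x)" for b
  have D2: "((\<lambda>y. D y b) has_derivative D2 b) (at x)" if "b \<in> Basis" for b
    using der2[OF that] by (simp add: D2_def frechet_derivative_works)
  have linD: "linear (D y)" if "y \<in> S" for y
    using der[OF that] by (rule has_derivative_linear)
  have linD2: "linear (D2 b)" if "b \<in> Basis" for b
    using D2[OF that] by (rule has_derivative_linear)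
  define B where "B w v = (\<Sum>b\<in>Basis. (v \<bullet> b) * D2 b w)" for w v :: 'e
  have bil: "bilinear B"
    unfolding bilinear_def B_def
  proof (intro conjI allI)
    show "linear (\<lambda>v. \<Sum>b\<in>Basis. (v \<bullet> b) * D2 b w)" for w
      by (intro linearI) (auto simp: inner_add_left distrib_right sum.distrib sum_distrib_left mult.assoc)
    show "linear (\<lambda>w. \<Sum>b\<in>Basis. (v \<bullet> b) * D2 b w)" for v
      by (intro linearI)
        (auto simp: linear_add[OF linD2] linear_scale[OF linD2] distrib_left sum.distrib sum_distrib_left
          mult.left_commute)
  qed
  \<comment> \<open>\<open>x\<close> is a minimum of \<open>f\<close> on \<open>S\<close>, so the
    expansion starts with the quadratic term.\<close>
  have Dx: "D x = (\<lambda>v. 0)"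
    using differential_zero_maxmin[OF S(2,1) der[OF S(2)]] nonneg zero by auto
  show thesis
  proof (rule that[OF bil])
    fix \<eta> :: real assume \<eta>: "\<eta> > 0"
    define \<eta>' where "\<eta>' = \<eta> / DIM('e)"
    have \<eta>': "\<eta>' > 0" using \<eta> by (simp add: \<eta>'_def)
    have "\<forall>b\<in>Basis. \<exists>d>0. \<forall>y. norm (y - x) < d \<longrightarrow> \<bar>D y b - D2 b (y - x)\<bar> \<le> \<eta>' * norm (y - x)"
    proof
      fix b :: 'e assume b: "b \<in> Basis"
      show "\<exists>d>0. \<forall>y. norm (y - x) < d \<longrightarrow> \<bar>D y b - D2 b (y - x)\<bar> \<le> \<eta>' * norm (y - x)"
        using D2[OF b] \<eta>' Dx unfolding has_derivative_at_alt by auto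
    qed
    then obtain d where d: "\<And>b. b \<in> Basis \<Longrightarrow> d b > 0"
      "\<And>b y. b \<in> Basis \<Longrightarrow> norm (y - x) < d b \<Longrightarrow> \<bar>D y b - D2 b (y - x)\<bar> \<le> \<eta>' * norm (y - x)"
      by metis
    obtain r0 where r0: "r0 > 0" "ball x r0 \<subseteq> S" using S open_contains_ball by blast
    define r where "r = Min (insert r0 (d ` Basis))"
    have r: "r > 0" "r \<le> r0" using r0 d(1) by (auto simp: r_def)
    have rd: "r \<le> d b" if "b \<in> Basis" for b unfolding r_def using that by (intro Min.coboundedI) auto
    have inS: "x + w \<in> S" if "norm w < r" for w using that r(2) r0(2) by (auto simp: dist_norm subset_iff)
    have bound: "\<bar>D y v - B (y - x) v\<bar> \<le> \<eta> * norm (y - x) * norm v" if y: "norm (y - x) < r" for y v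
    proof -
      have yS: "y \<in> S" using inS[of "y - x"] y by simp
      have "D y v = D y (\<Sum>b\<in>Basis. (v \<bullet> b) *\<^sub>R b)" by (simp add: euclidean_representation)
      also have "\<dots> = (\<Sum>b\<in>Basis. (v \<bullet> b) * D y b)"
        by (simp add: linear_sum[OF linD[OF yS]] linear_scale[OF linD[OF yS]])
      finally have "D y v - B (y - x) v = (\<Sum>b\<in>Basis. (v \<bullet> b) * (D y b - D2 b (y - x)))"
        by (simp add: B_def sum_subtractf right_diff_distrib)
      then have "\<bar>D y v - B (y - x) v\<bar> \<le> (\<Sum>b\<in>Basis. \<bar>(v \<bullet> b) * (D y b - D2 b (y - x))\<bar>)" by (simp add: sum_abs)
      also have "\<dots> \<le> (\<Sum>b\<in>(Basis::'e set). norm v * (\<eta>' * norm (y - x)))"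
        unfolding abs_mult using d(2) rd y
        by (intro sum_mono mult_mono) (auto simp: Basis_le_norm intro: order.strict_trans2)
      also have "\<dots> = \<eta> * norm (y - x) * norm v" by (simp add: \<eta>'_def)
      finally show ?thesis .
    qed
    show "\<exists>r>0. \<forall>w. norm w < r \<longrightarrow> x + w \<in> S \<and>
      (\<exists>\<theta>. 0 < \<theta> \<and> \<theta> < 1 \<and> \<bar>f (x + w) - \<theta> * B w w\<bar> \<le> \<theta> * (\<eta> * (norm w)\<^sup>2))"
    proof (rule exI[of _ r], intro conjI allI impI)
      fix w :: 'e assume w: "norm w < r"
      show "x + w \<in> S" by (rule inS[OF w])
      have tw: "norm (t *\<^sub>R w) < r" if "0 \<le> t" "t \<le> 1" for t
        using that w mult_left_le_one_le[of "norm w" t] by simp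
      have der1: "((\<lambda>t. f (x + t *\<^sub>R w)) has_derivative (\<lambda>s. D (x + t *\<^sub>R w) (s *\<^sub>R w))) (at t within X)"
        if "0 \<le> t" "t \<le> 1" for t X
      proof -
        have "((\<lambda>t. x + t *\<^sub>R w) has_derivative (\<lambda>s. s *\<^sub>R w)) (at t within X)"
          by (auto intro!: derivative_eq_intros)
        from has_derivative_compose[OF this der[OF inS[OF tw[OF that]]]] show ?thesis .
      qed
      \<comment> \<open>One application of the mean value theorem reduces \<open>f (x + w)\<close>
        to the first derivative at \<open>x + \<theta> w\<close>, which is
        \<open>\<theta> * B w w\<close> up to an error carrying the same factor
        \<open>\<theta>\<close>. The unknown \<open>\<theta>\<close> replaces the 1/2 of Taylor's
        formula; being positive, it does not affect signs.\<close>
      have "\<exists>\<theta>\<in>{0<..<1}. f (x + 1 *\<^sub>R w) - f (x + 0 *\<^sub>R w) = D (x + \<theta> *\<^sub>R w) ((1 - 0) *\<^sub>R w)"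
        by (rule mvt_simple[of 0 1 "\<lambda>t. f (x + t *\<^sub>R w)" "\<lambda>t s. D (x + t *\<^sub>R w) (s *\<^sub>R w)"]) (use der1 in auto)
      then obtain \<theta> where \<theta>: "0 < \<theta>" "\<theta> < 1" "f (x + w) = D (x + \<theta> *\<^sub>R w) w"
        using zero by auto
      have "\<bar>f (x + w) - B (\<theta> *\<^sub>R w) w\<bar> \<le> \<eta> * norm (\<theta> *\<^sub>R w) * norm w"
        using bound[of "x + \<theta> *\<^sub>R w" w] tw[of \<theta>] \<theta> by simp
      then have "\<bar>f (x + w) - \<theta> * B w w\<bar> \<le> \<theta> * (\<eta> * (norm w)\<^sup>2)"
        using \<theta> bil by (simp add: bilinear_lmul power2_eq_square mult.assoc mult.left_commute)
      then show "\<exists>\<theta>. 0 < \<theta> \<and> \<theta> < 1 \<and> \<bar>f (x + w) - \<theta> * B w w\<bar> \<le> \<theta> * (\<eta> * (norm w)\<^sup>2)"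
        using \<theta> by blast
    qed (use r in auto)
  qed
qed

text \<open>Nonnegativity of \<open>f\<close> makes \<open>B\<close> positive semidefinite, and
  growth by \<open>\<kappa> * (norm e)\<^sup>2\<close> at a nearby point \<open>x + e\<close> forces
  \<open>B e e > 0\<close>, since the error there is below half of that growth. Then
  \<open>B\<close> on \<open>v + \<delta> e\<close> is a nonnegative quadratic polynomial in
  \<open>\<delta>\<close> with positive leading coefficient, so it has at most one zero; wherever it
  is positive, so is \<open>f\<close> along the initial part of the ray.\<close>

lemma nonneg_directions:
  fixes f :: "'e::euclidean_space \<Rightarrow> real"
  assumes "open S" "x \<in> S"
    and "\<And>y. y \<in> S \<Longrightarrow> (f has_derivative D y) (at y)"
    and "\<And>b. b \<in> Basis \<Longrightarrow> (\<lambda>y. D y b) differentiable (at x)"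
    and nonneg: "\<And>y. y \<in> S \<Longrightarrow> f y \<ge> 0" and zero: "f x = 0" and \<kappa>: "\<kappa> > 0"
  obtains r where "r > 0"
    "\<And>e v. norm e < r \<Longrightarrow> f (x + e) > 0 \<Longrightarrow> f (x + e) \<ge> \<kappa> * (norm e)\<^sup>2 \<Longrightarrow>
      finite {\<delta>. \<not> eventually (\<lambda>h. f (x + h *\<^sub>R (v + \<delta> *\<^sub>R e)) > 0) (at_right 0)}"
proof -
  obtain B where B: "bilinear B"
    "\<And>\<eta>. \<eta> > 0 \<Longrightarrow> \<exists>r>0. \<forall>w. norm w < r \<longrightarrow> x + w \<in> S \<and>
      (\<exists>\<theta>. 0 < \<theta> \<and> \<theta> < 1 \<and> \<bar>f (x + w) - \<theta> * B w w\<bar> \<le> \<theta> * (\<eta> * (norm w)\<^sup>2))"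
    using nonneg_second_order[OF assms(1-6)] by blast
  have small: "eventually (\<lambda>h. norm (h *\<^sub>R v) < r) (at_right 0)" if "r > 0" for r and v :: 'e
  proof -
    have "((\<lambda>h. norm (h *\<^sub>R v)) \<longlongrightarrow> norm (0 *\<^sub>R v)) (at_right 0)"
      by (intro tendsto_intros)
    then show ?thesis using that by (auto dest: order_tendstoD)
  qed
  have pos: "eventually (\<lambda>h. f (x + h *\<^sub>R v) > 0) (at_right 0)" if v: "B v v > 0" for v
  proof -
    have "v \<noteq> 0" using v B(1) by (auto simp: bilinear_lzero)
    \<comment> \<open>With this choice the error at \<open>h v\<close> is half of the main term
      \<open>h\<^sup>2 * B v v\<close>, both with the factor \<open>\<theta>\<close>.\<close>
    define \<eta> where "\<eta> = B v v / (2 * (norm v)\<^sup>2)"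
    have "\<eta> > 0" using v \<open>v \<noteq> 0\<close> by (simp add: \<eta>_def)
    then obtain r where r: "r > 0" "\<And>w. norm w < r \<Longrightarrow>
      (\<exists>\<theta>. 0 < \<theta> \<and> \<theta> < 1 \<and> \<bar>f (x + w) - \<theta> * B w w\<bar> \<le> \<theta> * (\<eta> * (norm w)\<^sup>2))" using B(2) by metis
    show ?thesis using small[OF r(1), of v] eventually_at_right_less[of 0]
    proof eventually_elim
      case (elim h)
      obtain \<theta> where \<theta>: "0 < \<theta>" "\<bar>f (x + h *\<^sub>R v) - \<theta> * B (h *\<^sub>R v) (h *\<^sub>R v)\<bar> \<le> \<theta> * (\<eta> * (norm (h *\<^sub>R v))\<^sup>2)"
        using r(2)[OF elim(1)] by blast
      have 1: "B (h *\<^sub>R v) (h *\<^sub>R v) = h\<^sup>2 * B v v" using B(1) by (simp add: bilinear_lmul bilinear_rmul power2_eq_square)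
      have 2: "\<eta> * (norm (h *\<^sub>R v))\<^sup>2 = h\<^sup>2 * (B v v / 2)"
        using \<open>v \<noteq> 0\<close> by (simp add: \<eta>_def power_mult_distrib)
      have "\<theta> * (h\<^sup>2 * B v v) = 2 * (\<theta> * (h\<^sup>2 * (B v v / 2)))" by simp
      then have "f (x + h *\<^sub>R v) \<ge> \<theta> * (h\<^sup>2 * (B v v / 2))"
        using \<theta>(2)[unfolded 1 2] by linarith
      moreover have "\<theta> * (h\<^sup>2 * (B v v / 2)) > 0" using \<theta>(1) elim(2) v by simp
      ultimately show ?case by linarith
    qed
  qed
  have Bnonneg: "B v v \<ge> 0" for v
  proof (rule ccontr)
    assume "\<not> B v v \<ge> 0"
    then have v: "B v v < 0" by simp
    have "v \<noteq> 0" using v B(1) by (auto simp: bilinear_lzero)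
    define \<eta> where "\<eta> = - B v v / (2 * (norm v)\<^sup>2)"
    have "\<eta> > 0" using v \<open>v \<noteq> 0\<close> by (simp add: \<eta>_def divide_neg_pos)
    then obtain r where r: "r > 0" "\<And>w. norm w < r \<Longrightarrow> x + w \<in> S \<and>
      (\<exists>\<theta>. 0 < \<theta> \<and> \<theta> < 1 \<and> \<bar>f (x + w) - \<theta> * B w w\<bar> \<le> \<theta> * (\<eta> * (norm w)\<^sup>2))" using B(2) by metis
    define h where "h = r / (2 * norm v)"
    have h: "h > 0" "norm (h *\<^sub>R v) < r" using r(1) \<open>v \<noteq> 0\<close> by (auto simp: h_def)
    obtain \<theta> where \<theta>: "0 < \<theta>" "\<bar>f (x + h *\<^sub>R v) - \<theta> * B (h *\<^sub>R v) (h *\<^sub>R v)\<bar> \<le> \<theta> * (\<eta> * (norm (h *\<^sub>R v))\<^sup>2)"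
      using r(2)[OF h(2)] by blast
    have 1: "B (h *\<^sub>R v) (h *\<^sub>R v) = h\<^sup>2 * B v v" using B(1) by (simp add: bilinear_lmul bilinear_rmul power2_eq_square)
    have 2: "\<eta> * (norm (h *\<^sub>R v))\<^sup>2 = - (h\<^sup>2 * (B v v / 2))"
      using \<open>v \<noteq> 0\<close> by (simp add: \<eta>_def power_mult_distrib)
    have "\<theta> * (h\<^sup>2 * B v v) = 2 * (\<theta> * (h\<^sup>2 * (B v v / 2)))" "\<theta> * - (h\<^sup>2 * (B v v / 2)) = - (\<theta> * (h\<^sup>2 * (B v v / 2)))"
      by simp_all
    then have "f (x + h *\<^sub>R v) \<le> \<theta> * (h\<^sup>2 * (B v v / 2))"
      using \<theta>(2)[unfolded 1 2] by linarith
    moreover have "\<theta> * (h\<^sup>2 * (B v v / 2)) < 0" using \<theta>(1) h(1) v by (simp add: mult_less_0_iff)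
    ultimately show False using nonneg[of "x + h *\<^sub>R v"] r(2)[OF h(2)] by auto
  qed
  obtain r where r: "r > 0" "\<And>w. norm w < r \<Longrightarrow>
      (\<exists>\<theta>. 0 < \<theta> \<and> \<theta> < 1 \<and> \<bar>f (x + w) - \<theta> * B w w\<bar> \<le> \<theta> * (\<kappa> / 2 * (norm w)\<^sup>2))"
    using B(2)[OF half_gt_zero[OF \<kappa>]] by metis
  show thesis
  proof (rule that[OF r(1)])
    fix e v :: 'e assume e: "norm e < r" "f (x + e) > 0" "f (x + e) \<ge> \<kappa> * (norm e)\<^sup>2"
    have Be: "B e e > 0"
    proof (rule ccontr)
      assume "\<not> B e e > 0"
      obtain \<theta> where \<theta>: "0 < \<theta>" "\<theta> < 1" "\<bar>f (x + e) - \<theta> * B e e\<bar> \<le> \<theta> * (\<kappa> / 2 * (norm e)\<^sup>2)"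
        using r(2)[OF e(1)] by blast
      have "\<theta> * B e e \<le> 0" using \<theta>(1) \<open>\<not> B e e > 0\<close> by (simp add: mult_le_0_iff)
      then have 1: "f (x + e) \<le> \<theta> * (\<kappa> / 2 * (norm e)\<^sup>2)" using \<theta>(3) by linarith
      also have "\<dots> \<le> 1 * (\<kappa> / 2 * (norm e)\<^sup>2)" using \<theta> \<kappa> by (intro mult_right_mono) auto
      finally have 2: "f (x + e) \<le> \<kappa> * (norm e)\<^sup>2 / 2" by simp
      then have "\<kappa> * (norm e)\<^sup>2 \<le> 0" using e(3) by linarith
      then show False using 2 e(2) by linarith
    qed
    define N where "N = {\<delta>. B (v + \<delta> *\<^sub>R e) (v + \<delta> *\<^sub>R e) = 0}"
    have quad: "B (v + \<delta> *\<^sub>R e) (v + \<delta> *\<^sub>R e) = B v v + \<delta> * (B v e + B e v) + \<delta>\<^sup>2 * B e e" for \<delta>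
      using B(1) by (simp add: bilinear_ladd bilinear_radd bilinear_lmul bilinear_rmul power2_eq_square algebra_simps)
    \<comment> \<open>Strict convexity: with two distinct zeros the polynomial would be negative at
      their midpoint.\<close>
    have "a = b" if ab: "a \<in> N" "b \<in> N" for a b
    proof (rule ccontr)
      assume "a \<noteq> b"
      define q where "q \<delta> = B v v + \<delta> * (B v e + B e v) + \<delta>\<^sup>2 * B e e" for \<delta>
      have "q ((a + b) / 2) = (q a + q b) / 2 - ((a - b) / 2)\<^sup>2 * B e e"
        by (simp add: q_def power2_eq_square field_simps)
      moreover have "q a = 0" "q b = 0" using ab quad by (simp_all add: N_def q_def)
      moreover have "q ((a + b) / 2) \<ge> 0" using Bnonneg[of "v + ((a + b) / 2) *\<^sub>R e"] quad by (simp add: q_def)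
      ultimately have "((a - b) / 2)\<^sup>2 * B e e \<le> 0" by simp
      moreover have "((a - b) / 2)\<^sup>2 * B e e > 0" using \<open>a \<noteq> b\<close> Be by simp
      ultimately show False by (simp only: not_le)
    qed
    then have "finite N"
      by (metis finite.emptyI finite.insertI finite_subset singletonI subsetI)
    moreover have "{\<delta>. \<not> eventually (\<lambda>h. f (x + h *\<^sub>R (v + \<delta> *\<^sub>R e)) > 0) (at_right 0)} \<subseteq> N"
      using pos Bnonneg by (auto simp: N_def less_le)
    ultimately show "finite {\<delta>. \<not> eventually (\<lambda>h. f (x + h *\<^sub>R (v + \<delta> *\<^sub>R e)) > 0) (at_right 0)}"
      by (rule finite_subset[rotated])
  qed
qed

section \<open>Slopes across the boundary\<close>

context riemannian
begin

text \<open>The direction \<open>v\<close> is replaced by a nearby \<open>v + e\<close> whose ray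
  lies in \<open>M0\<close> right after \<open>p\<close>. Integrating the known slopes along this
  ray costs \<open>\<epsilon> / 3\<close>, and the local Lipschitz constant \<open>K\<close>,
  however large, pays for the way from the ray to \<open>x\<close>, whose length is at most
  \<open>2 * \<eta> * h\<close>.\<close>

lemma slope_bound_extend:
  assumes c: "c \<in> \<A>" and p: "p \<in> chart_dom c" and cont: "continuous_on UNIV \<rho>"
    and lip: "r > 0" "K \<ge> 0"
      "\<And>x y. x \<in> ball (chart_map c p) r \<Longrightarrow> y \<in> ball (chart_map c p) r \<Longrightarrow>
        \<rho> (chart_inv c y) \<le> \<rho> (chart_inv c x) + K * norm (y - x)"
    and slope: "\<And>q. q \<in> M0 \<Longrightarrow> \<exists>c\<in>\<A>. q \<in> chart_dom c \<and> slope_bound g \<rho> c q"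
    and rays: "\<And>v \<eta>. \<eta> > 0 \<Longrightarrow> \<exists>e. norm e < \<eta> \<and> eventually (\<lambda>h. chart_inv c (chart_map c p + h *\<^sub>R (v + e)) \<in> M0) (at_right 0)"
  shows "slope_bound g \<rho> c p"
  unfolding slope_bound_def
proof (intro allI impI)
  fix v and \<epsilon> :: real assume \<epsilon>: "\<epsilon> > 0"
  then have \<epsilon>3: "\<epsilon> / 3 > 0" by simp
  obtain s where s: "s > 0" "\<And>x w. norm (x - chart_map c p) < s \<Longrightarrow> norm (w - v) < s \<Longrightarrow>
      x \<in> chart_image c \<and> \<bar>sqrt (g c (chart_inv c x) w w) - sqrt (g c p v v)\<bar> < \<epsilon> / 3"
    using norm_near[OF c p \<epsilon>3, of v] by metis
  \<comment> \<open>Chosen so that \<open>K * \<eta> \<le> \<epsilon> / 3\<close>, with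
    \<open>K + 1\<close> in the denominator because \<open>K\<close> may be 0. It is used twice, for
    the opening of the cone and for the size of \<open>e\<close>.\<close>
  define \<eta> where "\<eta> = \<epsilon> / (3 * (K + 1))"
  have \<eta>: "\<eta> > 0" "K * \<eta> \<le> \<epsilon> / 3"
    using \<epsilon> lip(2) by (auto simp: \<eta>_def field_simps add_pos_nonneg)
  obtain e where e: "norm e < min (min 1 s) \<eta>"
    "eventually (\<lambda>h. chart_inv c (chart_map c p + h *\<^sub>R (v + e)) \<in> M0) (at_right 0)"
    using rays[of "min (min 1 s) \<eta>" v] s(1) \<eta>(1) by auto
  obtain h0 where h0: "h0 > 0" "\<And>h. 0 < h \<Longrightarrow> h < h0 \<Longrightarrow> chart_inv c (chart_map c p + h *\<^sub>R (v + e)) \<in> M0"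
    using e(2) by (auto simp: eventually_at_right_field)
  define n where "n = norm v + 2"
  have n: "n > 0" "norm v + 1 \<le> n" "norm (v + e) \<le> n"
    using norm_triangle_ineq[of v e] e(1) by (auto simp: n_def add_nonneg_pos)
  define \<delta> where "\<delta> = Min {1, h0, \<eta>, s / n, r / n}"
  have \<delta>: "\<delta> > 0" "\<delta> \<le> 1" "\<delta> \<le> h0" "\<delta> \<le> \<eta>" "\<delta> \<le> s / n" "\<delta> \<le> r / n"
    using h0 \<eta> s lip(1) n by (auto simp: \<delta>_def)
  have \<delta>n: "\<delta> * n \<le> s" "\<delta> * n \<le> r" using \<delta>(5,6) n(1) by (auto simp: pos_le_divide_eq)
  show "\<exists>\<delta>>0. \<forall>h x. 0 < h \<and> h < \<delta> \<and> norm (x - (chart_map c p + h *\<^sub>R v)) \<le> \<delta> * h \<longrightarrow>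
      \<rho> (chart_inv c x) \<le> \<rho> p + h * (sqrt (g c p v v) + \<epsilon>)"
  proof (intro exI conjI allI impI)
    show "\<delta> > 0" by fact
    fix h x assume "0 < h \<and> h < \<delta> \<and> norm (x - (chart_map c p + h *\<^sub>R v)) \<le> \<delta> * h"
    then have h: "0 < h" "h < \<delta>" "norm (x - (chart_map c p + h *\<^sub>R v)) \<le> \<delta> * h" by auto
    define \<gamma> where "\<gamma> = (\<lambda>t. chart_inv c (chart_map c p + t *\<^sub>R (v + e)))"
    have hn: "h * n < \<delta> * n" using h n by simp
    have tn: "norm (t *\<^sub>R (v + e)) < s" "norm (t *\<^sub>R (v + e)) < r" if "0 \<le> t" "t \<le> h" for t
    proof -
      have "norm (t *\<^sub>R (v + e)) \<le> h * n" using that n(3) by (simp add: mult_mono)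
      then show "norm (t *\<^sub>R (v + e)) < s" "norm (t *\<^sub>R (v + e)) < r" using hn \<delta>n by linarith+
    qed
    have near: "chart_map c p + t *\<^sub>R (v + e) \<in> chart_image c"
      "sqrt (g c (\<gamma> t) (v + e) (v + e)) \<le> sqrt (g c p v v) + \<epsilon> / 3" if "0 \<le> t" "t \<le> h" for t
    proof -
      have "chart_map c p + t *\<^sub>R (v + e) \<in> chart_image c \<and> \<bar>sqrt (g c (\<gamma> t) (v + e) (v + e)) - sqrt (g c p v v)\<bar> < \<epsilon> / 3"
        unfolding \<gamma>_def using tn(1)[OF that] e(1) by (intro s(2)) auto
      then show "chart_map c p + t *\<^sub>R (v + e) \<in> chart_image c"
        "sqrt (g c (\<gamma> t) (v + e) (v + e)) \<le> sqrt (g c p v v) + \<epsilon> / 3" by linarith+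
    qed
    note seg = chart_segment[OF c h(1), of "chart_map c p" "v + e", folded \<gamma>_def]
    have seg': "C1_curve \<A> \<gamma> 0 h" "continuous_on {0..h} \<gamma>"
      "\<And>t. t \<in> {0<..<h} \<Longrightarrow> speed \<A> g \<gamma> t = sqrt (g c (\<gamma> t) (v + e) (v + e))"
      using seg near(1) by (auto simp: \<gamma>_def)
    have sl: "\<exists>c\<in>\<A>. \<gamma> t \<in> chart_dom c \<and> slope_bound g \<rho> c (\<gamma> t)" if "t \<in> {0<..<h}" for t
      using that h(2) \<delta>(3) by (intro slope) (auto simp: \<gamma>_def intro!: h0(2))
    note along = slope_along_C1[OF seg'(1,2) h(1) cont sl]
    have "integral {0..h} (speed \<A> g \<gamma>) \<le> (h - 0) * (sqrt (g c p v v) + \<epsilon> / 3)"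
      using along(1) h(1) seg'(3) near(2) by (intro integral_le_const) auto
    then have 1: "\<rho> (\<gamma> h) \<le> \<rho> p + h * (sqrt (g c p v v) + \<epsilon> / 3)"
      using along(2) c p by (simp add: \<gamma>_def inv_map)
    have "norm (x - chart_map c p) < r"
      by (rule cone_near(2)[OF h(1,2) \<delta>(2) h(3)])
        (use \<delta>n(2) n(2) \<delta>(1) mult_left_mono[of "norm v + 1" n \<delta>] in linarith)
    then have xb: "x \<in> ball (chart_map c p) r" by (simp add: dist_norm norm_minus_commute)
    have yb: "chart_map c p + h *\<^sub>R (v + e) \<in> ball (chart_map c p) r"
      using tn(2)[of h] h(1) by (simp add: dist_norm)
    have "x - (chart_map c p + h *\<^sub>R (v + e)) = (x - (chart_map c p + h *\<^sub>R v)) - h *\<^sub>R e"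
      by (simp add: algebra_simps)
    then have "norm (x - (chart_map c p + h *\<^sub>R (v + e))) \<le> norm (x - (chart_map c p + h *\<^sub>R v)) + norm (h *\<^sub>R e)"
      by (metis norm_triangle_ineq4)
    also have "\<dots> \<le> \<eta> * h + \<eta> * h"
    proof (rule add_mono)
      show "norm (x - (chart_map c p + h *\<^sub>R v)) \<le> \<eta> * h"
        using h mult_right_mono[OF \<delta>(4), of h] by linarith
      show "norm (h *\<^sub>R e) \<le> \<eta> * h" using h(1) e(1) by (simp add: mult.commute)
    qed
    finally have "K * norm (x - (chart_map c p + h *\<^sub>R (v + e))) \<le> K * (\<eta> * h + \<eta> * h)"
      using lip(2) by (rule mult_left_mono)
    also have "\<dots> = (K * \<eta>) * (2 * h)" by simp
    also have "\<dots> \<le> \<epsilon> / 3 * (2 * h)" using \<eta>(2) h(1) by (intro mult_right_mono) auto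
    finally have "\<rho> (chart_inv c x) \<le> \<rho> (\<gamma> h) + \<epsilon> / 3 * (2 * h)"
      using lip(3)[OF yb xb] by (simp add: \<gamma>_def)
    then show "\<rho> (chart_inv c x) \<le> \<rho> p + h * (sqrt (g c p v v) + \<epsilon>)"
      using 1 by (simp add: algebra_simps)
  qed
qed

end

section \<open>Torus actions\<close>

locale torus_action = smooth_atlas \<A>
  for \<A> :: "('a::t2_space, 'e::euclidean_space) chart set" +
  fixes act :: "real ^ 'n \<Rightarrow> 'a \<Rightarrow> 'a"
  assumes action: "effective_torus_action \<A> act"
begin

lemma act_0 [simp]: "act 0 p = p"
  and act_add: "act (s + t) p = act s (act t p)"
  and act_id_iff: "act s = id \<longleftrightarrow> s \<in> (\<lambda>v. (2 * pi) *\<^sub>R v) ` int_lattice"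
  and continuous_action: "continuous_on UNIV (\<lambda>(s, p). act s p)"
  using action by (auto simp: effective_torus_action_def)

lemma act_minus [simp]: "act (- s) (act s p) = p" "act s (act (- s) p) = p"
  using act_add[of "- s" s p] act_add[of s "- s" p] by auto

lemma continuous_act: "continuous_on UNIV (act s)"
  using continuous_on_compose2[OF continuous_action, of UNIV "\<lambda>p. (s, p)"] by (simp add: continuous_intros)

lemma continuous_orbit: "continuous_on UNIV (\<lambda>s. act (s *\<^sub>R \<xi>) p)"
  using continuous_on_compose2[OF continuous_action, of UNIV "\<lambda>s. (s *\<^sub>R \<xi>, p)"] by (simp add: continuous_intros)

lemma action_differentiable:
  assumes "c \<in> \<A>" "c' \<in> \<A>" "p \<in> chart_dom c" "act s p \<in> chart_dom c'"
  shows "(\<lambda>(s, x). chart_map c' (act s (chart_inv c x))) differentiable (at (s, chart_map c p))"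
proof -
  have "smooth_on {(s, x). x \<in> chart_map c ` chart_dom c \<and> act s (chart_inv c x) \<in> chart_dom c'}
        (\<lambda>(s, x). chart_map c' (act s (chart_inv c x)))"
    using action assms(1,2) by (simp add: effective_torus_action_def)
  then show ?thesis using assms by (elim smooth_on_differentiable) (auto simp: inv_map)
qed

lemma act_differentiable:
  assumes "c \<in> \<A>" "c' \<in> \<A>" "p \<in> chart_dom c" "act s p \<in> chart_dom c'"
  shows "(chart_map c' \<circ> act s \<circ> chart_inv c) differentiable (at (chart_map c p))"
proof -
  have "(\<lambda>x. (s, x)) differentiable (at (chart_map c p))"
    by (auto simp: differentiable_def intro!: derivative_eq_intros)
  from differentiable_chain_at[OF this action_differentiable[OF assms]]
  show ?thesis by (simp add: o_def)
qed

text \<open>All three facts come from joint differentiability of the action at the identity: the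
  derivative splits over the two factors, it is the identity on the second because 0 acts trivially,
  and its linearity on the first is linearity of \<open>fund_field\<close>.\<close>

lemma action_derivative:
  assumes c: "c \<in> \<A>" "p \<in> chart_dom c"
  shows "((\<lambda>(s, x). chart_map c (act s (chart_inv c x))) has_derivative
      (\<lambda>(\<xi>, w). fund_field act \<xi> c p + w)) (at (0, chart_map c p))"
    and "((\<lambda>s. chart_map c (act (s *\<^sub>R \<xi>) p)) has_vector_derivative fund_field act \<xi> c p) (at 0)"
    and "linear (\<lambda>\<xi>. fund_field act \<xi> c p)"
proof -
  let ?\<Theta> = "\<lambda>(s, x). chart_map c (act s (chart_inv c x))"
  obtain D where D: "(?\<Theta> has_derivative D) (at (0, chart_map c p))"
    using action_differentiable[OF c(1,1,2), of 0] c(2) unfolding differentiable_def by auto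
  have lin: "linear D" using D by (rule has_derivative_linear)
  have D1: "((\<lambda>s. chart_map c (act (s *\<^sub>R \<xi>) p)) has_vector_derivative D (\<xi>, 0)) (at 0)" for \<xi>
  proof -
    have "((\<lambda>s::real. (s *\<^sub>R \<xi>, chart_map c p)) has_derivative (\<lambda>s. (s *\<^sub>R \<xi>, 0))) (at 0)"
      by (auto intro!: derivative_eq_intros)
    moreover have "(?\<Theta> has_derivative D) (at ((\<lambda>s::real. (s *\<^sub>R \<xi>, chart_map c p)) 0))" using D by simp
    ultimately have "((\<lambda>s. ?\<Theta> (s *\<^sub>R \<xi>, chart_map c p)) has_derivative (\<lambda>s. D (s *\<^sub>R \<xi>, 0))) (at 0)"
      by (rule has_derivative_compose)
    moreover have "D (s *\<^sub>R \<xi>, 0) = s *\<^sub>R D (\<xi>, 0)" for s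
      using linear_scale[OF lin, of s "(\<xi>, 0)"] by simp
    ultimately show ?thesis using c by (simp add: has_vector_derivative_def inv_map)
  qed
  have fund: "fund_field act \<xi> c p = D (\<xi>, 0)" for \<xi>
    unfolding fund_field_def by (rule vector_derivative_at[OF D1])
  have D2: "D (0, w) = w" for w
  proof -
    have "((\<lambda>x. (0, x)) has_derivative (\<lambda>w. (0, w))) (at (chart_map c p))"
      by (auto intro!: derivative_eq_intros)
    from has_derivative_compose[OF this D]
    have 1: "((\<lambda>x. ?\<Theta> (0, x)) has_derivative (\<lambda>w. D (0, w))) (at (chart_map c p))" .
    have "((\<lambda>x. x) has_derivative (\<lambda>w. D (0, w))) (at (chart_map c p))"
      by (rule has_derivative_transform_within_open[OF 1 open_image[OF c(1)]]) (use c in \<open>auto simp: inv_map\<close>)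
    then have "(\<lambda>w. D (0, w)) = (\<lambda>w. w)" by (rule has_derivative_unique[OF _ has_derivative_ident])
    then show ?thesis by metis
  qed
  have "D (\<xi>, w) = fund_field act \<xi> c p + w" for \<xi> w
    using linear_add[OF lin, of "(\<xi>, 0)" "(0, w)"] by (simp add: fund D2)
  then have "D = (\<lambda>(\<xi>, w). fund_field act \<xi> c p + w)" by auto
  then show "(?\<Theta> has_derivative (\<lambda>(\<xi>, w). fund_field act \<xi> c p + w)) (at (0, chart_map c p))"
    using D by simp
  show "((\<lambda>s. chart_map c (act (s *\<^sub>R \<xi>) p)) has_vector_derivative fund_field act \<xi> c p) (at 0)"
    using D1 by (simp add: fund)
  show "linear (\<lambda>\<xi>. fund_field act \<xi> c p)"
  proof (rule linearI)
    show "fund_field act (a + b) c p = fund_field act a c p + fund_field act b c p" for a b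
      using linear_add[OF lin, of "(a, 0)" "(b, 0)"] by (simp add: fund)
    show "fund_field act (k *\<^sub>R a) c p = k *\<^sub>R fund_field act a c p" for k a
      using linear_scale[OF lin, of k "(a, 0)"] by (simp add: fund)
  qed
qed

text \<open>If the field of \<open>\<xi>\<close> vanished everywhere, all its orbits would be
  locally constant, hence constant, and the whole line through \<open>\<xi>\<close> would act
  trivially. Effectiveness allows this only for a lattice.\<close>

lemma fund_field_nonzero:
  assumes "\<xi> \<noteq> 0"
  shows "\<exists>c p. c \<in> \<A> \<and> p \<in> chart_dom c \<and> fund_field act \<xi> c p \<noteq> 0"
proof (rule ccontr)
  assume "\<not> ?thesis"
  then have zero: "fund_field act \<xi> c p = 0" if "c \<in> \<A>" "p \<in> chart_dom c" for c p using that by blast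
  have const: "act (s *\<^sub>R \<xi>) p = p" for s p
  proof -
    let ?\<kappa> = "\<lambda>s. act (s *\<^sub>R \<xi>) p"
    have "?\<kappa> s = ?\<kappa> 0"
    proof (rule connected_local_const[where f = ?\<kappa> and A = UNIV])
      show "\<forall>a\<in>UNIV. eventually (\<lambda>b. ?\<kappa> a = ?\<kappa> b) (at a within UNIV)"
      proof
        fix a :: real
        obtain c where c: "c \<in> \<A>" "?\<kappa> a \<in> chart_dom c" using chart_at by blast
        have "open (?\<kappa> -` chart_dom c)"
          using continuous_orbit open_dom[OF c(1)] by (intro open_vimage) auto
        moreover have "a \<in> ?\<kappa> -` chart_dom c" using c by simp
        ultimately obtain d where d: "d > 0" "ball a d \<subseteq> ?\<kappa> -` chart_dom c" using open_contains_ball by blast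
        have der: "((\<lambda>s. chart_map c (?\<kappa> s)) has_derivative (\<lambda>s. 0)) (at b)" if b: "b \<in> ball a d" for b
        proof -
          have kb: "?\<kappa> b \<in> chart_dom c" using b d by blast
          \<comment> \<open>By the group law the velocity of the orbit at time \<open>b\<close> is
            the fundamental field at the point reached at time \<open>b\<close>.\<close>
          have "((\<lambda>s. chart_map c (act (s *\<^sub>R \<xi>) (?\<kappa> b))) has_derivative (\<lambda>s. 0)) (at 0)"
            using action_derivative(2)[OF c(1) kb, of \<xi>] zero[OF c(1) kb] by (simp add: has_vector_derivative_def)
          moreover have "((\<lambda>s. s - b) has_derivative (\<lambda>s. s)) (at b)"
            by (auto intro!: derivative_eq_intros)
          ultimately have "((\<lambda>s. chart_map c (act ((s - b) *\<^sub>R \<xi>) (?\<kappa> b))) has_derivative (\<lambda>s. 0)) (at b)"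
            by (intro has_derivative_compose[of "\<lambda>s. s - b"]) auto
          then show ?thesis by (simp flip: act_add scaleR_add_left)
        qed
        have "?\<kappa> a = ?\<kappa> b" if b: "b \<in> ball a d" for b
        proof -
          have "chart_map c (?\<kappa> a) = chart_map c (?\<kappa> b)"
            by (rule has_derivative_zero_unique_connected[of "ball a d" "\<lambda>s. chart_map c (?\<kappa> s)"])
              (use der b d(1) in \<open>auto simp: connected_ball\<close>)
          moreover have "?\<kappa> b \<in> chart_dom c" using b d by blast
          ultimately show ?thesis using c inv_map by metis
        qed
        then show "eventually (\<lambda>b. ?\<kappa> a = ?\<kappa> b) (at a within UNIV)"
          using d(1) unfolding eventually_at by (intro exI[of _ d]) (auto simp: dist_commute)
      qed
    qed auto
    then show ?thesis by simp
  qed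
  obtain i where i: "\<xi> $ i \<noteq> 0" using assms by (auto simp: vec_eq_iff)
  \<comment> \<open>This multiple of \<open>\<xi>\<close> has \<open>pi\<close>, half a period, as
    its coordinate at \<open>i\<close>, so it lies outside the lattice.\<close>
  have "act ((pi / \<xi> $ i) *\<^sub>R \<xi>) = id" using const by auto
  then obtain z where z: "z \<in> int_lattice" "(pi / \<xi> $ i) *\<^sub>R \<xi> = (2 * pi) *\<^sub>R z" by (auto simp: act_id_iff)
  have "((pi / \<xi> $ i) *\<^sub>R \<xi>) $ i = ((2 * pi) *\<^sub>R z) $ i" by (simp only: z(2))
  then have "2 * z $ i = 1" using i by simp
  moreover have "z $ i \<in> \<int>" using z(1) by (simp add: int_lattice_def)
  then obtain k where "z $ i = of_int k" by (auto elim: Ints_cases)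
  ultimately have "of_int (2 * k) = (1::real)" by simp
  then have "2 * k = 1" using of_int_eq_1_iff by blast
  then show False by presburger
qed

text \<open>The form in which compactness of the torus is used: parameters may be taken from a
  compact cube.\<close>

lemma act_fundamental_domain: "\<exists>s'\<in>cbox 0 (\<chi> i. 2 * pi). act s = act s'"
proof -
  define z :: "real ^ 'n" where "z = (\<chi> i. of_int \<lfloor>s $ i / (2 * pi)\<rfloor>)"
  have z: "act ((2 * pi) *\<^sub>R z) = id" unfolding act_id_iff by (auto simp: int_lattice_def z_def)
  define s' where "s' = s - (2 * pi) *\<^sub>R z"
  have "act s = act s'"
  proof
    fix p
    have "act s p = act s' (act ((2 * pi) *\<^sub>R z) p)" by (simp add: s'_def flip: act_add)
    then show "act s p = act s' p" by (simp add: z)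
  qed
  moreover have "s' \<in> cbox 0 (\<chi> i. 2 * pi)"
  proof -
    have "0 \<le> s $ i - 2 * pi * of_int \<lfloor>s $ i / (2 * pi)\<rfloor> \<and> s $ i - 2 * pi * of_int \<lfloor>s $ i / (2 * pi)\<rfloor> \<le> 2 * pi" for i
    proof -
      have "of_int \<lfloor>s $ i / (2 * pi)\<rfloor> \<le> s $ i / (2 * pi)" "s $ i / (2 * pi) \<le> of_int \<lfloor>s $ i / (2 * pi)\<rfloor> + 1"
        by linarith+
      then have "of_int \<lfloor>s $ i / (2 * pi)\<rfloor> * (2 * pi) \<le> s $ i" "s $ i \<le> (of_int \<lfloor>s $ i / (2 * pi)\<rfloor> + 1) * (2 * pi)"
        by (simp_all only: pos_le_divide_eq pos_divide_le_eq pi_gt_zero zero_less_mult_iff zero_less_numeral simp_thms)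
      then show ?thesis by (simp add: algebra_simps)
    qed
    then show ?thesis by (simp add: mem_box_cart s'_def z_def)
  qed
  ultimately show ?thesis by blast
qed

end

section \<open>The open orbits of a Delzant manifold\<close>

lemma label_affine: "label u l j ((1 - \<epsilon>) *\<^sub>R x + \<epsilon> *\<^sub>R y) = (1 - \<epsilon>) * label u l j x + \<epsilon> * label u l j y"
  by (simp add: label_def inner_add_right algebra_simps)

lemma convex_polytope_of: "convex (polytope_of u l)"
  unfolding convex_alt polytope_of_def by (auto simp: label_affine)

text \<open>A label with \<open>u j = 0\<close> is constant and says nothing about the position of
  \<open>x\<close> in the polyhedron; hence the case distinction.\<close>

lemma interior_polytopeI:
  fixes u :: "'d::finite \<Rightarrow> real ^ 'n"
  assumes x: "x \<in> polytope_of u l" and pos: "\<And>j. u j \<noteq> 0 \<Longrightarrow> label u l j x > 0"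
  shows "x \<in> interior (polytope_of u l)"
proof (rule interiorI)
  have "{y. \<forall>j. u j \<noteq> 0 \<longrightarrow> label u l j y > 0} = (\<Inter>j\<in>{j. u j \<noteq> 0}. {y. 0 < u j \<bullet> y + l j})"
    by (auto simp: label_def)
  also have "open \<dots>"
    by (intro open_INT ballI open_Collect_less continuous_intros) auto
  finally show "open {y. \<forall>j. u j \<noteq> 0 \<longrightarrow> label u l j y > 0}" .
  show "x \<in> {y. \<forall>j. u j \<noteq> 0 \<longrightarrow> label u l j y > 0}" using pos by simp
  show "{y. \<forall>j. u j \<noteq> 0 \<longrightarrow> label u l j y > 0} \<subseteq> polytope_of u l"
  proof
    fix y assume y: "y \<in> {y. \<forall>j. u j \<noteq> 0 \<longrightarrow> label u l j y > 0}"
    have "label u l j y \<ge> 0" for j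
    proof (cases "u j = 0")
      case True
      then have "label u l j y = label u l j x" by (simp add: label_def)
      then show ?thesis using x by (simp add: polytope_of_def)
    next
      case False
      then show ?thesis using y by (simp add: less_imp_le)
    qed
    then show "y \<in> polytope_of u l" by (simp add: polytope_of_def)
  qed
qed

lemma interior_polytopeD:
  assumes x: "x \<in> interior (polytope_of u l)" and j: "u j \<noteq> 0"
  shows "label u l j x > 0"
proof -
  obtain d where d: "d > 0" "cball x d \<subseteq> polytope_of u l" using x mem_interior_cball by blast
  define y where "y = x - (d / norm (u j)) *\<^sub>R u j"
  have "y \<in> cball x d" using d(1) j by (simp add: y_def dist_norm)
  then have "0 \<le> label u l j y" using d(2) by (auto simp: polytope_of_def)
  also have "label u l j y = label u l j x - d / norm (u j) * (u j \<bullet> u j)"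
    by (simp add: label_def y_def inner_diff_right)
  also have "\<dots> < label u l j x" using d(1) j by simp
  finally show ?thesis .
qed

locale delzant = torus_action \<A> act
  for \<A> :: "('a::t2_space, 'e::euclidean_space) chart set" and act :: "real ^ 'n \<Rightarrow> 'a \<Rightarrow> 'a" +
  fixes F :: "('a, 'e) bilin" and \<mu> :: "'a \<Rightarrow> real ^ 'n"
    and u :: "'d::finite \<Rightarrow> real ^ 'n" and l :: "'d \<Rightarrow> real"
  assumes delzant: "delzant_manifold \<A> F act \<mu> u l"
begin

lemma range_moment: "range \<mu> = polytope_of u l"
  and moment: "moment_map \<A> F act \<mu>"
  and symplectic: "symplectic_form \<A> F"
  using delzant by (auto simp: delzant_manifold_def hamiltonian_toric_manifold_def)

lemma moment_smooth: "c \<in> \<A> \<Longrightarrow> smooth_on (chart_image c) (\<mu> \<circ> chart_inv c)"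
  using moment by (auto simp: moment_map_def smooth_fun_def)

text \<open>A convex set with empty interior lies in a hyperplane. For its normal \<open>a\<close>
  the function \<open>\<mu> q \<bullet> a\<close> would be constant, so by the moment map equation
  and nondegeneracy of \<open>F\<close> the field of \<open>a\<close> would vanish, against
  effectiveness.\<close>

lemma interior_nonempty: "interior (polytope_of u l) \<noteq> {}"
proof
  assume "interior (polytope_of u l) = {}"
  then obtain a b where a: "a \<noteq> 0" "polytope_of u l \<subseteq> {x. a \<bullet> x = b}"
    using empty_interior_subset_hyperplane[OF convex_polytope_of] by metis
  obtain c p where cp: "c \<in> \<A>" "p \<in> chart_dom c" "fund_field act a c p \<noteq> 0"
    using fund_field_nonzero[OF a(1)] by blast
  have "\<mu> q \<bullet> a = b" for q
  proof -
    have "\<mu> q \<in> {x. a \<bullet> x = b}" using a(2) range_moment by blast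
    then show ?thesis by (simp add: inner_commute)
  qed
  then have "(\<lambda>q. \<mu> q \<bullet> a) = (\<lambda>q. b)" by auto
  then have "differential (\<lambda>q. \<mu> q \<bullet> a) c p v = 0" for v
    by (simp add: differential_def o_def)
  moreover have "F c p (fund_field act a c p) v = - differential (\<lambda>q. \<mu> q \<bullet> a) c p v" for v
    using moment cp by (simp add: moment_map_def)
  ultimately have "\<forall>v. F c p (fund_field act a c p) v = 0" by simp
  then have "fund_field act a c p = 0"
    using symplectic cp unfolding symplectic_form_def by blast
  then show False using cp by simp
qed

text \<open>At a point of the level set over \<open>p\<close>, moving \<open>\<mu>\<close> by \<open>\<epsilon>\<close> towards the interior moves the vanishing
  coordinates, hence the chart point, by \<open>O(\<surd>\<epsilon>)\<close>. So the vanishing labels grow at least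
  quadratically along some small displacement \<open>e\<close>, which makes their Hessians positive there.\<close>
lemma quadratic_growth:
  assumes c: "c \<in> \<A>" and p: "p \<in> chart_dom c"
  obtains \<kappa> where "\<kappa> > 0"
    "\<And>r. r > 0 \<Longrightarrow> \<exists>e. norm e < r \<and> (\<forall>j. u j \<noteq> 0 \<and> label u l j (\<mu> p) = 0 \<longrightarrow>
      label u l j (\<mu> (chart_inv c (chart_map c p + e))) > 0 \<and>
      label u l j (\<mu> (chart_inv c (chart_map c p + e))) \<ge> \<kappa> * (norm e)\<^sup>2)"
proof -
  obtain \<pi> where \<pi>: "delzant_quotient_map \<A> F act \<mu> u l \<pi>"
    using delzant by (auto simp: delzant_manifold_def)
  define Z where "Z = delzant_level u l"
  have surj: "\<pi> ` Z = UNIV" and lab: "\<And>z j. z \<in> Z \<Longrightarrow> (cmod (z $ j))\<^sup>2 / 2 = label u l j (\<mu> (\<pi> z))"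
    using \<pi> by (auto simp: delzant_quotient_map_def Let_def Z_def)
  obtain z where z: "z \<in> Z" "\<pi> z = p" using surj by (metis UNIV_I imageE)
  have "\<exists>W h. open W \<and> z \<in> W \<and> smooth_on W h \<and> (\<forall>w\<in>W \<inter> Z. \<pi> w \<in> chart_dom c \<and> h w = chart_map c (\<pi> w))"
    using \<pi> z c p unfolding delzant_quotient_map_def Let_def Z_def by blast
  then obtain W h where W: "open W" "z \<in> W" "smooth_on W h"
    "\<And>w. w \<in> W \<Longrightarrow> w \<in> Z \<Longrightarrow> \<pi> w \<in> chart_dom c \<and> h w = chart_map c (\<pi> w)" by blast
  obtain h' where h': "(h has_derivative h') (at z)"
    using smooth_on_differentiable[OF W(3,2)] by (auto simp: differentiable_def)
  obtain K0 where K0: "K0 > 0" "\<And>w. norm (h' w) \<le> norm w * K0"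
    using bounded_linear.pos_bounded[OF has_derivative_bounded_linear[OF h']] by blast
  obtain d1 where d1: "d1 > 0" "\<And>w. norm (w - z) < d1 \<Longrightarrow> norm (h w - h z - h' (w - z)) \<le> 1 * norm (w - z)"
    using h' unfolding has_derivative_at_alt by (meson zero_less_one)
  obtain d2 where d2: "d2 > 0" "ball z d2 \<subseteq> W" using W open_contains_ball by blast
  obtain x0 where x0: "x0 \<in> interior (polytope_of u l)" using interior_nonempty by blast
  have x0P: "label u l j x0 \<ge> 0" for j
    using x0 interior_subset by (auto simp: polytope_of_def)
  have pP: "label u l j (\<mu> p) \<ge> 0" for j using range_moment by (auto simp: polytope_of_def)
  define xx where "xx \<epsilon> = (1 - \<epsilon>) *\<^sub>R \<mu> p + \<epsilon> *\<^sub>R x0" for \<epsilon>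
  \<comment> \<open>The lift of \<open>xx \<epsilon>\<close> to the level set: the labels prescribe
    the moduli, and the phases are those of \<open>z\<close>, so that the lift tends to
    \<open>z\<close>. Where a coordinate of \<open>z\<close> vanishes any phase serves.\<close>
  define w where "w \<epsilon> = (\<chi> j. (if z $ j = 0 then 1 else sgn (z $ j)) * of_real (sqrt (2 * label u l j (xx \<epsilon>))))" for \<epsilon>
  define C where "C = (\<Sum>j\<in>UNIV. sqrt (2 * \<bar>label u l j x0 - label u l j (\<mu> p)\<bar>))"
  have C0: "C \<ge> 0" by (simp add: C_def sum_nonneg)
  have lxx: "label u l j (xx \<epsilon>) \<ge> 0" if "0 \<le> \<epsilon>" "\<epsilon> \<le> 1" for j \<epsilon>
    using that x0P pP by (simp add: xx_def label_affine)
  have cw: "cmod (w \<epsilon> $ j) = sqrt (2 * label u l j (xx \<epsilon>))" if "0 \<le> \<epsilon>" "\<epsilon> \<le> 1" for \<epsilon> j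
    using lxx[OF that, of j] by (auto simp: w_def norm_mult norm_sgn)
  have wZ: "w \<epsilon> \<in> Z" if \<epsilon>: "0 \<le> \<epsilon>" "\<epsilon> \<le> 1" for \<epsilon>
  proof -
    have "(cmod (w \<epsilon> $ j))\<^sup>2 / 2 = label u l j (xx \<epsilon>)" for j
      using lxx[OF \<epsilon>, of j] by (simp add: cw[OF \<epsilon>])
    then show ?thesis by (auto simp: Z_def delzant_level_def)
  qed
  have lw: "label u l j (\<mu> (\<pi> (w \<epsilon>))) = label u l j (xx \<epsilon>)" if \<epsilon>: "0 \<le> \<epsilon>" "\<epsilon> \<le> 1" for \<epsilon> j
    using lab[OF wZ[OF \<epsilon>], of j] lxx[OF \<epsilon>, of j] by (simp add: cw[OF \<epsilon>])
  have sqrt_eq: "sqrt \<bar>\<epsilon> * (2 * D)\<bar> = sqrt \<epsilon> * sqrt (2 * \<bar>D\<bar>)" if "0 \<le> \<epsilon>" for \<epsilon> D :: real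
  proof -
    have "\<bar>\<epsilon> * (2 * D)\<bar> = \<epsilon> * (2 * \<bar>D\<bar>)" using that by (simp add: abs_mult)
    then show ?thesis by (simp only: real_sqrt_mult)
  qed
  have dist_w: "norm (w \<epsilon> - z) \<le> C * sqrt \<epsilon>" if \<epsilon>: "0 \<le> \<epsilon>" "\<epsilon> \<le> 1" for \<epsilon>
  proof -
    have "cmod ((w \<epsilon> - z) $ j) \<le> sqrt \<epsilon> * sqrt (2 * \<bar>label u l j x0 - label u l j (\<mu> p)\<bar>)" for j
    proof -
      define s where "s = (if z $ j = 0 then 1 else sgn (z $ j))"
      have "cmod (z $ j) = sqrt (2 * label u l j (\<mu> p))"
        using lab[OF z(1), of j] z(2) by (intro real_sqrt_unique[symmetric]) auto
      moreover have "z $ j = s * of_real (cmod (z $ j))"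
        by (simp add: s_def sgn_div_norm scaleR_conv_of_real)
      ultimately have "z $ j = s * of_real (sqrt (2 * label u l j (\<mu> p)))" by simp
      then have "(w \<epsilon> - z) $ j = s * of_real (sqrt (2 * label u l j (xx \<epsilon>)) - sqrt (2 * label u l j (\<mu> p)))"
        by (simp add: w_def s_def algebra_simps)
      moreover have "cmod s = 1" by (simp add: s_def norm_sgn)
      ultimately have "cmod ((w \<epsilon> - z) $ j) = \<bar>sqrt (2 * label u l j (xx \<epsilon>)) - sqrt (2 * label u l j (\<mu> p))\<bar>"
        by (simp only: norm_mult norm_of_real mult_1)
      also have "\<dots> \<le> sqrt \<bar>2 * label u l j (xx \<epsilon>) - 2 * label u l j (\<mu> p)\<bar>"
      proof -
        \<comment> \<open>The square root is Hoelder continuous of exponent 1/2; this is the source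
          of the rate \<open>sqrt \<epsilon>\<close>.\<close>
        have *: "\<bar>sqrt a - sqrt b\<bar> \<le> sqrt \<bar>a - b\<bar>" if "a \<ge> 0" "b \<ge> 0" for a b :: real
        proof -
          have "sqrt y \<le> sqrt x + sqrt \<bar>y - x\<bar>" if "x \<ge> 0" "y \<ge> 0" for x y :: real
          proof -
            have "sqrt y \<le> sqrt (x + \<bar>y - x\<bar>)" by simp
            also have "\<dots> \<le> sqrt x + sqrt \<bar>y - x\<bar>" using that by (intro sqrt_add_le_add_sqrt) auto
            finally show ?thesis .
          qed
          from this[of a b] this[of b a] show ?thesis using that by (simp add: abs_le_iff abs_minus_commute)
        qed
        show ?thesis using lxx[OF \<epsilon>, of j] pP[of j] by (intro *) auto
      qed
      also have "2 * label u l j (xx \<epsilon>) - 2 * label u l j (\<mu> p) = \<epsilon> * (2 * (label u l j x0 - label u l j (\<mu> p)))"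
        unfolding xx_def label_affine by (simp add: algebra_simps)
      finally show ?thesis unfolding sqrt_eq[OF \<epsilon>(1)] .
    qed
    then have "(\<Sum>j\<in>UNIV. cmod ((w \<epsilon> - z) $ j)) \<le> sqrt \<epsilon> * C"
      unfolding C_def sum_distrib_left by (intro sum_mono)
    moreover have "norm (w \<epsilon> - z) \<le> (\<Sum>j\<in>UNIV. cmod ((w \<epsilon> - z) $ j))"
      unfolding norm_vec_def by (rule L2_set_le_sum) simp
    ultimately show ?thesis by (simp add: mult.commute)
  qed
  \<comment> \<open>Near \<open>z\<close> the map \<open>h\<close> stretches distances from
    \<open>z\<close> by at most \<open>K0 + 1\<close>, and \<open>C\<close> comes from
    \<open>dist_w\<close>; the final summand makes \<open>K\<close> positive.\<close>
  define K where "K = (K0 + 1) * C + 1"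
  have K: "K > 0" using K0(1) C0 by (simp add: K_def add_nonneg_pos)
  define J where "J = {j. u j \<noteq> 0 \<and> label u l j (\<mu> p) = 0}"
  \<comment> \<open>The element 1 keeps the minimum meaningful when no label vanishes at
    \<open>p\<close>.\<close>
  define m where "m = Min (insert 1 ((\<lambda>j. label u l j x0) ` J))"
  have m: "m > 0" "\<And>j. j \<in> J \<Longrightarrow> m \<le> label u l j x0"
    using interior_polytopeD[OF x0] by (auto simp: m_def J_def intro: Min.coboundedI)
  show thesis
  \<comment> \<open>A label in \<open>J\<close> vanishes at \<open>\<mu> p\<close>, so over
    \<open>xx \<epsilon>\<close> it is at least \<open>\<epsilon> * m\<close>, while the square of
    \<open>norm e\<close> is at most \<open>K\<^sup>2 * \<epsilon>\<close>.\<close>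
  proof (rule that[of "m / K\<^sup>2"])
    show "m / K\<^sup>2 > 0" using m K by simp
    fix r :: real assume r: "r > 0"
    define a where "a = Min {1, d1 / (C + 1), d2 / (C + 1), r / (K + 1)}"
    have a: "a > 0" "a \<le> 1" "a \<le> d1 / (C + 1)" "a \<le> d2 / (C + 1)" "a \<le> r / (K + 1)"
      using d1 d2 r K C0 by (auto simp: a_def)
    define \<epsilon> where "\<epsilon> = a\<^sup>2"
    have \<epsilon>: "\<epsilon> > 0" "0 \<le> \<epsilon>" "\<epsilon> \<le> 1" "sqrt \<epsilon> = a" using a by (auto simp: \<epsilon>_def power_le_one)
    have wz: "norm (w \<epsilon> - z) \<le> C * a" using dist_w[OF \<epsilon>(2,3)] \<epsilon>(4) by simp
    have "C * a < (C + 1) * a" using a(1) by (simp add: algebra_simps)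
    moreover have "(C + 1) * a \<le> d1" "(C + 1) * a \<le> d2"
      using a(3,4) C0 by (simp_all add: pos_le_divide_eq add_nonneg_pos mult.commute)
    ultimately have wd: "norm (w \<epsilon> - z) < d1" "norm (w \<epsilon> - z) < d2" using wz by linarith+
    have "w \<epsilon> \<in> W" using d2(2) wd(2) by (auto simp: dist_norm norm_minus_commute subset_iff)
    note hw = W(4)[OF this wZ[OF \<epsilon>(2,3)]]
    have hz: "h z = chart_map c p" using W(4)[OF W(2) z(1)] z(2) by simp
    define e where "e = chart_map c (\<pi> (w \<epsilon>)) - chart_map c p"
    have "e = (h (w \<epsilon>) - h z - h' (w \<epsilon> - z)) + h' (w \<epsilon> - z)" using hw hz by (simp add: e_def)
    then have "norm e \<le> norm (h (w \<epsilon>) - h z - h' (w \<epsilon> - z)) + norm (h' (w \<epsilon> - z))"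
      using norm_triangle_ineq by metis
    also have "\<dots> \<le> 1 * norm (w \<epsilon> - z) + norm (w \<epsilon> - z) * K0" using d1(2)[OF wd(1)] K0(2) by (rule add_mono)
    also have "\<dots> = (K0 + 1) * norm (w \<epsilon> - z)" by (simp add: algebra_simps)
    also have "\<dots> \<le> (K0 + 1) * (C * a)" using wz K0(1) by (intro mult_left_mono) auto
    also have "\<dots> \<le> K * a" using a(1) by (simp add: K_def algebra_simps)
    finally have e: "norm e \<le> K * a" .
    show "\<exists>e. norm e < r \<and> (\<forall>j. u j \<noteq> 0 \<and> label u l j (\<mu> p) = 0 \<longrightarrow>
      label u l j (\<mu> (chart_inv c (chart_map c p + e))) > 0 \<and>
      label u l j (\<mu> (chart_inv c (chart_map c p + e))) \<ge> m / K\<^sup>2 * (norm e)\<^sup>2)"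
    proof (intro exI[of _ e] conjI allI impI)
      have "K * a < (K + 1) * a" using a(1) by (simp add: algebra_simps)
      moreover have "(K + 1) * a \<le> r" using a(5) K by (simp add: pos_le_divide_eq mult.commute)
      ultimately show "norm e < r" using e by linarith
      fix j assume j: "u j \<noteq> 0 \<and> label u l j (\<mu> p) = 0"
      have "chart_inv c (chart_map c p + e) = \<pi> (w \<epsilon>)" using hw c by (simp add: e_def inv_map)
      then have eq: "label u l j (\<mu> (chart_inv c (chart_map c p + e))) = \<epsilon> * label u l j x0"
        using lw[OF \<epsilon>(2,3), of j] j by (simp add: xx_def label_affine)
      have mj: "m \<le> label u l j x0" using m(2) j by (simp add: J_def)
      show "label u l j (\<mu> (chart_inv c (chart_map c p + e))) > 0" unfolding eq using \<epsilon>(1) mj m(1) by simp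
      have "(norm e)\<^sup>2 \<le> (K * a)\<^sup>2" using e by (rule power_mono) simp
      then have "m / K\<^sup>2 * (norm e)\<^sup>2 \<le> m / K\<^sup>2 * (K * a)\<^sup>2" using m(1) K by (intro mult_left_mono) auto
      also have "\<dots> = \<epsilon> * m" using K by (simp add: \<epsilon>_def power_mult_distrib)
      also have "\<dots> \<le> \<epsilon> * label u l j x0" using mj \<epsilon>(1) by simp
      finally show "label u l j (\<mu> (chart_inv c (chart_map c p + e))) \<ge> m / K\<^sup>2 * (norm e)\<^sup>2" unfolding eq .
    qed
  qed
qed

text \<open>The vanishing labels share one displacement from \<open>quadratic_growth\<close>, and
  each excludes only finitely many multiples of it, so an arbitrarily small multiple serves them
  all. Labels positive at \<open>p\<close> stay positive by continuity.\<close>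

lemma rays_to_interior:
  assumes c: "c \<in> \<A>" and p: "p \<in> chart_dom c" and \<eta>: "\<eta> > 0"
  shows "\<exists>e. norm e < \<eta> \<and>
    eventually (\<lambda>h. chart_inv c (chart_map c p + h *\<^sub>R (v + e)) \<in> \<mu> -` interior (polytope_of u l)) (at_right 0)"
proof -
  define f where "f j x = label u l j (\<mu> (chart_inv c x))" for j x
  define M where "M = \<mu> \<circ> chart_inv c"
  define D where "D j y v = u j \<bullet> frechet_derivative M (at y) v" for j y v
  have f: "f j = (\<lambda>x. u j \<bullet> M x + l j)" for j by (auto simp: f_def M_def label_def)
  have smooth: "smooth_on (chart_image c) M" unfolding M_def by (rule moment_smooth[OF c])
  have M': "(M has_derivative frechet_derivative M (at y)) (at y)" if "y \<in> chart_image c" for y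
    using smooth_on_differentiable[OF smooth that] by (simp add: frechet_derivative_works)
  have der: "(f j has_derivative D j y) (at y)" if "y \<in> chart_image c" for j y
    unfolding f D_def using M'[OF that] by (auto intro!: derivative_eq_intros)
  have xp: "chart_map c p \<in> chart_image c" using p by simp
  have der2: "(\<lambda>y. D j y b) differentiable (at (chart_map c p))" for j b
    using smooth_on_differentiable[OF smooth_on_frechet[OF smooth, of b] xp]
    unfolding D_def by (intro differentiable_inner differentiable_const)
  have nonneg: "f j y \<ge> 0" for j y using range_moment by (auto simp: f_def polytope_of_def)
  obtain \<kappa> where \<kappa>: "\<kappa> > 0"
    "\<And>r. r > 0 \<Longrightarrow> \<exists>e. norm e < r \<and> (\<forall>j. u j \<noteq> 0 \<and> label u l j (\<mu> p) = 0 \<longrightarrow>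
      f j (chart_map c p + e) > 0 \<and> f j (chart_map c p + e) \<ge> \<kappa> * (norm e)\<^sup>2)"
    using quadratic_growth[OF c p] unfolding f_def by metis
  define J where "J = {j. u j \<noteq> 0 \<and> label u l j (\<mu> p) = 0}"
  have fp: "f j (chart_map c p) = label u l j (\<mu> p)" for j using c p by (simp add: f_def inv_map)
  have "\<forall>j\<in>J. \<exists>r>0. \<forall>e v. norm e < r \<longrightarrow> f j (chart_map c p + e) > 0 \<longrightarrow>
      f j (chart_map c p + e) \<ge> \<kappa> * (norm e)\<^sup>2 \<longrightarrow>
      finite {\<delta>. \<not> eventually (\<lambda>h. f j (chart_map c p + h *\<^sub>R (v + \<delta> *\<^sub>R e)) > 0) (at_right 0)}"
  proof
    fix j assume "j \<in> J"
    then have zero: "f j (chart_map c p) = 0" by (simp add: fp J_def)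
    show "\<exists>r>0. \<forall>e v. norm e < r \<longrightarrow> f j (chart_map c p + e) > 0 \<longrightarrow>
      f j (chart_map c p + e) \<ge> \<kappa> * (norm e)\<^sup>2 \<longrightarrow>
      finite {\<delta>. \<not> eventually (\<lambda>h. f j (chart_map c p + h *\<^sub>R (v + \<delta> *\<^sub>R e)) > 0) (at_right 0)}"
    proof (rule nonneg_directions[OF open_image[OF c] xp der der2 nonneg zero \<kappa>(1)])
      fix r assume "r > 0" and "\<And>e v. norm e < r \<Longrightarrow> f j (chart_map c p + e) > 0 \<Longrightarrow>
        f j (chart_map c p + e) \<ge> \<kappa> * (norm e)\<^sup>2 \<Longrightarrow>
        finite {\<delta>. \<not> eventually (\<lambda>h. f j (chart_map c p + h *\<^sub>R (v + \<delta> *\<^sub>R e)) > 0) (at_right 0)}"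
      then show ?thesis by (intro exI[of _ r] conjI allI impI)
    qed
  qed
  then obtain r where r: "\<And>j. j \<in> J \<Longrightarrow> r j > 0"
    "\<And>j e v. j \<in> J \<Longrightarrow> norm e < r j \<Longrightarrow> f j (chart_map c p + e) > 0 \<Longrightarrow>
      f j (chart_map c p + e) \<ge> \<kappa> * (norm e)\<^sup>2 \<Longrightarrow>
      finite {\<delta>. \<not> eventually (\<lambda>h. f j (chart_map c p + h *\<^sub>R (v + \<delta> *\<^sub>R e)) > 0) (at_right 0)}"
    by metis
  define r0 where "r0 = Min (insert 1 (r ` J))"
  have r0: "r0 > 0" using r(1) by (auto simp: r0_def)
  have r0j: "r0 \<le> r j" if "j \<in> J" for j unfolding r0_def using that by (intro Min.coboundedI) auto
  obtain e where e: "norm e < r0" "\<And>j. j \<in> J \<Longrightarrow> f j (chart_map c p + e) > 0 \<and> f j (chart_map c p + e) \<ge> \<kappa> * (norm e)\<^sup>2"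
    using \<kappa>(2)[OF r0] unfolding J_def by blast
  define N where "N = (\<Union>j\<in>J. {\<delta>. \<not> eventually (\<lambda>h. f j (chart_map c p + h *\<^sub>R (v + \<delta> *\<^sub>R e)) > 0) (at_right 0)})"
  have "finite N" unfolding N_def
  proof (rule finite_UN_I)
    fix j assume j: "j \<in> J"
    show "finite {\<delta>. \<not> eventually (\<lambda>h. f j (chart_map c p + h *\<^sub>R (v + \<delta> *\<^sub>R e)) > 0) (at_right 0)}"
      using e(1) r0j[OF j] e(2)[OF j] by (intro r(2)[OF j]) auto
  qed simp
  moreover have "infinite {0<..<\<eta> / (norm e + 1)}"
    using \<eta> by (simp add: infinite_Ioo_iff add_nonneg_pos)
  ultimately obtain \<delta> where \<delta>: "\<delta> \<in> {0<..<\<eta> / (norm e + 1)}" "\<delta> \<notin> N"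
    by (metis finite_subset subsetI)
  have small: "norm (\<delta> *\<^sub>R e) < \<eta>"
  proof -
    have "\<delta> * (norm e + 1) < \<eta>" using \<delta>(1) by (simp add: pos_less_divide_eq add_nonneg_pos)
    then show ?thesis using \<delta>(1) by (simp add: algebra_simps)
  qed
  define w where "w = v + \<delta> *\<^sub>R e"
  have lim: "((\<lambda>h. chart_map c p + h *\<^sub>R w) \<longlongrightarrow> chart_map c p + 0 *\<^sub>R w) (at_right 0)"
    by (intro tendsto_intros)
  have pos: "eventually (\<lambda>h. f j (chart_map c p + h *\<^sub>R w) > 0) (at_right 0)" if j: "u j \<noteq> 0" for j
  proof (cases "j \<in> J")
    case True
    then show ?thesis using \<delta>(2) by (auto simp: N_def w_def)
  next
    case False
    then have fpos: "f j (chart_map c p) > 0"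
      using nonneg[of j "chart_map c p"] j by (simp add: fp J_def less_le)
    have "isCont (f j) (chart_map c p)" using der[OF xp] by (rule has_derivative_continuous)
    then have "((\<lambda>h. f j (chart_map c p + h *\<^sub>R w)) \<longlongrightarrow> f j (chart_map c p)) (at_right 0)"
      using lim by (intro isCont_tendsto_compose[of _ "f j"]) auto
    then show ?thesis using fpos by (rule order_tendstoD)
  qed
  then have "eventually (\<lambda>h. \<forall>j. u j \<noteq> 0 \<longrightarrow> f j (chart_map c p + h *\<^sub>R w) > 0) (at_right 0)"
    by (intro eventually_all_finite) (auto intro: eventually_mono)
  then have "eventually (\<lambda>h. chart_inv c (chart_map c p + h *\<^sub>R w) \<in> \<mu> -` interior (polytope_of u l)) (at_right 0)"
  proof eventually_elim
    case (elim h)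
    have "\<mu> (chart_inv c (chart_map c p + h *\<^sub>R w)) \<in> polytope_of u l" using range_moment by blast
    then show ?case using elim by (auto intro!: interior_polytopeI simp: f_def)
  qed
  then show ?thesis using small unfolding w_def by blast
qed

end

section \<open>Deformed metrics\<close>

lemma matrix_inv_vector:
  fixes B :: "real ^ 'n ^ 'n"
  assumes "\<And>w. w \<noteq> 0 \<Longrightarrow> w \<bullet> (B *v w) > 0"
  shows "B *v (matrix_inv B *v x) = x" "matrix_inv B *v (B *v x) = x"
proof -
  have "\<forall>x. B *v x = 0 \<longrightarrow> x = 0" using assms by (metis inner_zero_right less_irrefl)
  then have "invertible B" by (simp add: invertible_left_inverse matrix_left_invertible_ker)
  then have "B ** matrix_inv B = mat 1 \<and> matrix_inv B ** B = mat 1"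
    unfolding invertible_def matrix_inv_def by (rule someI_ex)
  then show "B *v (matrix_inv B *v x) = x" "matrix_inv B *v (B *v x) = x"
    by (auto simp: matrix_vector_mul_assoc)
qed

lemma inner_matrix_transpose:
  fixes B :: "real ^ 'n ^ 'n" shows "x \<bullet> (B *v y) = (transpose B *v x) \<bullet> y"
  by (simp add: transpose_matrix_vector dot_lmul_matrix)

lemma sym_part_inner: "a \<bullet> (sym_part B *v a) = a \<bullet> (B *v a)"
proof -
  have "a \<bullet> (transpose B *v a) = a \<bullet> (B *v a)"
    using inner_matrix_transpose[of a "transpose B" a] by (simp add: inner_commute)
  then show ?thesis
    by (simp add: sym_part_def matrix_vector_mult_add_rdistrib inner_add_right flip: scaleR_matrix_vector_assoc)
qed

text \<open>With \<open>y = (G + A)\<^sup>-\<^sup>1 a\<close> one has \<open>a \<bullet> y = y \<bullet> G y\<close> and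
  \<open>a \<bullet> G\<^sup>-\<^sup>1 a = y \<bullet> G y + A y \<bullet> G\<^sup>-\<^sup>1 (A y)\<close>.\<close>
lemma deformed_inverse_bounds:
  fixes G A :: "real ^ 'n ^ 'n"
  assumes sym: "transpose G = G" and pos: "\<And>w. w \<noteq> 0 \<Longrightarrow> w \<bullet> (G *v w) > 0"
    and skew: "transpose A = - A"
  shows "0 \<le> a \<bullet> (sym_part (matrix_inv (G + A)) *v a)"
    and "a \<bullet> (sym_part (matrix_inv (G + A)) *v a) \<le> a \<bullet> (matrix_inv G *v a)"
proof -
  have nonneg: "w \<bullet> (G *v w) \<ge> 0" for w using pos[of w] by (cases "w = 0") auto
  have neg: "(- A) *v w = - (A *v w)" for w
    by (simp add: vec_eq_iff matrix_vector_mult_def sum_negf)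
  have Aw: "w \<bullet> (A *v w) = 0" for w
    using inner_matrix_transpose[of w A w] by (simp add: skew neg inner_commute)
  have "w \<bullet> ((G + A) *v w) > 0" if "w \<noteq> 0" for w
    using pos[OF that] Aw by (simp add: matrix_vector_mult_add_rdistrib inner_add_right)
  note inv\<Psi> = matrix_inv_vector[OF this]
  define y where "y = matrix_inv (G + A) *v a"
  have a: "a = G *v y + A *v y" using inv\<Psi>(1)[of a] by (simp add: y_def matrix_vector_mult_add_rdistrib)
  have 1: "a \<bullet> y = y \<bullet> (G *v y)" using Aw[of y] by (simp add: a inner_commute[of _ y] inner_add_right)
  define z where "z = matrix_inv G *v (A *v y)"
  have Gz: "G *v z = A *v y" unfolding z_def by (rule matrix_inv_vector(1)[OF pos])
  have "matrix_inv G *v a = matrix_inv G *v (G *v y) + z"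
    by (simp add: a z_def matrix_vector_right_distrib)
  then have inva: "matrix_inv G *v a = y + z" by (simp add: matrix_inv_vector(2)[OF pos])
  have "(G *v y) \<bullet> z = y \<bullet> (G *v z)" using inner_matrix_transpose[of y G z] sym by simp
  then have "(G *v y) \<bullet> z = 0" using Aw[of y] by (simp add: Gz)
  moreover have "(A *v y) \<bullet> z = z \<bullet> (G *v z)" by (simp add: Gz inner_commute)
  moreover have "a \<bullet> (matrix_inv G *v a) = (G *v y) \<bullet> y + (A *v y) \<bullet> y + (G *v y) \<bullet> z + (A *v y) \<bullet> z"
    unfolding inva by (subst a) (simp add: inner_add_left inner_add_right)
  ultimately have 2: "a \<bullet> (matrix_inv G *v a) = y \<bullet> (G *v y) + z \<bullet> (G *v z)"
    using Aw[of y] by (simp add: inner_commute)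
  have s: "a \<bullet> (sym_part (matrix_inv (G + A)) *v a) = y \<bullet> (G *v y)"
    using 1 by (simp add: sym_part_inner y_def)
  show "0 \<le> a \<bullet> (sym_part (matrix_inv (G + A)) *v a)" unfolding s by (rule nonneg)
  show "a \<bullet> (sym_part (matrix_inv (G + A)) *v a) \<le> a \<bullet> (matrix_inv G *v a)" unfolding s 2 using nonneg by simp
qed

lemma metric_from_matrices_inner:
  fixes G E :: "real ^ 'n ^ 'n"
  assumes "metric_from_matrices g G E"
  shows "g v w = snd v \<bullet> (G *v snd w) + fst v \<bullet> (E *v fst w)"
proof -
  have "x \<bullet> (B *v y) = (\<Sum>i\<in>UNIV. \<Sum>j\<in>UNIV. B $ i $ j * x $ i * y $ j)" for B :: "real ^ 'n ^ 'n" and x y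
    by (simp add: inner_vec_def matrix_vector_mult_def sum_distrib_left algebra_simps)
  moreover have "g v w = (\<Sum>i\<in>UNIV. \<Sum>j\<in>UNIV.
      G $ i $ j * snd v $ i * snd w $ j + E $ i $ j * fst v $ i * fst w $ j)"
    using assms unfolding metric_from_matrices_def by blast
  ultimately show ?thesis by (simp add: sum.distrib)
qed

lemma slope_bound_mono:
  assumes "slope_bound g \<rho> c p" and le: "\<And>v. g c p v v \<le> g' c p v v"
  shows "slope_bound g' \<rho> c p"
  unfolding slope_bound_def
proof (intro allI impI)
  fix v and \<epsilon> :: real assume "\<epsilon> > 0"
  then obtain \<delta> where \<delta>: "\<delta> > 0" "\<And>h x. 0 < h \<Longrightarrow> h < \<delta> \<Longrightarrow> norm (x - (chart_map c p + h *\<^sub>R v)) \<le> \<delta> * h \<Longrightarrow>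
      \<rho> (chart_inv c x) \<le> \<rho> p + h * (sqrt (g c p v v) + \<epsilon>)"
    using slope_boundE[OF assms(1), of \<epsilon> v] by metis
  have "h * (sqrt (g c p v v) + \<epsilon>) \<le> h * (sqrt (g' c p v v) + \<epsilon>)" if "0 < h" for h
    using le[of v] that by (intro mult_left_mono) auto
  then show "\<exists>\<delta>>0. \<forall>h x. 0 < h \<and> h < \<delta> \<and> norm (x - (chart_map c p + h *\<^sub>R v)) \<le> \<delta> * h \<longrightarrow>
      \<rho> (chart_inv c x) \<le> \<rho> p + h * (sqrt (g' c p v v) + \<epsilon>)"
    using \<delta> by (intro exI[of _ \<delta>]) (meson order_trans add_left_mono)
qed

text \<open>Rotating the point \<open>x + h (a, b)\<close> by \<open>- h a\<close> removes the angular part of the displacement.\<close>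
lemma (in torus_action) slope_bound_rotate:
  fixes a :: "'e \<Rightarrow> real ^ 'n"
  assumes c: "c \<in> \<A>" "p \<in> chart_dom c" and slope: "slope_bound g \<rho> c p"
    and inv: "\<And>s q. \<rho> (act s q) = \<rho> q"
    and le: "\<And>v. g c p (v - fund_field act (a v) c p) (v - fund_field act (a v) c p) \<le> g' c p v v"
  shows "slope_bound g' \<rho> c p"
  unfolding slope_bound_def
proof (intro allI impI)
  fix v and \<epsilon> :: real assume \<epsilon>: "\<epsilon> > 0"
  define w where "w = v - fund_field act (a v) c p"
  let ?\<Theta> = "\<lambda>(s, x). chart_map c (act s (chart_inv c x))"
  obtain \<delta>1 where \<delta>1: "\<delta>1 > 0" "\<And>h x. 0 < h \<Longrightarrow> h < \<delta>1 \<Longrightarrow> norm (x - (chart_map c p + h *\<^sub>R w)) \<le> \<delta>1 * h \<Longrightarrow>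
      \<rho> (chart_inv c x) \<le> \<rho> p + h * (sqrt (g c p w w) + \<epsilon>)"
    using slope_boundE[OF slope \<epsilon>, of w] by metis
  obtain \<delta>2 where \<delta>2: "\<delta>2 > 0" "\<And>h y. 0 < h \<Longrightarrow> h < \<delta>2 \<Longrightarrow>
      norm (y - ((0, chart_map c p) + h *\<^sub>R (- a v, v))) \<le> \<delta>2 * h \<Longrightarrow>
      norm (?\<Theta> y - (?\<Theta> (0, chart_map c p) + h *\<^sub>R (\<lambda>(\<xi>, w). fund_field act \<xi> c p + w) (- a v, v))) \<le> \<delta>1 * h"
    using has_derivative_cone[OF action_derivative(1)[OF c] \<delta>1(1), of "(- a v, v)"] by metis
  \<comment> \<open>Rotating while moving along \<open>v\<close> is motion of the pair (torus
    element, chart point) in direction \<open>(- a v, v)\<close>; the derivative of the action sends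
    it to \<open>w\<close>.\<close>
  have dir: "(\<lambda>(\<xi>, w). fund_field act \<xi> c p + w) (- a v, v) = w"
    using linear_neg[OF action_derivative(3)[OF c], of "a v"] by (simp add: w_def)
  have base: "?\<Theta> (0, chart_map c p) = chart_map c p" using c by (simp add: inv_map)
  define X where "X = (UNIV \<times> chart_image c) \<inter> (\<lambda>y. act (fst y) (chart_inv c (snd y))) -` chart_dom c"
  have "continuous_on (UNIV \<times> chart_image c) (\<lambda>y. (fst y, chart_inv c (snd y)))"
    by (intro continuous_intros continuous_on_compose2[OF continuous_inv[OF c(1)]]) auto
  from continuous_on_compose2[OF continuous_action this]
  have "continuous_on (UNIV \<times> chart_image c) (\<lambda>y. act (fst y) (chart_inv c (snd y)))" by simp
  then have "open X" unfolding X_def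
    using open_image[OF c(1)] open_dom[OF c(1)] by (intro continuous_open_preimage open_Times) auto
  moreover have "(0, chart_map c p) \<in> X" using c by (simp add: X_def inv_map)
  ultimately obtain r where r: "r > 0" "ball (0, chart_map c p) r \<subseteq> X" using open_contains_ball by blast
  define \<delta> where "\<delta> = Min {\<delta>1, \<delta>2, 1, r / (norm (- a v, v) + 1)}"
  have \<delta>: "\<delta> > 0" "\<delta> \<le> \<delta>1" "\<delta> \<le> \<delta>2" "\<delta> \<le> 1" "\<delta> \<le> r / (norm (- a v, v) + 1)"
    using \<delta>1 \<delta>2 r by (auto simp: \<delta>_def add_nonneg_pos)
  have \<delta>r: "\<delta> * (norm (- a v, v) + 1) \<le> r"
    by (rule iffD1[OF pos_le_divide_eq, OF _ \<delta>(5)]) (simp add: add_nonneg_pos)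
  show "\<exists>\<delta>>0. \<forall>h x. 0 < h \<and> h < \<delta> \<and> norm (x - (chart_map c p + h *\<^sub>R v)) \<le> \<delta> * h \<longrightarrow>
      \<rho> (chart_inv c x) \<le> \<rho> p + h * (sqrt (g' c p v v) + \<epsilon>)"
  proof (intro exI conjI allI impI)
    show "\<delta> > 0" by fact
    fix h x assume "0 < h \<and> h < \<delta> \<and> norm (x - (chart_map c p + h *\<^sub>R v)) \<le> \<delta> * h"
    then have h: "0 < h" "h < \<delta>" "norm (x - (chart_map c p + h *\<^sub>R v)) \<le> \<delta> * h" by auto
    define y where "y = (- (h *\<^sub>R a v), x)"
    have "y - ((0, chart_map c p) + h *\<^sub>R (- a v, v)) = (0, x - (chart_map c p + h *\<^sub>R v))"
      by (simp add: y_def)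
    then have yn: "norm (y - ((0, chart_map c p) + h *\<^sub>R (- a v, v))) \<le> \<delta> * h"
      using h(3) by (simp add: norm_Pair)
    have "norm (y - (0, chart_map c p)) < r" by (rule cone_near(2)[OF h(1,2) \<delta>(4) yn \<delta>r])
    then have "y \<in> X" using r(2) by (auto simp: dist_norm norm_minus_commute)
    then have dom: "act (- (h *\<^sub>R a v)) (chart_inv c x) \<in> chart_dom c" by (simp add: X_def y_def)
    have "norm (y - ((0, chart_map c p) + h *\<^sub>R (- a v, v))) \<le> \<delta>2 * h"
      using yn mult_right_mono[OF \<delta>(3), of h] h(1) by linarith
    then have "norm (?\<Theta> y - (chart_map c p + h *\<^sub>R w)) \<le> \<delta>1 * h"
      using \<delta>2(2)[OF h(1), of y] h(2) \<delta>(3) unfolding dir base by linarith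
    then have "\<rho> (chart_inv c (?\<Theta> y)) \<le> \<rho> p + h * (sqrt (g c p w w) + \<epsilon>)"
      using h \<delta>(2) by (intro \<delta>1(2)) auto
    also have "chart_inv c (?\<Theta> y) = act (- (h *\<^sub>R a v)) (chart_inv c x)"
      using dom c(1) by (simp add: y_def inv_map)
    finally have "\<rho> (chart_inv c x) \<le> \<rho> p + h * (sqrt (g c p w w) + \<epsilon>)" by (simp add: inv)
    also have "\<dots> \<le> \<rho> p + h * (sqrt (g' c p v v) + \<epsilon>)"
      using le[of v] h(1) by (intro add_left_mono mult_left_mono) (auto simp: w_def)
    finally show "\<rho> (chart_inv c x) \<le> \<rho> p + h * (sqrt (g' c p v v) + \<epsilon>)" .
  qed
qed

section \<open>Completeness of deformed metrics\<close>

locale toric_deformation = delzant \<A> act F \<mu> u l + G: connected_riemannian \<A> g + K: connected_riemannian \<A> gK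
  for \<A> :: "('a::t2_space, (real ^ 'n) \<times> (real ^ 'n)) chart set"
    and act :: "real ^ 'n \<Rightarrow> 'a \<Rightarrow> 'a" and F \<mu> and u :: "'d::finite \<Rightarrow> real ^ 'n" and l and g gK +
  fixes I J JK :: "('a, (real ^ 'n) \<times> (real ^ 'n)) endo" and A :: "real ^ 'n ^ 'n"
  assumes invariant: "\<And>s. preserves_bilin \<A> (act s) gK"
    and skew: "transpose A = - A"
    and deformation: "A_deformation \<A> F act \<mu> (interior (polytope_of u l)) A gK JK g I J"
begin

abbreviation open_orbits :: "'a set" where
  "open_orbits \<equiv> \<mu> -` interior (polytope_of u l)"

text \<open>In momentum-angle coordinates \<open>fst v\<close> is the angular part of
  \<open>v\<close>, and the field of \<open>\<xi>\<close> is \<open>(\<xi>, 0)\<close>. Once the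
  angular part is removed, \<open>gK\<close> reduces to the form \<open>G\<close> that it shares
  with \<open>g\<close>, and the angular form of \<open>g\<close> can only add to it.\<close>

lemma chart_metrics:
  assumes p: "p \<in> open_orbits"
  obtains c where "c \<in> \<A>" "p \<in> chart_dom c" "\<And>v. g c p v v \<le> gK c p v v"
    "\<And>v. gK c p (v - fund_field act (fst v) c p) (v - fund_field act (fst v) c p) \<le> g c p v v"
proof -
  obtain h where h: "\<And>x w. x \<in> interior (polytope_of u l) \<Longrightarrow> w \<noteq> 0 \<Longrightarrow> w \<bullet> (hess_matrix h x *v w) > 0"
    "\<forall>p\<in>open_orbits. \<exists>c\<in>\<A>. p \<in> chart_dom c \<and> chart_dom c \<subseteq> open_orbits \<and>
           momentum_angle_chart c F act \<mu> \<and>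
           (\<forall>q\<in>chart_dom c.
              let G = hess_matrix h (\<mu> q); \<Psi> = G + A in
                endo_from_matrix (JK c q) G \<and>
                metric_from_matrices (gK c q) G (matrix_inv G) \<and>
                endo_from_matrix (J c q) \<Psi> \<and>
                endo_from_matrix (I c q) (transpose \<Psi>) \<and>
                metric_from_matrices (g c q) G (sym_part (matrix_inv \<Psi>)))"
    using deformation unfolding A_deformation_def by blast
  then obtain c where c: "c \<in> \<A>" "p \<in> chart_dom c" "momentum_angle_chart c F act \<mu>"
    "metric_from_matrices (gK c p) (hess_matrix h (\<mu> p)) (matrix_inv (hess_matrix h (\<mu> p)))"
    "metric_from_matrices (g c p) (hess_matrix h (\<mu> p)) (sym_part (matrix_inv (hess_matrix h (\<mu> p) + A)))"
    using p unfolding Let_def by blast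
  define H where "H = hess_matrix h (\<mu> p)"
  have pos: "w \<bullet> (H *v w) > 0" if "w \<noteq> 0" for w using h(1)[of "\<mu> p" w] p that by (simp add: H_def)
  note gK = metric_from_matrices_inner[OF c(4), folded H_def]
  note gg = metric_from_matrices_inner[OF c(5), folded H_def]
  have symK: "gK c p v w = gK c p w v" for v w
    using K.metric c(1,2) unfolding riemannian_metric_def by blast
  \<comment> \<open>Commutation of the iterated derivatives in \<open>hess_matrix\<close> is read
    off from the symmetry of \<open>gK\<close> in the momentum directions.\<close>
  have "x \<bullet> (H *v y) = y \<bullet> (H *v x)" for x y
    using symK[of "(0, x)" "(0, y)"] by (simp add: gK)
  then have "(transpose H *v x) \<bullet> y = (H *v x) \<bullet> y" for x y
    by (metis inner_matrix_transpose inner_commute)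
  then have "transpose H *v x = H *v x" for x by (metis vector_eq_rdot)
  then have sym: "transpose H = H" by (simp add: matrix_eq)
  note bounds = deformed_inverse_bounds[OF sym pos skew]
  have lin: "linear (\<lambda>\<xi>. fund_field act \<xi> c p)" by (rule action_derivative(3)[OF c(1,2)])
  have fund: "fund_field act \<xi> c p = (\<xi>, 0)" for \<xi>
  proof -
    have "fund_field act \<xi> c p = fund_field act (\<Sum>i\<in>UNIV. (\<xi> $ i) *\<^sub>R axis i 1) c p"
      using basis_expansion[of \<xi>] by (simp add: scalar_mult_eq_scaleR)
    also have "\<dots> = (\<Sum>i\<in>UNIV. (\<xi> $ i) *\<^sub>R fund_field act (axis i 1) c p)"
      by (simp add: linear_sum[OF lin] linear_scale[OF lin])
    also have "\<dots> = (\<Sum>i\<in>UNIV. (\<xi> $ i) *\<^sub>R (axis i 1, 0))"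
      using c(2,3) by (simp add: momentum_angle_chart_def dt_def)
    also have "\<dots> = (\<xi>, 0)"
      using basis_expansion[of \<xi>] by (simp add: prod_eq_iff fst_sum snd_sum scalar_mult_eq_scaleR)
    finally show ?thesis .
  qed
  show thesis
  proof (rule that[OF c(1,2)])
    fix v
    show "g c p v v \<le> gK c p v v" using bounds(2)[of "fst v"] by (simp add: gK gg)
    show "gK c p (v - fund_field act (fst v) c p) (v - fund_field act (fst v) c p) \<le> g c p v v"
      using bounds(1)[of "fst v"] by (simp add: gK gg fund)
  qed
qed

text \<open>The test function is the \<open>g\<close>-distance from \<open>x\<close>: its
  \<open>gK\<close>-slope is at most 1 over the open orbits because \<open>g\<close> is smaller
  there, and \<open>slope_bound_extend\<close> carries this to the remaining points.\<close>

lemma rdist_le: "G.rdist x y \<le> K.rdist x y"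
proof -
  let ?\<rho> = "\<lambda>q. G.rdist x q"
  have \<rho>: "?\<rho> z \<le> ?\<rho> y + max (G.rdist y z) (G.rdist z y)" for y z
    using G.rdist_triangle[of x z y] by linarith
  have "?\<rho> y \<le> ?\<rho> x + K.rdist x y"
  proof (rule K.slope_bound_imp_le_rdist[OF G.lipschitz_continuous[OF \<rho>]])
    fix p
    obtain c where c: "c \<in> \<A>" "p \<in> chart_dom c" using chart_at by blast
    obtain r L where r: "r > 0" "L \<ge> 0" "\<And>x y. x \<in> ball (chart_map c p) r \<Longrightarrow> y \<in> ball (chart_map c p) r \<Longrightarrow>
      G.rdist (chart_inv c x) (chart_inv c y) \<le> L * norm (y - x)"
      using G.rdist_lipschitz[OF c] by metis
    have "slope_bound gK ?\<rho> c p"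
    proof (rule K.slope_bound_extend[OF c G.lipschitz_continuous[OF \<rho>] r(1,2)])
      fix y z assume "y \<in> ball (chart_map c p) r" "z \<in> ball (chart_map c p) r"
      then show "?\<rho> (chart_inv c z) \<le> ?\<rho> (chart_inv c y) + L * norm (z - y)"
        using r(3)[of y z] G.rdist_triangle[of x "chart_inv c z" "chart_inv c y"] by linarith
    next
      fix q assume "q \<in> open_orbits"
      then obtain c' where c': "c' \<in> \<A>" "q \<in> chart_dom c'" "\<And>v. g c' q v v \<le> gK c' q v v"
        using chart_metrics by metis
      then show "\<exists>c\<in>\<A>. q \<in> chart_dom c \<and> slope_bound gK ?\<rho> c q"
        using slope_bound_mono[OF G.lipschitz_slope_bound[OF \<rho> c'(1,2)]] by blast
    qed (rule rays_to_interior[OF c])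
    then show "\<exists>c\<in>\<A>. p \<in> chart_dom c \<and> slope_bound gK ?\<rho> c p" using c by blast
  qed
  then show ?thesis by (simp add: G.rdist_self)
qed

lemma rdist_act_le: "K.rdist (act s p) (act s q) \<le> K.rdist p q"
  by (rule K.rdist_isometry_le[OF invariant continuous_act act_differentiable])

text \<open>The test function is the \<open>gK\<close>-distance from \<open>x\<close> to a torus
  orbit. It is invariant, so \<open>slope_bound_rotate\<close> allows the angular part of a vector
  to be dropped, and what remains is no longer for \<open>gK\<close> than the vector is for
  \<open>g\<close>. The strict inequality avoids the question whether the infimum is
  attained.\<close>

lemma orbit_rdist_less:
  assumes less: "G.rdist x y < d"
  shows "\<exists>s. K.rdist x (act s y) < d"
proof -
  define \<rho> where "\<rho> q = (INF s. K.rdist x (act s q))" for q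
  have bdd: "bdd_below (range (\<lambda>s. K.rdist x (act s q)))" for q
    by (rule bdd_belowI2[of _ 0]) (rule K.rdist_nonneg)
  have low: "\<rho> q \<le> K.rdist x (act s q)" for s q
    unfolding \<rho>_def by (rule cINF_lower[OF bdd UNIV_I])
  have lip1: "\<rho> z \<le> \<rho> y + K.rdist y z" for y z
  proof -
    have "\<rho> z - K.rdist y z \<le> \<rho> y"
      unfolding \<rho>_def[of y]
    proof (rule cINF_greatest)
      fix s
      have "\<rho> z \<le> K.rdist x (act s z)" by (rule low)
      also have "\<dots> \<le> K.rdist x (act s y) + K.rdist (act s y) (act s z)" by (rule K.rdist_triangle)
      finally show "\<rho> z - K.rdist y z \<le> K.rdist x (act s y)" using rdist_act_le[of s y z] by linarith
    qed simp
    then show ?thesis by simp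
  qed
  have lip: "\<rho> z \<le> \<rho> y + max (K.rdist y z) (K.rdist z y)" for y z using lip1[of z y] by linarith
  have inv: "\<rho> (act s q) = \<rho> q" for s q
  proof -
    have le: "\<rho> (act s q) \<le> \<rho> q" for s q
      unfolding \<rho>_def[of q]
    proof (rule cINF_greatest)
      fix t show "\<rho> (act s q) \<le> K.rdist x (act t q)"
        using low[of "act s q" "t - s"] by (simp flip: act_add)
    qed simp
    from le[of s q] le[of "- s" "act s q"] show ?thesis by simp
  qed
  have "\<rho> y \<le> \<rho> x + G.rdist x y"
  proof (rule G.slope_bound_imp_le_rdist[OF K.lipschitz_continuous[OF lip]])
    fix p
    obtain c where c: "c \<in> \<A>" "p \<in> chart_dom c" using chart_at by blast
    obtain r L where r: "r > 0" "L \<ge> 0" "\<And>x y. x \<in> ball (chart_map c p) r \<Longrightarrow> y \<in> ball (chart_map c p) r \<Longrightarrow>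
      K.rdist (chart_inv c x) (chart_inv c y) \<le> L * norm (y - x)"
      using K.rdist_lipschitz[OF c] by metis
    have "slope_bound g \<rho> c p"
    proof (rule G.slope_bound_extend[OF c K.lipschitz_continuous[OF lip] r(1,2)])
      fix y z assume "y \<in> ball (chart_map c p) r" "z \<in> ball (chart_map c p) r"
      then show "\<rho> (chart_inv c z) \<le> \<rho> (chart_inv c y) + L * norm (z - y)"
        using r(3)[of y z] lip1[of "chart_inv c z" "chart_inv c y"] by linarith
    next
      fix q assume "q \<in> open_orbits"
      then obtain c' where c': "c' \<in> \<A>" "q \<in> chart_dom c'"
        "\<And>v. gK c' q (v - fund_field act (fst v) c' q) (v - fund_field act (fst v) c' q) \<le> g c' q v v"
        using chart_metrics by metis
      then have "slope_bound g \<rho> c' q"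
        by (intro slope_bound_rotate[OF c'(1,2) K.lipschitz_slope_bound[OF lip c'(1,2)] inv, where a = fst]) auto
      then show "\<exists>c\<in>\<A>. q \<in> chart_dom c \<and> slope_bound g \<rho> c q" using c' by blast
    qed (rule rays_to_interior[OF c])
    then show "\<exists>c\<in>\<A>. p \<in> chart_dom c \<and> slope_bound g \<rho> c p" using c by blast
  qed
  moreover have "\<rho> x \<le> 0" using low[of x 0] by (simp add: K.rdist_self)
  ultimately have "\<rho> y < d" using less by linarith
  then show ?thesis unfolding \<rho>_def using cINF_less_iff[OF UNIV_not_empty bdd] by blast
qed

text \<open>By \<open>rdist_le\<close> a Cauchy sequence for \<open>gK\<close> is one for
  \<open>g\<close>. Its limit transfers back because both distances induce the manifold
  topology.\<close>

lemma complete_imp_complete_K: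
  assumes g: "complete_metric \<A> g"
  shows "complete_metric \<A> gK"
  unfolding complete_metric_def
proof (intro allI impI)
  fix \<sigma> :: "nat \<Rightarrow> 'a"
  assume "\<forall>\<epsilon>>0. \<exists>N. \<forall>m\<ge>N. \<forall>n\<ge>N. K.rdist (\<sigma> m) (\<sigma> n) < \<epsilon>"
  then have "\<forall>\<epsilon>>0. \<exists>N. \<forall>m\<ge>N. \<forall>n\<ge>N. G.rdist (\<sigma> m) (\<sigma> n) < \<epsilon>"
    using rdist_le by (meson le_less_trans)
  then obtain p where "(\<lambda>n. G.rdist (\<sigma> n) p) \<longlonglongrightarrow> 0"
    using g unfolding complete_metric_def by blast
  then have "(\<lambda>n. K.rdist (\<sigma> n) p) \<longlonglongrightarrow> 0"
    by (intro K.rdist_tendsto_of_tendsto G.tendsto_of_rdist_tendsto)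
  then show "\<exists>p. (\<lambda>n. K.rdist (\<sigma> n) p) \<longlonglongrightarrow> 0" by blast
qed

text \<open>A subsequence \<open>\<tau>\<close> of a \<open>g\<close>-Cauchy sequence can be moved along the orbits to a \<open>gK\<close>-Cauchy
  sequence \<open>x\<^sub>k = act s\<^sub>k \<tau>\<^sub>k\<close>; compactness of the torus makes a further subsequence of \<open>\<tau>\<close> converge.\<close>
lemma complete_K_imp_complete:
  assumes gK: "complete_metric \<A> gK"
  shows "complete_metric \<A> g"
  unfolding complete_metric_def
proof (intro allI impI)
  fix \<sigma> :: "nat \<Rightarrow> 'a"
  assume cauchy: "\<forall>\<epsilon>>0. \<exists>N. \<forall>m\<ge>N. \<forall>n\<ge>N. G.rdist (\<sigma> m) (\<sigma> n) < \<epsilon>"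
  obtain N where N: "\<And>k m n. m \<ge> N k \<Longrightarrow> n \<ge> N k \<Longrightarrow> G.rdist (\<sigma> m) (\<sigma> n) < (1/2) ^ k"
  proof -
    have "\<exists>N. \<forall>m\<ge>N. \<forall>n\<ge>N. G.rdist (\<sigma> m) (\<sigma> n) < (1/2) ^ k" for k using cauchy by simp
    then show ?thesis using that by metis
  qed
  \<comment> \<open>Partial sums with every term at least 1: strictly increasing, and never below
    \<open>N k\<close>.\<close>
  define r where "r k = (\<Sum>i\<le>k. N i + 1)" for k
  have rN: "r k \<ge> N k" for k
    unfolding r_def using member_le_sum[of k "{..k}" "\<lambda>i. N i + 1"] by simp
  have r_mono: "r k < r (Suc k)" for k by (simp add: r_def)
  then have sr: "strict_mono r" by (simp add: strict_mono_Suc_iff)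
  have step: "G.rdist (\<sigma> (r k)) (\<sigma> (r (Suc k))) < (1/2) ^ k" for k
    using rN[of k] r_mono[of k] by (intro N) auto
  \<comment> \<open>The rotations are chosen successively. Given \<open>s\<close>, the orbit
    estimate supplies \<open>t\<close> for the unrotated points; since the torus acts by
    \<open>gK\<close>-isometries, \<open>s + t\<close> serves for the rotated ones, and it is then
    reduced to the cube.\<close>
  have "\<exists>s. \<forall>k. s k \<in> cbox 0 (\<chi> i. 2 * pi) \<and>
      K.rdist (act (s k) (\<sigma> (r k))) (act (s (Suc k)) (\<sigma> (r (Suc k)))) < (1/2) ^ k"
  proof (rule dependent_nat_choice)
    show "\<exists>s::real ^ 'n. s \<in> cbox 0 (\<chi> i. 2 * pi)" using act_fundamental_domain by blast
    fix s :: "real ^ 'n" and k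
    obtain t where t: "K.rdist (\<sigma> (r k)) (act t (\<sigma> (r (Suc k)))) < (1/2) ^ k"
      using orbit_rdist_less[OF step] by blast
    obtain s' where s': "s' \<in> cbox 0 (\<chi> i. 2 * pi)" "act (s + t) = act s'"
      using act_fundamental_domain by blast
    have "K.rdist (act s (\<sigma> (r k))) (act s' (\<sigma> (r (Suc k)))) < (1/2) ^ k"
      using rdist_act_le[of s "\<sigma> (r k)" "act t (\<sigma> (r (Suc k)))"] t s'(2) by (simp flip: act_add)
    then show "\<exists>s'. s' \<in> cbox 0 (\<chi> i. 2 * pi) \<and>
        K.rdist (act s (\<sigma> (r k))) (act s' (\<sigma> (r (Suc k)))) < (1/2) ^ k" using s' by blast
  qed
  then obtain s where s: "\<And>k. s k \<in> cbox 0 (\<chi> i. 2 * pi)"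
    "\<And>k. K.rdist (act (s k) (\<sigma> (r k))) (act (s (Suc k)) (\<sigma> (r (Suc k)))) < (1/2) ^ k" by blast
  define x where "x k = act (s k) (\<sigma> (r k))" for k
  \<comment> \<open>The bound is the exact geometric sum from \<open>m\<close> to
    \<open>n - 1\<close>; this form, unlike its limit, survives the induction step.\<close>
  have tail: "K.rdist (x m) (x n) \<le> 2 * (1/2) ^ m - 2 * (1/2) ^ n" if "m \<le> n" for m n
    using that
  proof (induction n rule: dec_induct)
    case base
    then show ?case by (simp add: K.rdist_self)
  next
    case (step n)
    then show ?case using K.rdist_triangle[of "x m" "x (Suc n)" "x n"] s(2)[of n] by (simp add: x_def)
  qed
  have tail': "K.rdist (x m) (x n) \<le> 2 * (1/2) ^ M" if "M \<le> m" "M \<le> n" for M m n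
  proof -
    have "K.rdist (x m) (x n) \<le> 2 * (1/2) ^ min m n"
      using tail[of m n] tail[of n m] K.rdist_commute[of "x m" "x n"]
      by (cases "m \<le> n") (auto simp: min_def intro: order_trans)
    also have "\<dots> \<le> 2 * (1/2) ^ M" using that by (intro mult_left_mono power_decreasing) auto
    finally show ?thesis .
  qed
  have "\<forall>\<epsilon>>0. \<exists>N. \<forall>m\<ge>N. \<forall>n\<ge>N. K.rdist (x m) (x n) < \<epsilon>"
  proof (intro allI impI)
    fix \<epsilon> :: real assume "\<epsilon> > 0"
    then obtain M where "(1/2) ^ M < \<epsilon> / 2" using real_arch_pow_inv[of "\<epsilon> / 2" "1/2"] by auto
    then show "\<exists>N. \<forall>m\<ge>N. \<forall>n\<ge>N. K.rdist (x m) (x n) < \<epsilon>"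
      using tail'[of M] by (intro exI[of _ M]) (force intro: le_less_trans)
  qed
  then obtain y where "(\<lambda>k. K.rdist (x k) y) \<longlonglongrightarrow> 0"
    using gK unfolding complete_metric_def by blast
  then have xy: "x \<longlonglongrightarrow> y" by (rule K.tendsto_of_rdist_tendsto)
  have "compact (cbox 0 (\<chi> i. 2 * pi) :: (real ^ 'n) set)" by (rule compact_cbox)
  then obtain t q where q: "strict_mono (q :: nat \<Rightarrow> nat)" "(s \<circ> q) \<longlonglongrightarrow> t"
    using s(1) unfolding compact_def by blast
  \<comment> \<open>Undoing the rotations recovers the original subsequence. Both the rotation and
    the point vary, so joint continuity of the action is required.\<close>
  have "(\<lambda>k. (- s (q k), x (q k))) \<longlonglongrightarrow> (- t, y)"
    using q LIMSEQ_subseq_LIMSEQ[OF xy q(1)] by (intro tendsto_Pair tendsto_minus) (auto simp: o_def)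
  moreover have "isCont (\<lambda>(s, p). act s p) (- t, y)"
    using continuous_action by (simp add: continuous_on_eq_continuous_at)
  ultimately have "(\<lambda>k. (\<lambda>(s, p). act s p) (- s (q k), x (q k))) \<longlonglongrightarrow> (\<lambda>(s, p). act s p) (- t, y)"
    by (rule isCont_tendsto_compose[rotated])
  then have "(\<lambda>k. \<sigma> (r (q k))) \<longlonglongrightarrow> act (- t) y" by (simp add: x_def)
  then have lim: "(\<lambda>k. G.rdist (\<sigma> (r (q k))) (act (- t) y)) \<longlonglongrightarrow> 0"
    by (rule G.rdist_tendsto_of_tendsto)
  \<comment> \<open>A Cauchy sequence converges to the limit of any of its subsequences;
    \<open>k \<le> r (q k)\<close> places the chosen term beyond \<open>N1\<close>.\<close>
  have "(\<lambda>n. G.rdist (\<sigma> n) (act (- t) y)) \<longlonglongrightarrow> 0"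
  proof (rule LIMSEQ_I)
    fix \<epsilon> :: real assume "\<epsilon> > 0"
    then have \<epsilon>2: "\<epsilon> / 2 > 0" by simp
    obtain N1 where N1: "\<And>m n. m \<ge> N1 \<Longrightarrow> n \<ge> N1 \<Longrightarrow> G.rdist (\<sigma> m) (\<sigma> n) < \<epsilon> / 2"
      using cauchy \<epsilon>2 by blast
    obtain N2 where N2: "\<And>k. k \<ge> N2 \<Longrightarrow> norm (G.rdist (\<sigma> (r (q k))) (act (- t) y) - 0) < \<epsilon> / 2"
      using LIMSEQ_D[OF lim \<epsilon>2] by blast
    define k where "k = max N1 N2"
    have "k \<le> r (q k)"
      using seq_suble[OF sr, of "q k"] seq_suble[OF q(1), of k] by linarith
    then have rk: "r (q k) \<ge> N1" by (simp add: k_def)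
    have "norm (G.rdist (\<sigma> n) (act (- t) y) - 0) < \<epsilon>" if "n \<ge> N1" for n
      using G.rdist_triangle[of "\<sigma> n" "act (- t) y" "\<sigma> (r (q k))"] N1[OF that rk] N2[of k]
        G.rdist_nonneg[of "\<sigma> n" "act (- t) y"] by (simp add: k_def)
    then show "\<exists>no. \<forall>n\<ge>no. norm (G.rdist (\<sigma> n) (act (- t) y) - 0) < \<epsilon>" by blast
  qed
  then show "\<exists>p. (\<lambda>n. G.rdist (\<sigma> n) p) \<longlonglongrightarrow> 0" by blast
qed

end

theorem theorem1p2:
  fixes \<A> :: "('a::{t2_space, second_countable_topology}, (real ^ 'n) \<times> (real ^ 'n)) chart set"
    and F g gK :: "('a, (real ^ 'n) \<times> (real ^ 'n)) bilin"
    and I J JK :: "('a, (real ^ 'n) \<times> (real ^ 'n)) endo"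
    and f fK :: "'a \<Rightarrow> real"
    and act :: "real ^ 'n \<Rightarrow> 'a \<Rightarrow> 'a"
    and \<mu> :: "'a \<Rightarrow> real ^ 'n"
    and u :: "'d::finite \<Rightarrow> real ^ 'n" and l :: "'d \<Rightarrow> real"
    and A :: "real ^ 'n ^ 'n"
  assumes toric: "delzant_manifold \<A> F act \<mu> u l"
    and unbounded: "\<not> bounded (polytope_of u l)"
    and noncompact: "\<not> compact (UNIV :: 'a set)"
    and gkrs: "gk_ricci_soliton \<A> g I J f" "symplectic_type \<A> g I J F"
    and gkrs_invariant: "\<And>s. preserves_bilin \<A> (act s) g" "\<And>s. preserves_endo \<A> (act s) I"
      "\<And>s. preserves_endo \<A> (act s) J" "\<And>s p. f (act s p) = f p"
    and krs: "kahler_ricci_soliton \<A> gK JK fK"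
      "\<And>c p v w. c \<in> \<A> \<Longrightarrow> p \<in> chart_dom c \<Longrightarrow> F c p v w = gK c p (JK c p v) w"
    and krs_invariant: "\<And>s. preserves_bilin \<A> (act s) gK" "\<And>s. preserves_endo \<A> (act s) JK"
      "\<And>s p. fK (act s p) = fK p"
    and hyps: "toric_hypotheses \<A> (\<mu> -` interior (polytope_of u l)) act F g I J f"
    and skew: "transpose A = - A"
    and deformation: "A_deformation \<A> F act \<mu> (interior (polytope_of u l)) A gK JK g I J"
    and soliton_fields: "\<And>c p. c \<in> \<A> \<Longrightarrow> p \<in> chart_dom c \<Longrightarrow> \<mu> p \<in> interior (polytope_of u l) \<Longrightarrow>
      - ((1/2) *\<^sub>R JK c p (gradient gK fK c p))
        = (1/2) *\<^sub>R (soliton_field g I f c p + soliton_field g J f c p)"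
  shows "complete_metric \<A> g \<longleftrightarrow> complete_metric \<A> gK"
proof -
  have "hamiltonian_toric_manifold \<A> F act \<mu> (polytope_of u l)"
    using toric by (simp add: delzant_manifold_def)
  then have "maximal_atlas \<A>" "connected (UNIV :: 'a set)" "effective_torus_action \<A> act"
    by (auto simp: hamiltonian_toric_manifold_def)
  moreover have "riemannian_metric \<A> g" "riemannian_metric \<A> gK"
    using gkrs(1) krs(1)
    by (auto simp: gk_ricci_soliton_def generalized_kahler_def kahler_ricci_soliton_def kahler_def)
  ultimately interpret toric_deformation \<A> act F \<mu> u l g gK I J JK A
    using toric krs_invariant(1) skew deformation by unfold_locales
  show ?thesis using complete_imp_complete_K complete_K_imp_complete by blast
qed

end
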